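(* Let $I_{\mathbb{H}}=\{(h,m)\in\mathbb{N}^2: 2m\le h\}$. There is a Hilbert space orthogonal direct sum decomposition $$L^2(\mathbb{S})=\widehat{\bigoplus_{(h,m)\in I_{\mathbb{H}}}}\mathcal{H}_{h,m}$$ with the following properties. (i) $\mathcal{H}_{h,m}$ is $\overline{\mathrm{Sp}(1)}\cdot\mathrm{Sp}(n)$-invariant and finite-dimensional, and $$\dim\mathcal{H}_{h,m}=\frac{(h-2m+1)^2(h+2n-1)}{(2n-2)(2n-1)}\binom{h-m+2n-2}{2n-3}\binom{m+2n-3}{2n-3}.$$ (ii) The elements of $\mathcal{H}_{h,m}$ are joint eigenfunctions of $\Delta_{\mathbb{S}}$ and $\Gamma$ of eigenvalues $$\lambda^{\Delta_{\mathbb{S}}}_{h,m}=h(h+4n-2),\qquad \lambda^{\Gamma}_{h,m}=(h-2m)(h-2m+2)$$ respectively. In particular, they are eigenfunctions of $\mathfrak{L}$ of eigenvalue $$\lambda^{\mathfrak{L}}_{h,m}=4m(h-m+1)+4(n-1)h.$$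
   Context: Let $\mathbb{H}$ be the skew field of quaternions with imaginary units $\mathbf{i},\mathbf{j},\mathbf{k}$ ($\mathbf{i}^2=\mathbf{j}^2=\mathbf{k}^2=\mathbf{i}\mathbf{j}\mathbf{k}=-1$), and let $n\ge 2$ be an integer. $\mathbb{H}^n$ is a left $\mathbb{H}$-module, with quaternionic inner product $\langle x,y\rangle=\sum_{j=1}^n x_j\overline{y_j}\in\mathbb{H}$; $\Re\langle\cdot,\cdot\rangle$ is the Euclidean inner product of $\mathbb{H}^n\cong\mathbb{R}^{4n}$. $\mathbb{S}=\{x\in\mathbb{H}^n:\langle x,x\rangle=1\}$ is the unit sphere, with the Riemannian metric induced by $\Re\langle\cdot,\cdot\rangle$ and the rotation-invariant probability measure $\sigma$, with respect to which $L^2(\mathbb{S})$ is defined. $\mathbb{N}$ includes $0$. $\Delta_{\mathbb{S}}$ is the nonnegative Laplace–Beltrami operator on $\mathbb{S}$. For $\mathbf{u}\in\{\mathbf{i},\mathbf{j},\mathbf{k}\}$ let $T_{\mathbf{u}}f(x)=\frac{d}{dt}\big|_{t=0}f(\exp(-t\mathbf{u})x)$ (the vector field $x\mapsto-\mathbf{u}x$), and $\Gamma=-(T_{\mathbf{i}}^2+T_{\mathbf{j}}^2+T_{\mathbf{k}}^2)$. The sub-Laplacian on $\mathbb{S}$ associated with the horizontal distribution $H_x\mathbb{S}=\{y\in\mathbb{H}^n:\langle x,y\rangle=0\}$ is $\mathfrak{L}=\Delta_{\mathbb{S}}-\Gamma$. $\mathrm{Sp}(n)$ is the group of (left) $\mathbb{H}$-linear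 maps of $\mathbb{H}^n$ preserving $\Re\langle\cdot,\cdot\rangle$; $\overline{\mathrm{Sp}(1)}$ is the group of $\mathbb{R}$-linear maps $x\mapsto cx$ of $\mathbb{H}^n$ with $c\in\mathbb{H}$, $|c|=1$; $\overline{\mathrm{Sp}(1)}\cdot\mathrm{Sp}(n)$ is the subgroup of $\mathrm{O}(4n)$ generated by them. It acts on functions on $\mathbb{S}$ by composition. *)

theory Defs
  imports
    "HOL-Probability.Probability"
    "HOL-Library.Function_Algebras"
    "HOL-Algebra.Generated_Groups"
begin

section \<open>The skew field of quaternions\<close>

datatype quat = Quat (qRe: real) (qIm1: real) (qIm2: real) (qIm3: real)

lemma quat_eq_iff: "x = y \<longleftrightarrow> qRe x = qRe y \<and> qIm1 x = qIm1 y \<and> qIm2 x = qIm2 y \<and> qIm3 x = qIm3 y"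
  by (cases x; cases y) simp

instantiation quat :: ab_group_add
begin
definition zero_quat where "0 = Quat 0 0 0 0"
definition plus_quat where
  "x + y = Quat (qRe x + qRe y) (qIm1 x + qIm1 y) (qIm2 x + qIm2 y) (qIm3 x + qIm3 y)"
definition minus_quat where
  "x - y = Quat (qRe x - qRe y) (qIm1 x - qIm1 y) (qIm2 x - qIm2 y) (qIm3 x - qIm3 y)"
definition uminus_quat where
  "- x = Quat (- qRe x) (- qIm1 x) (- qIm2 x) (- qIm3 x)"
instance
  by standard (simp_all add: zero_quat_def plus_quat_def minus_quat_def uminus_quat_def quat_eq_iff)
end

definition quat_cnj :: "quat \<Rightarrow> quat" where
  "quat_cnj x = Quat (qRe x) (- qIm1 x) (- qIm2 x) (- qIm3 x)"

instantiation quat :: real_vector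
begin
definition scaleR_quat where
  "r *\<^sub>R x = Quat (r * qRe x) (r * qIm1 x) (r * qIm2 x) (r * qIm3 x)"
instance
  by standard (simp_all add: scaleR_quat_def plus_quat_def quat_eq_iff algebra_simps)
end

instantiation quat :: real_inner
begin
definition inner_quat :: "quat \<Rightarrow> quat \<Rightarrow> real" where
  "inner_quat x y = qRe x * qRe y + qIm1 x * qIm1 y + qIm2 x * qIm2 y + qIm3 x * qIm3 y"
definition norm_quat :: "quat \<Rightarrow> real" where "norm_quat x = sqrt (x \<bullet> x)"
definition dist_quat :: "quat \<Rightarrow> quat \<Rightarrow> real" where "dist_quat x y = norm (x - y)"
definition sgn_quat :: "quat \<Rightarrow> quat" where "sgn_quat x = x /\<^sub>R norm x"
definition uniformity_quat :: "(quat \<times> quat) filter" where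
  "uniformity_quat = (INF e\<in>{0<..}. principal {(x, y). dist x y < e})"
definition open_quat :: "quat set \<Rightarrow> bool" where
  "open_quat U \<longleftrightarrow> (\<forall>x\<in>U. eventually (\<lambda>(x', y). x' = x \<longrightarrow> y \<in> U) uniformity)"
instance
proof
  fix x y z :: quat and r :: real
  note defs = scaleR_quat_def inner_quat_def plus_quat_def zero_quat_def quat_eq_iff
  show "x \<bullet> y = y \<bullet> x" "(x + y) \<bullet> z = x \<bullet> z + y \<bullet> z" "(r *\<^sub>R x) \<bullet> y = r * (x \<bullet> y)" "0 \<le> x \<bullet> x"
    by (simp_all add: defs algebra_simps)
  show "x \<bullet> x = 0 \<longleftrightarrow> x = 0"
    by (simp add: defs) (smt (verit) mult_eq_0_iff zero_le_square)
  show "norm x = sqrt (x \<bullet> x)" by (rule norm_quat_def)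
  show "dist x y = norm (x - y)" by (rule dist_quat_def)
  show "sgn x = x /\<^sub>R norm x" by (rule sgn_quat_def)
  show "uniformity = (INF e\<in>{0<..}. principal {(x :: quat, y). dist x y < e})"
    by (rule uniformity_quat_def)
  show "open U \<longleftrightarrow> (\<forall>x\<in>U. eventually (\<lambda>(x', y). x' = x \<longrightarrow> y \<in> U) uniformity)" for U :: "quat set"
    by (rule open_quat_def)
qed
end

instantiation quat :: real_normed_div_algebra
begin
definition one_quat where "1 = Quat 1 0 0 0"
definition times_quat where
  "x * y = Quat
    (qRe x * qRe y - qIm1 x * qIm1 y - qIm2 x * qIm2 y - qIm3 x * qIm3 y)
    (qRe x * qIm1 y + qIm1 x * qRe y + qIm2 x * qIm3 y - qIm3 x * qIm2 y)
    (qRe x * qIm2 y - qIm1 x * qIm3 y + qIm2 x * qRe y + qIm3 x * qIm1 y)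
    (qRe x * qIm3 y + qIm1 x * qIm2 y - qIm2 x * qIm1 y + qIm3 x * qRe y)"
definition inverse_quat :: "quat \<Rightarrow> quat" where "inverse_quat x = quat_cnj x /\<^sub>R (x \<bullet> x)"
definition divide_quat :: "quat \<Rightarrow> quat \<Rightarrow> quat" where "divide_quat x y = x * inverse y"
instance
proof
  fix x y z :: quat and r :: real
  note defs = scaleR_quat_def plus_quat_def zero_quat_def one_quat_def times_quat_def quat_eq_iff
  show "x * y * z = x * (y * z)" "(x + y) * z = x * z + y * z" "x * (y + z) = x * y + x * z"
    "1 * x = x" "x * 1 = x" "(0::quat) \<noteq> 1"
    "r *\<^sub>R x * y = r *\<^sub>R (x * y)" "x * r *\<^sub>R y = r *\<^sub>R (x * y)"
    by (simp_all add: defs algebra_simps)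
  have cnj: "quat_cnj x * x = Quat (x \<bullet> x) 0 0 0" "x * quat_cnj x = Quat (x \<bullet> x) 0 0 0"
    by (simp_all add: defs quat_cnj_def inner_quat_def algebra_simps)
  have sc: "r *\<^sub>R u * v = r *\<^sub>R (u * v)" "u * r *\<^sub>R v = r *\<^sub>R (u * v)" for u v :: quat and r
    by (simp_all add: defs algebra_simps)
  show "inverse x * x = 1" "x * inverse x = 1" if "x \<noteq> 0"
    using that by (simp_all add: inverse_quat_def sc cnj) (simp_all add: scaleR_quat_def one_quat_def)
  show "x div y = x * inverse y" by (rule divide_quat_def)
  show "inverse (0::quat) = 0"
    by (simp add: inverse_quat_def quat_cnj_def scaleR_quat_def zero_quat_def)
  have "(x * y) \<bullet> (x * y) = (x \<bullet> x) * (y \<bullet> y)"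
    by (simp add: inner_quat_def times_quat_def algebra_simps)
  then show "norm (x * y) = norm x * norm y"
    by (simp add: norm_quat_def real_sqrt_mult)
qed
end

definition quat_i :: quat where "quat_i = Quat 0 1 0 0"
definition quat_j :: quat where "quat_j = Quat 0 0 1 0"
definition quat_k :: quat where "quat_k = Quat 0 0 0 1"

lemma quat_units: "quat_i * quat_i = - 1" "quat_j * quat_j = - 1" "quat_k * quat_k = - 1" "quat_i * quat_j * quat_k = - 1"
  by (simp_all add: quat_i_def quat_j_def quat_k_def times_quat_def uminus_quat_def one_quat_def)

instantiation quat :: euclidean_space
begin
definition Basis_quat :: "quat set" where "Basis_quat = {1, quat_i, quat_j, quat_k}"
instance
proof
  note defs = Basis_quat_def one_quat_def quat_i_def quat_j_def quat_k_def inner_quat_def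
  show "(Basis :: quat set) \<noteq> {}" "finite (Basis :: quat set)"
    by (simp_all add: Basis_quat_def)
  show "u \<bullet> v = (if u = v then 1 else 0)" if "u \<in> Basis" "v \<in> Basis" for u v :: quat
    using that unfolding Basis_quat_def
    by (elim insertE emptyE; hypsubst) (simp_all add: inner_quat_def one_quat_def quat_i_def quat_j_def quat_k_def)
  show "(\<forall>u\<in>Basis. x \<bullet> u = 0) \<longleftrightarrow> x = 0" for x :: quat
    by (simp add: defs quat_eq_iff[of x] zero_quat_def)
qed
end


section \<open>Quaternionic $n$-space and its unit sphere\<close>

text \<open>
  Quaternionic $n$-space is \<^typ>\<open>quat ^ 'n\<close>, with left scalar multiplication
  \<^term>\<open>c *s x\<close> for \<^term>\<open>c :: quat\<close>.
\<close>

definition qinner :: "quat ^ 'n \<Rightarrow> quat ^ 'n \<Rightarrow> quat" where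
  "qinner x y = (\<Sum>j\<in>UNIV. x $ j * quat_cnj (y $ j))"

lemma qRe_sum: "qRe (sum f A) = (\<Sum>a\<in>A. qRe (f a))"
  by (induction A rule: infinite_finite_induct) (simp_all add: zero_quat_def plus_quat_def)

lemma qRe_qinner: "qRe (qinner x y) = x \<bullet> y"
  by (simp add: qinner_def qRe_sum inner_vec_def times_quat_def quat_cnj_def inner_quat_def)

definition qsphere :: "(quat ^ 'n) set" where
  "qsphere = {x. qinner x x = 1}"

lemma qinner_self: "qinner x x = of_real (x \<bullet> x)"
proof -
  have "x $ j * quat_cnj (x $ j) = of_real (x $ j \<bullet> x $ j)" for j
    by (simp add: quat_eq_iff times_quat_def quat_cnj_def inner_quat_def of_real_def scaleR_quat_def
        one_quat_def)
  then show ?thesis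
    by (simp add: qinner_def inner_vec_def)
qed

lemma qsphere_eq_sphere: "qsphere = sphere 0 1"
  by (auto simp: qsphere_def qinner_self norm_eq_1)

definition rotation_invariant_prob :: "(quat ^ 'n) measure \<Rightarrow> bool" where
  "rotation_invariant_prob \<sigma> \<longleftrightarrow>
     prob_space \<sigma> \<and> sets \<sigma> = sets (restrict_space borel qsphere) \<and>
     (\<forall>A. orthogonal_transformation A \<longrightarrow> distr \<sigma> \<sigma> A = \<sigma>)"

lemma emeasure_lborel_vimage_orthogonal:
  fixes A :: "'a::euclidean_space \<Rightarrow> 'a"
  assumes A: "orthogonal_transformation A" and U: "open U"
  shows "emeasure lborel (A -` U) = emeasure lborel U"
proof -
  have bij: "bij A" and inv: "orthogonal_transformation (inv_into UNIV A)" and lin: "linear A"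
    using A by (simp_all add: orthogonal_transformation_bij orthogonal_transformation_inv
        orthogonal_transformation_linear)
  have cont: "continuous_on UNIV A"
    using lin by (simp add: linear_continuous_on linear_conv_bounded_linear)
  have vim: "A -` S = inv_into UNIV A ` S" for S
    using bij by (simp add: bij_vimage_eq_inv_image)
  have [measurable]: "A -` S \<in> sets borel" if "S \<in> sets borel" for S
    using measurable_sets[OF borel_measurable_continuous_onI[OF cont] that] by simp
  have ball: "A -` ball x r = ball (inv_into UNIV A x) r" for x r
  proof -
    have "dist x (A y) = dist (inv_into UNIV A x) y" for y
      using orthogonal_transformation_isometry[of A] A bij_inv_eq_iff[OF bij]
      by (metis)
    then show ?thesis by auto
  qed
  define K where "K = {i. 0 < snd i \<and> ball (fst i) (snd i) \<subseteq> U}"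
  have cover: "\<exists>i. i \<in> K \<and> x \<in> ball (fst i) (snd i) \<and> snd i < d" if x: "x \<in> U" and d: "0 < d" for x d
  proof -
    obtain e where e: "0 < e" "ball x e \<subseteq> U"
      using U x by (meson openE)
    then have "(x, min e (d/2)) \<in> K"
      using d by (auto simp: K_def)
    with e d show ?thesis by (intro exI[of _ "(x, min e (d/2))"]) auto
  qed
  obtain C where C: "countable C" "C \<subseteq> K"
      "pairwise (\<lambda>i j. disjnt (ball (fst i) (snd i)) (ball (fst j) (snd j))) C"
      "negligible (U - (\<Union>i\<in>C. ball (fst i) (snd i)))"
    using Vitali_covering_theorem_balls[of U K fst snd, OF cover] by blast
  define B where "B = (\<Union>i\<in>C. ball (fst i) (snd i))"
  have sub: "B \<subseteq> U" using C(2) unfolding B_def K_def by blast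
  have oB: "open B" by (auto simp: B_def)
  have oAB: "open (A -` B)" using oB cont by (metis open_vimage)
  have null: "U - B \<in> null_sets lborel"
    using C(4) U oB by (auto simp: B_def[symmetric] negligible_iff_null_sets null_sets_completion_iff)
  have "negligible (inv_into UNIV A ` (U - B))"
    by (rule negligible_differentiable_image_negligible)
      (use C(4) inv in \<open>auto simp: B_def[symmetric] intro!: linear_imp_differentiable_on orthogonal_transformation_linear\<close>)
  then have null': "A -` (U - B) \<in> null_sets lborel"
    using U oB by (subst (asm) negligible_iff_null_sets, subst (asm) vim[symmetric])
       (simp add: null_sets_completion_iff)
  have disj: "disjoint_family_on (\<lambda>i. ball (fst i) (snd i)) C"
    using C(3) by (auto simp: pairwise_def disjoint_family_on_def disjnt_def)
  have eqB: "emeasure lborel (A -` B) = emeasure lborel B"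
  proof -
    have "emeasure lborel (A -` B) = (\<integral>\<^sup>+i. emeasure lborel (A -` ball (fst i) (snd i)) \<partial>count_space C)"
      unfolding B_def vimage_UN
      by (rule emeasure_UN_countable)
        (use C(1) disj in \<open>auto simp: ball disjoint_family_on_def simp flip: ball vimage_Int\<close>)
    also have "\<dots> = (\<integral>\<^sup>+i. emeasure lborel (ball (fst i) (snd i)) \<partial>count_space C)"
      by (rule nn_integral_cong)
        (use C(2) in \<open>auto simp: ball K_def emeasure_ball subset_iff less_imp_le\<close>)
    also have "\<dots> = emeasure lborel B"
      unfolding B_def by (rule emeasure_UN_countable[symmetric]) (use C(1) disj in auto)
    finally show ?thesis .
  qed
  have "U = B \<union> (U - B)" "A -` U = A -` B \<union> A -` (U - B)"
    using sub by auto
  then show ?thesis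
    using eqB emeasure_Un_null_set[OF _ null] emeasure_Un_null_set[OF _ null'] oB oAB
    by (metis borel_open sets_lborel)
qed

lemma distr_lborel_orthogonal:
  fixes A :: "'a::euclidean_space \<Rightarrow> 'a"
  assumes A: "orthogonal_transformation A"
  shows "distr lborel borel A = lborel"
proof (rule lborel_eqI[symmetric])
  have [measurable]: "A \<in> borel_measurable borel"
    using orthogonal_transformation_linear[OF A]
    by (intro borel_measurable_continuous_onI) (simp add: linear_continuous_on linear_conv_bounded_linear)
  show "emeasure (distr lborel borel A) (box l u) = (\<Prod>b\<in>Basis. (u - l) \<bullet> b)"
    if "\<And>b. b \<in> Basis \<Longrightarrow> l \<bullet> b \<le> u \<bullet> b" for l u
    using that by (simp add: emeasure_distr emeasure_lborel_vimage_orthogonal[OF A open_box]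
        emeasure_lborel_box)
qed simp

lemma rotation_invariant_prob_exists:
  "\<exists>\<sigma> :: (quat ^ 'n) measure. rotation_invariant_prob \<sigma>"
proof -
  let ?B = "ball 0 1 :: (quat ^ 'n) set"
  define N where "N = uniform_measure lborel ?B"
  obtain e :: "quat ^ 'n" where e: "norm e = 1"
    using vector_choose_size[of 1] by auto
  define g where "g x = (if x = 0 then e else x /\<^sub>R norm x)" for x
  define R where "R = restrict_space borel (qsphere :: (quat ^ 'n) set)"
  have B: "emeasure lborel ?B \<noteq> 0" "emeasure lborel ?B \<noteq> \<infinity>"
    by (auto simp: emeasure_ball unit_ball_vol_pos[THEN less_imp_neq, symmetric])
  have sN [measurable_cong]: "sets N = sets borel"
    by (simp add: N_def)
  have "g \<in> borel_measurable borel"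
    unfolding g_def by measurable
  then have g: "g \<in> measurable borel R"
    unfolding R_def by (intro measurable_restrict_space2) (auto simp: g_def e qsphere_eq_sphere)
  then have gN: "g \<in> measurable N R"
    using sN by (simp cong: measurable_cong_sets)
  have AE0: "AE x in N. x \<noteq> 0"
    unfolding N_def using AE_lborel_singleton[of "0 :: quat ^ 'n"]
    by (intro AE_uniform_measureI) auto
  have "rotation_invariant_prob (distr N R g)"
    unfolding rotation_invariant_prob_def
  proof (intro conjI allI impI)
    show "prob_space (distr N R g)"
      using gN B unfolding N_def
      by (intro prob_space.prob_space_distr prob_space_uniform_measure) auto
    show "sets (distr N R g) = sets (restrict_space borel qsphere)"
      by (simp add: R_def)
    fix A :: "quat ^ 'n \<Rightarrow> quat ^ 'n"
    assume A: "orthogonal_transformation A"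
    have lin: "linear A" and nA: "norm (A x) = norm x" for x
      using A by (simp_all add: orthogonal_transformation_linear orthogonal_transformation_norm)
    have mA [measurable]: "A \<in> borel_measurable borel"
      using lin by (intro borel_measurable_continuous_onI)
        (simp add: linear_continuous_on linear_conv_bounded_linear)
    have AR: "A \<in> measurable R R"
      unfolding R_def
      by (intro measurable_restrict_space3) (auto simp: qsphere_eq_sphere nA)
    have AN: "distr N borel A = N"
    proof (rule measure_eqI)
      fix S assume "S \<in> sets (distr N borel A)"
      then have S: "S \<in> sets borel" by simp
      then have AS: "A -` S \<in> sets borel"
        using measurable_sets[OF mA] by simp
      have "emeasure (distr N borel A) S = emeasure N (A -` S)"
        using S by (subst emeasure_distr) (simp_all add: N_def)
      also have "\<dots> = emeasure lborel (?B \<inter> A -` S) / emeasure lborel ?B"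
        unfolding N_def using AS by (intro emeasure_uniform_measure) auto
      also have "?B \<inter> A -` S = A -` (?B \<inter> S)"
        by (auto simp: nA)
      also have "emeasure lborel (A -` (?B \<inter> S)) = emeasure (distr lborel borel A) (?B \<inter> S)"
        using S by (subst emeasure_distr) auto
      also have "\<dots> = emeasure lborel (?B \<inter> S)"
        by (simp add: distr_lborel_orthogonal[OF A])
      also have "\<dots> / emeasure lborel ?B = emeasure N S"
        unfolding N_def using S by (intro emeasure_uniform_measure[symmetric]) auto
      finally show "emeasure (distr N borel A) S = emeasure N S" .
    qed (simp add: sN)
    have mAN: "A \<in> measurable N borel" by measurable
    have "distr (distr N R g) (distr N R g) A = distr (distr N R g) R A"
      by (rule distr_cong) auto
    also have "\<dots> = distr N R (A \<circ> g)"
      by (rule distr_distr[OF AR gN])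
    also have "\<dots> = distr N R (g \<circ> A)"
    proof (rule distr_cong_AE)
      show "AE x in N. (A \<circ> g) x = (g \<circ> A) x"
        using AE0
      proof eventually_elim
        case (elim x)
        then have "A x \<noteq> 0" using nA[of x] by auto
        with elim show ?case
          by (simp add: g_def nA linear_cmul[OF lin])
      qed
    qed (use AR gN g mAN in \<open>auto intro: measurable_comp\<close>)
    also have "\<dots> = distr (distr N borel A) R g"
      by (rule distr_distr[OF g mAN, symmetric])
    finally show "distr (distr N R g) (distr N R g) A = distr N R g"
      by (simp add: AN)
  qed
  then show ?thesis by blast
qed


section \<open>Spaces of functions on the sphere\<close>

text \<open>
  A complex-valued function on the sphere is encoded as a function on \<^typ>\<open>quat ^ 'n\<close> that
  vanishes off \<^const>\<open>qsphere\<close>. With this normalization, spans and dimensions for the pointwise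
  operations are those of spaces of functions on the sphere.
\<close>

definition cscale :: "complex \<Rightarrow> ('a \<Rightarrow> complex) \<Rightarrow> 'a \<Rightarrow> complex" where
  "cscale c f = (\<lambda>x. c * f x)"

global_interpretation cfun: vector_space cscale
  by standard (simp_all add: cscale_def fun_eq_iff algebra_simps)

text \<open>
  \<open>L2 \<sigma>\<close> consists of functions rather than of classes modulo null functions, so \<^term>\<open>L2_norm \<sigma>\<close>
  is only a seminorm on it.
\<close>

definition L2 :: "(quat ^ 'n) measure \<Rightarrow> (quat ^ 'n \<Rightarrow> complex) set" where
  "L2 \<sigma> = {f. f \<in> borel_measurable \<sigma> \<and> integrable \<sigma> (\<lambda>x. (cmod (f x))\<^sup>2) \<and> (\<forall>x. x \<notin> qsphere \<longrightarrow> f x = 0)}"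

definition L2_inner ::
    "(quat ^ 'n) measure \<Rightarrow> (quat ^ 'n \<Rightarrow> complex) \<Rightarrow> (quat ^ 'n \<Rightarrow> complex) \<Rightarrow> complex" where
  "L2_inner \<sigma> f g = (LINT x|\<sigma>. f x * cnj (g x))"

definition L2_norm :: "(quat ^ 'n) measure \<Rightarrow> (quat ^ 'n \<Rightarrow> complex) \<Rightarrow> real" where
  "L2_norm \<sigma> f = sqrt (LINT x|\<sigma>. (cmod (f x))\<^sup>2)"

text \<open>
  The function spaces \<open>V i\<close> are (isomorphic to) closed subspaces of the Hilbert space of
  square-integrable functions modulo null functions: no two distinct elements of \<open>V i\<close> agree almost
  everywhere, and the image of \<open>V i\<close> in the quotient is closed. They are pairwise orthogonal, and
  the closure of their algebraic sum is the whole space.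
\<close>

definition hilbert_direct_sum ::
    "(quat ^ 'n) measure \<Rightarrow> 'i set \<Rightarrow> ('i \<Rightarrow> (quat ^ 'n \<Rightarrow> complex) set) \<Rightarrow> bool" where
  "hilbert_direct_sum \<sigma> I V \<longleftrightarrow>
     (\<forall>i\<in>I. V i \<subseteq> L2 \<sigma> \<and> cfun.subspace (V i) \<and>
        (\<forall>f\<in>V i. (AE x in \<sigma>. f x = 0) \<longrightarrow> f = 0) \<and>
        (\<forall>f\<in>L2 \<sigma>. (\<forall>\<epsilon>>0. \<exists>g\<in>V i. L2_norm \<sigma> (f - g) < \<epsilon>) \<longrightarrow>
           (\<exists>g\<in>V i. AE x in \<sigma>. f x = g x))) \<and>
     (\<forall>i\<in>I. \<forall>j\<in>I. i \<noteq> j \<longrightarrow> (\<forall>f\<in>V i. \<forall>g\<in>V j. L2_inner \<sigma> f g = 0)) \<and>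
     (\<forall>f\<in>L2 \<sigma>. \<forall>\<epsilon>>0. \<exists>g\<in>cfun.span (\<Union>i\<in>I. V i). L2_norm \<sigma> (f - g) < \<epsilon>)"


section \<open>Differential operators on the sphere\<close>

primrec Ck_on ::
    "nat \<Rightarrow> ('a::real_normed_vector \<Rightarrow> 'b::real_normed_vector) \<Rightarrow> 'a set \<Rightarrow> bool" where
  "Ck_on 0 F U \<longleftrightarrow> continuous_on U F"
| "Ck_on (Suc k) F U \<longleftrightarrow>
     (\<forall>x\<in>U. F differentiable (at x)) \<and> (\<forall>v. Ck_on k (\<lambda>x. frechet_derivative F (at x) v) U)"

definition smooth_on_qsphere :: "(quat ^ 'n \<Rightarrow> complex) \<Rightarrow> bool" where
  "smooth_on_qsphere f \<longleftrightarrow>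
     (\<exists>U F. open U \<and> qsphere \<subseteq> U \<and> (\<forall>k. Ck_on k F U) \<and> (\<forall>x\<in>qsphere. F x = f x))"

definition tangent_space :: "quat ^ 'n \<Rightarrow> (quat ^ 'n) set" where
  "tangent_space x = {v. x \<bullet> v = 0}"

definition tangent_proj :: "quat ^ 'n \<Rightarrow> quat ^ 'n \<Rightarrow> quat ^ 'n" where
  "tangent_proj x v = v - (x \<bullet> v) *\<^sub>R x"

text \<open>
  The derivative of a map along the sphere. The within-derivative is determined only on tangent
  vectors, and the definitions below apply it only to those.
\<close>

abbreviation sphere_deriv ::
    "(quat ^ 'n \<Rightarrow> 'b::real_normed_vector) \<Rightarrow> quat ^ 'n \<Rightarrow> quat ^ 'n \<Rightarrow> 'b" where
  "sphere_deriv f x \<equiv> frechet_derivative f (at x within qsphere)"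

text \<open>
  Gradient and divergence for the metric induced by the Euclidean inner product. The Levi-Civita
  covariant derivative of a tangent field \<open>X\<close> along \<open>v\<close> is the tangential part of the derivative of
  \<open>X\<close> along \<open>v\<close>, and the divergence is the trace over the tangent space of this map of \<open>v\<close>; the sum
  over the standard basis of the ambient space computes this trace, since \<^term>\<open>tangent_proj x\<close> is
  the orthogonal projection onto the tangent space at \<open>x\<close>.
\<close>

definition sphere_grad :: "(quat ^ 'n \<Rightarrow> real) \<Rightarrow> quat ^ 'n \<Rightarrow> quat ^ 'n" where
  "sphere_grad f x =
     (THE v. v \<in> tangent_space x \<and> (\<forall>w\<in>tangent_space x. v \<bullet> w = sphere_deriv f x w))"

definition sphere_div :: "(quat ^ 'n \<Rightarrow> quat ^ 'n) \<Rightarrow> quat ^ 'n \<Rightarrow> real" where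
  "sphere_div X x =
     (\<Sum>b\<in>Basis. tangent_proj x (sphere_deriv X x (tangent_proj x b)) \<bullet> b)"

definition real_laplace_beltrami :: "(quat ^ 'n \<Rightarrow> real) \<Rightarrow> quat ^ 'n \<Rightarrow> real" where
  "real_laplace_beltrami f x = - sphere_div (sphere_grad f) x"

definition laplace_beltrami :: "(quat ^ 'n \<Rightarrow> complex) \<Rightarrow> quat ^ 'n \<Rightarrow> complex" where
  "laplace_beltrami f x =
     Complex (real_laplace_beltrami (\<lambda>y. Re (f y)) x) (real_laplace_beltrami (\<lambda>y. Im (f y)) x)"

definition T_op :: "quat \<Rightarrow> (quat ^ 'n \<Rightarrow> complex) \<Rightarrow> quat ^ 'n \<Rightarrow> complex" where
  "T_op u f x = vector_derivative (\<lambda>t::real. f (exp (- (t *\<^sub>R u)) *s x)) (at 0)"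

definition Gamma_op :: "(quat ^ 'n \<Rightarrow> complex) \<Rightarrow> quat ^ 'n \<Rightarrow> complex" where
  "Gamma_op f x =
     - (T_op quat_i (T_op quat_i f) x + T_op quat_j (T_op quat_j f) x + T_op quat_k (T_op quat_k f) x)"

definition sub_laplacian :: "(quat ^ 'n \<Rightarrow> complex) \<Rightarrow> quat ^ 'n \<Rightarrow> complex" where
  "sub_laplacian f x = laplace_beltrami f x - Gamma_op f x"

text \<open>
  \<open>f\<close> lies in the \<open>\<mu>\<close>-eigenspace of \<open>D\<close>; as usual, the zero function is included. Smoothness is
  required because the operators above take unspecified values on non-differentiable functions.
\<close>

definition eigenfunction ::
    "((quat ^ 'n \<Rightarrow> complex) \<Rightarrow> quat ^ 'n \<Rightarrow> complex) \<Rightarrow> complex \<Rightarrow> (quat ^ 'n \<Rightarrow> complex) \<Rightarrow> bool" where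
  "eigenfunction D \<mu> f \<longleftrightarrow> smooth_on_qsphere f \<and> (\<forall>x\<in>qsphere. D f x = \<mu> * f x)"


section \<open>The symmetry group\<close>

definition orthogonal_group :: "(quat ^ 'n \<Rightarrow> quat ^ 'n) monoid" where
  "orthogonal_group =
     \<lparr>carrier = {A. orthogonal_transformation A}, mult = (\<lambda>A B. A \<circ> B), one = id\<rparr>"

definition Sp_group :: "(quat ^ 'n \<Rightarrow> quat ^ 'n) set" where
  "Sp_group = {A. (\<forall>x y. A (x + y) = A x + A y) \<and> (\<forall>c x. A (c *s x) = c *s A x) \<and>
     (\<forall>x y. A x \<bullet> A y = x \<bullet> y)}"

definition Sp1_bar :: "(quat ^ 'n \<Rightarrow> quat ^ 'n) set" where
  "Sp1_bar = {A. \<exists>c. norm c = 1 \<and> A = (\<lambda>x. c *s x)}"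

definition Sp1_Sp_group :: "(quat ^ 'n \<Rightarrow> quat ^ 'n) set" where
  "Sp1_Sp_group = generate orthogonal_group (Sp1_bar \<union> Sp_group)"


section \<open>The index set\<close>

definition I_H :: "(nat \<times> nat) set" where
  "I_H = {(h, m). 2 * m \<le> h}"

end

theory Submission
  imports Defs
begin

text \<open>
  Left multiplication by unit quaternions makes the polynomial functions on \<open>H\<^sup>n\<close> a representation of
  \<open>Sp(1)\<close>. In suitable complex linear coordinates these are the polynomials in \<open>2n\<close> doublets
  \<open>(p\<^sub>a, q\<^sub>a)\<close>: with \<open>x\<^sub>l = z\<^sub>l + w\<^sub>l j\<close> the doublets are \<open>(z\<^sub>l, cnj w\<^sub>l)\<close> and \<open>(w\<^sub>l, - cnj z\<^sub>l)\<close>. The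
  complexified Lie algebra \<open>sl\<^sub>2\<close> then acts by the raising operator \<open>E = \<Sum> p\<^sub>a \<partial>/\<partial>q\<^sub>a\<close> and the lowering
  operator \<open>F = \<Sum> q\<^sub>a \<partial>/\<partial>p\<^sub>a\<close>, and it commutes with the Laplacian. The component \<open>(h, m)\<close> consists of the
  restrictions to the sphere of the harmonic polynomials that are homogeneous of degree \<open>h\<close> and lie in
  the isotypic component of \<open>sl\<^sub>2\<close> with highest weight \<open>h - 2 m\<close>. That component is cut out by one
  eigenvalue equation for \<open>C F (x) = \<Sum>\<^sub>u D\<^sup>2F(x)(u x, u x)\<close>, where \<open>u\<close> runs over the basis \<open>1, i, j, k\<close>
  (lemma \<open>isotypic_iff\<close>). The operator \<open>C\<close> is \<open>h (h + 2)\<close> minus \<open>\<Gamma>\<close> on homogeneous polynomials of degree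
  \<open>h\<close>, so the eigenvalues of \<open>\<Gamma>\<close> come for free.

  The algebra rests on the Fischer inner product, for which multiplication by a variable is adjoint to
  differentiation with respect to it. Hence \<open>E\<close> is adjoint to \<open>F\<close> and the Laplacian is adjoint to
  multiplication by \<open>|x|\<^sup>2\<close>. If \<open>T T\<^sup>*\<close> equals \<open>T\<^sup>* T\<close> plus a positive scalar, then \<open>T T\<^sup>*\<close> is injective,
  so \<open>T\<close> is onto in finite dimension; both commutators \<open>[E, F]\<close> and \<open>[\<Delta>, |x|\<^sup>2]\<close> have this form. This
  gives the decomposition of polynomials into harmonic ones times powers of \<open>|x|\<^sup>2\<close>, and it reduces all
  dimensions to the count of monomials of given bidegree (\<open>dim_harmonic\<close>, \<open>dim_isotypic\<close>). The same
  positivity, applied to \<open>F E\<close> and \<open>E F\<close> as scalars, decides which weights occur (\<open>isotypic_weight_range\<close>).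

  The invariance under \<open>Sp(1) Sp(n)\<close> holds because the Laplacian and \<open>C\<close> are traces of a bilinear form
  over an orthonormal basis, and the group changes these bases orthogonally (\<open>trace_orthogonal\<close>,
  \<open>isotypic_invariant\<close>).

  On the sphere, the derivative of a function along a rotation field has integral zero, by the
  invariance of the measure (\<open>integral_infinitesimal_rotation\<close>). Thus squares of such fields are
  symmetric, and so are the sum over all coordinate planes and the sum over \<open>i, j, k\<close>. The components
  have distinct eigenvalues for this pair of operators and are therefore orthogonal
  (\<open>isotypic_orthogonal\<close>). Completeness is the Stone--Weierstrass theorem together with the density of
  continuous functions in \<open>L\<^sup>2\<close> (\<open>approximable_L2\<close>). Finally, the operators of the theorem are computed on
  restrictions of polynomials from the first two derivatives in the ambient space
  (\<open>real_laplace_beltrami_eq\<close>, \<open>T_op_on_sphere\<close>).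
\<close>

section \<open>Linear algebra of finite-dimensional function spaces\<close>

interpretation cpair: vector_space_pair cscale cscale ..

abbreviation clinear :: "(('a \<Rightarrow> complex) \<Rightarrow> 'b \<Rightarrow> complex) \<Rightarrow> bool" where
  "clinear \<equiv> Vector_Spaces.linear cscale cscale"

lemma clinearI:
  assumes "\<And>f g. T (f + g) = T f + T g" "\<And>c f. T (cscale c f) = cscale c (T f)"
  shows "clinear T"
  using assms by (simp add: Vector_Spaces.linear_iff cfun.vector_space_axioms)

definition fin_dim :: "('a \<Rightarrow> complex) set \<Rightarrow> bool" where
  "fin_dim V \<longleftrightarrow> cfun.subspace V \<and> (\<exists>B. finite B \<and> V \<subseteq> cfun.span B)"

lemma fin_dim_subspace: "fin_dim V \<Longrightarrow> cfun.subspace V"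
  by (simp add: fin_dim_def)

lemma fin_dim_subset: "fin_dim W \<Longrightarrow> V \<subseteq> W \<Longrightarrow> cfun.subspace V \<Longrightarrow> fin_dim V"
  unfolding fin_dim_def by blast

lemma fin_dim_basis:
  assumes "fin_dim V"
  obtains B where "finite B" "B \<subseteq> V" "cfun.independent B" "cfun.span B = V" "card B = cfun.dim V"
proof -
  obtain B where B: "B \<subseteq> V" "cfun.independent B" "V \<subseteq> cfun.span B" "card B = cfun.dim V"
    by (rule cfun.basis_exists)
  obtain C where C: "finite C" "V \<subseteq> cfun.span C" using assms by (auto simp: fin_dim_def)
  have "finite B" using cfun.independent_span_bound[OF C(1) B(2)] B(1) C(2) by blast
  moreover have "cfun.span B = V"
    using B assms by (metis fin_dim_def cfun.span_minimal subset_antisym)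
  ultimately show thesis using that B by blast
qed

lemma fin_dim_image:
  assumes "fin_dim V" "clinear T"
  shows "fin_dim (T ` V)"
proof -
  obtain B where B: "finite B" "cfun.span B = V" using fin_dim_basis[OF assms(1)] by metis
  have "T ` V = cfun.span (T ` B)"
    using cpair.linear_span_image[OF assms(2)] B by simp
  then show ?thesis using B by (auto simp: fin_dim_def)
qed

lemma clinear_0: "clinear T \<Longrightarrow> T 0 = 0"
  by (rule cpair.linear_0)

lemma kernel_subspace:
  assumes "cfun.subspace V" "clinear T"
  shows "cfun.subspace {v \<in> V. T v = 0}"
  using assms unfolding cfun.subspace_def
  by (auto simp: cpair.linear_0 cpair.linear_add cpair.linear_scale)

text \<open>
  A basis of the kernel is extended to one of \<open>V\<close>, and \<open>T\<close> is injective on the span of the added vectors.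
\<close>

lemma rank_nullity:
  assumes V: "fin_dim V" and T: "clinear T"
  shows "cfun.dim V = cfun.dim {v \<in> V. T v = 0} + cfun.dim (T ` V)"
proof -
  define K where "K = {v \<in> V. T v = 0}"
  have K: "fin_dim K"
    using kernel_subspace[OF fin_dim_subspace[OF V] T] V unfolding K_def fin_dim_def by blast
  obtain B where B: "finite B" "B \<subseteq> K" "cfun.independent B" "cfun.span B = K" "card B = cfun.dim K"
    using fin_dim_basis[OF K] .
  have "B \<subseteq> V" using B by (auto simp: K_def)
  then obtain C where C: "B \<subseteq> C" "C \<subseteq> V" "cfun.independent C" "V \<subseteq> cfun.span C"
    using cfun.maximal_independent_subset_extend[OF _ B(3)] by metis
  obtain S where S: "finite S" "V \<subseteq> cfun.span S" using V by (auto simp: fin_dim_def)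
  have fC: "finite C"
    using cfun.independent_span_bound[OF S(1) C(3)] C S by blast
  have sC: "cfun.span C = V"
    using C V by (metis fin_dim_def cfun.span_minimal subset_antisym)
  define D where "D = C - B"
  have BD: "B \<inter> D = {}" "C = B \<union> D" "finite D" using C fC by (auto simp: D_def)
  (* An element of the span of the added vectors that is in the kernel is in the span of both parts of the basis. *)
  have meet: "x = 0" if xD: "x \<in> cfun.span D" "T x = 0" for x
  proof -
    have "x \<in> V" using that sC BD cfun.span_mono[of D C] by auto
    then have "x \<in> cfun.span B" using that B by (auto simp: K_def)
    then obtain u where u: "x = (\<Sum>b\<in>B. cscale (u b) b)"
      using cfun.span_finite[OF B(1)] by auto
    obtain w where w: "x = (\<Sum>b\<in>D. cscale (w b) b)"
      using xD(1) cfun.span_finite[OF BD(3)] by auto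
    define c where "c = (\<lambda>b. if b \<in> B then u b else - w b)"
    have "(\<Sum>b\<in>C. cscale (c b) b) = (\<Sum>b\<in>B. cscale (c b) b) + (\<Sum>b\<in>D. cscale (c b) b)"
      unfolding BD(2) using BD B(1) by (intro sum.union_disjoint) auto
    also have "(\<Sum>b\<in>B. cscale (c b) b) = x" unfolding u by (rule sum.cong) (auto simp: c_def)
    also have "(\<Sum>b\<in>D. cscale (c b) b) = (\<Sum>b\<in>D. - cscale (w b) b)"
      using BD by (intro sum.cong) (auto simp: c_def)
    also have "\<dots> = - x" unfolding w by (rule sum_negf)
    finally have "(\<Sum>b\<in>C. cscale (c b) b) = 0" by (simp add: zero_fun_def)
    then have "c b = 0" if "b \<in> C" for b
      using cfun.independentD[OF C(3) fC] that by blast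
    then have "u b = 0" if "b \<in> B" for b using that C(1) by (force simp: c_def)
    then show "x = 0" unfolding u by (simp add: sum.neutral)
  qed
  have inj: "inj_on T (cfun.span D)"
    by (rule inj_onI) (metis T cfun.span_diff cpair.linear_diff eq_iff_diff_eq_0 meet)
  have "cfun.independent D" using cfun.independent_mono[OF C(3)] BD by auto
  then have indT: "cfun.independent (T ` D)"
    using cpair.linear_independent_injective_image[OF T] inj by blast
  have "T ` V \<subseteq> cfun.span (T ` D)"
  proof -
    have "T ` V = cfun.span (T ` C)" using cpair.linear_span_image[OF T] sC by simp
    also have "\<dots> \<subseteq> cfun.span (T ` D)"
    proof (rule cfun.span_minimal)
      show "T ` C \<subseteq> cfun.span (T ` D)"
        using B(2) by (auto simp: BD(2) K_def cfun.span_base cfun.span_zero subset_iff)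
    qed simp
    finally show ?thesis .
  qed
  moreover have "T ` D \<subseteq> T ` V" using C by (auto simp: D_def)
  ultimately have "cfun.dim (T ` V) = card (T ` D)"
    using cfun.basis_card_eq_dim[OF _ _ indT] by metis
  also have "\<dots> = card D"
    using inj by (intro card_image inj_on_subset[OF inj]) (auto intro: cfun.span_base)
  finally have "cfun.dim (T ` V) = card D" .
  moreover have "cfun.dim V = card C" using cfun.dim_unique[of C V "card C"] C by simp
  moreover have "card C = card B + card D" unfolding BD(2) using BD B by (intro card_Un_disjoint) auto
  ultimately show ?thesis using B unfolding K_def by simp
qed

lemma dim_image_injective:
  assumes V: "fin_dim V" and T: "clinear T" and inj: "\<And>v. v \<in> V \<Longrightarrow> T v = 0 \<Longrightarrow> v = 0"
  shows "cfun.dim (T ` V) = cfun.dim V"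
proof -
  have "{v \<in> V. T v = 0} \<subseteq> cfun.span {}" using inj by auto
  then have "cfun.dim {v \<in> V. T v = 0} = 0" using cfun.dim_le_card[of _ "{}"] by simp
  then show ?thesis using rank_nullity[OF V T] by simp
qed

lemma subspace_eq_if_dim_eq:
  assumes W: "fin_dim W" and V: "cfun.subspace V" "V \<subseteq> W" and dim: "cfun.dim V = cfun.dim W"
  shows "V = W"
proof (rule ccontr)
  assume "V \<noteq> W"
  then obtain w where w: "w \<in> W" "w \<notin> V" using V by blast
  obtain B where B: "finite B" "B \<subseteq> V" "cfun.independent B" "cfun.span B = V" "card B = cfun.dim V"
    using fin_dim_basis fin_dim_subset[OF W V(2,1)] by metis
  obtain C where C: "finite C" "C \<subseteq> W" "cfun.independent C" "cfun.span C = W" "card C = cfun.dim W"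
    using fin_dim_basis W by metis
  have "cfun.independent (insert w B)" using w B by (intro cfun.independent_insertI) auto
  moreover have "insert w B \<subseteq> cfun.span C" using w B C V by auto
  ultimately have "card (insert w B) \<le> card C" using cfun.independent_span_bound[OF C(1)] by blast
  moreover have "w \<notin> B" using w B by blast
  ultimately show False using B C dim by simp
qed

text \<open>
  The surjectivity of the Laplacian and of the raising and lowering operators is obtained from this
  lemma, applied to the product of the operator with its adjoint.
\<close>

lemma injective_endomorphism_surjective:
  assumes W: "fin_dim W" and T: "clinear T" and TW: "T ` W \<subseteq> W"
    and inj: "\<And>v. v \<in> W \<Longrightarrow> T v = 0 \<Longrightarrow> v = 0"
  shows "T ` W = W"
  by (rule subspace_eq_if_dim_eq[OF W fin_dim_subspace[OF fin_dim_image[OF W T]] TW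
        dim_image_injective[OF W T inj]])

lemma sum_fun_apply: "(\<Sum>i\<in>A. f i) x = (\<Sum>i\<in>A. f i x)" for f :: "'i \<Rightarrow> 'a \<Rightarrow> complex"
  by (induction A rule: infinite_finite_induct) auto

lemma supported_fin_dim:
  fixes A :: "'a set"
  assumes A: "finite A"
  defines "V \<equiv> {f :: 'a \<Rightarrow> complex. \<forall>e. f e \<noteq> 0 \<longrightarrow> e \<in> A}"
  shows "fin_dim V" "cfun.dim V = card A"
proof -
  have "V = {f. \<forall>e. e \<notin> A \<longrightarrow> f e = 0}" unfolding V_def by blast
  then have sub: "cfun.subspace V" unfolding cfun.subspace_def by (simp add: cscale_def)
  define \<delta> :: "'a \<Rightarrow> 'a \<Rightarrow> complex" where "\<delta> = (\<lambda>a e. if e = a then 1 else 0 :: complex)"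
  have inj: "inj \<delta>" unfolding \<delta>_def by (rule injI) (metis zero_neq_one)
  have rep: "(\<Sum>b\<in>\<delta> ` A. cscale (u b) b) e = (if e \<in> A then u (\<delta> e) else 0)" for u e
  proof -
    have "(\<Sum>b\<in>\<delta> ` A. cscale (u b) b) e = (\<Sum>a\<in>A. u (\<delta> a) * \<delta> a e)"
      by (subst sum.reindex) (use inj in \<open>auto simp: sum_fun_apply cscale_def intro: inj_on_subset\<close>)
    also have "\<dots> = (\<Sum>a\<in>A. if a = e then u (\<delta> a) else 0)"
      by (rule sum.cong) (auto simp: \<delta>_def)
    also have "\<dots> = (if e \<in> A then u (\<delta> e) else 0)" using A by (simp add: sum.delta')
    finally show ?thesis .
  qed
  have span: "V \<subseteq> cfun.span (\<delta> ` A)"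
  proof
    fix f assume f: "f \<in> V"
    have "f = (\<Sum>b\<in>\<delta> ` A. cscale (f (inv_into UNIV \<delta> b)) b)"
      using f by (auto simp: rep V_def inj fun_eq_iff)
    then show "f \<in> cfun.span (\<delta> ` A)"
      by (metis (no_types, lifting) cfun.span_base cfun.span_scale cfun.span_sum)
  qed
  have "cfun.independent (\<delta> ` A)"
  proof (rule cfun.independent_if_scalars_zero)
    fix u x assume 0: "(\<Sum>b\<in>\<delta> ` A. cscale (u b) b) = 0" and "x \<in> \<delta> ` A"
    then obtain a where a: "x = \<delta> a" "a \<in> A" by blast
    show "u x = 0" using rep[of u a] a by (simp add: 0)
  qed (use A in auto)
  moreover have "\<delta> ` A \<subseteq> V" by (auto simp: V_def \<delta>_def split: if_splits)
  ultimately have "card (\<delta> ` A) = cfun.dim V" using span by (intro cfun.basis_card_eq_dim) auto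
  then show "cfun.dim V = card A" using card_image[OF inj_on_subset[OF inj]] by (metis subset_UNIV)
  show "fin_dim V" using sub span A unfolding fin_dim_def by blast
qed

section \<open>Formal polynomials\<close>

text \<open>
  A polynomial in variables indexed by \<open>'i\<close> is encoded by its coefficient function on exponents.
  Finiteness is a separate predicate, used for the inner product and for evaluation; the differential
  algebra takes place on all coefficient functions.
\<close>

definition pdiff :: "'i \<Rightarrow> (('i \<Rightarrow> nat) \<Rightarrow> complex) \<Rightarrow> ('i \<Rightarrow> nat) \<Rightarrow> complex" where
  "pdiff i f = (\<lambda>e. of_nat (Suc (e i)) * f (e(i := Suc (e i))))"

definition xmul :: "'i \<Rightarrow> (('i \<Rightarrow> nat) \<Rightarrow> complex) \<Rightarrow> ('i \<Rightarrow> nat) \<Rightarrow> complex" where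
  "xmul i f = (\<lambda>e. if e i = 0 then 0 else f (e(i := e i - 1)))"

lemma pdiff_commute: "pdiff i (pdiff j f) = pdiff j (pdiff i f)"
  by (cases "i = j") (auto simp: pdiff_def fun_eq_iff fun_upd_twist)

lemma xmul_commute: "xmul i (xmul j f) = xmul j (xmul i f)"
  by (cases "i = j") (auto simp: xmul_def fun_eq_iff fun_upd_twist)

lemma pdiff_xmul: "pdiff i (xmul j f) = xmul j (pdiff i f) + (if i = j then f else 0)"
proof (cases "i = j")
  case True
  have "of_nat (Suc (e j)) * f e = (if e j = 0 then 0 else of_nat (e j) * f e) + f e" for e
    by (simp add: algebra_simps)
  then show ?thesis using True by (auto simp: pdiff_def xmul_def fun_eq_iff)
next
  case False
  then show ?thesis by (auto simp: pdiff_def xmul_def fun_eq_iff fun_upd_twist)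
qed

lemma clinear_pdiff: "clinear (pdiff i)"
  by (rule clinearI) (auto simp: pdiff_def cscale_def fun_eq_iff algebra_simps)

lemma clinear_xmul: "clinear (xmul i)"
  by (rule clinearI) (auto simp: xmul_def cscale_def fun_eq_iff)

lemma clinear_add: "clinear T \<Longrightarrow> T (f + g) = T f + T g"
  by (rule cpair.linear_add)
lemma clinear_diff: "clinear T \<Longrightarrow> T (f - g) = T f - T g"
  by (rule cpair.linear_diff)
lemma clinear_scale: "clinear T \<Longrightarrow> T (cscale c f) = cscale c (T f)"
  by (rule cpair.linear_scale)
lemma clinear_sum: "clinear T \<Longrightarrow> T (sum f A) = (\<Sum>a\<in>A. T (f a))"
  by (rule cpair.linear_sum)

lemma clinear_compose: "clinear S \<Longrightarrow> clinear T \<Longrightarrow> clinear (\<lambda>f. T (S f))"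
  by (rule clinearI) (simp_all add: clinear_add[of S] clinear_add[of T] clinear_scale[of S] clinear_scale[of T])

lemma clinear_minus: "clinear S \<Longrightarrow> clinear T \<Longrightarrow> clinear (\<lambda>f. S f - T f)"
  by (rule clinearI) (simp_all add: clinear_add[of S] clinear_add[of T] clinear_scale[of S] clinear_scale[of T]
      cfun.scale_right_diff_distrib algebra_simps)

lemma clinear_setsum:
  assumes "\<And>a. a \<in> A \<Longrightarrow> clinear (T a)"
  shows "clinear (\<lambda>f. \<Sum>a\<in>A. T a f)"
proof (rule clinearI)
  show "(\<Sum>a\<in>A. T a (f + g)) = (\<Sum>a\<in>A. T a f) + (\<Sum>a\<in>A. T a g)" for f g
    unfolding sum.distrib[symmetric] by (intro sum.cong refl clinear_add assms)
  show "(\<Sum>a\<in>A. T a (cscale c f)) = cscale c (\<Sum>a\<in>A. T a f)" for c f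
    unfolding cfun.scale_sum_right by (intro sum.cong refl clinear_scale assms)
qed

lemmas linear_ops = clinear_add[OF clinear_pdiff] clinear_diff[OF clinear_pdiff]
  clinear_sum[OF clinear_pdiff] clinear_scale[OF clinear_pdiff] clinear_0[OF clinear_pdiff]
  clinear_add[OF clinear_xmul] clinear_diff[OF clinear_xmul]
  clinear_sum[OF clinear_xmul] clinear_scale[OF clinear_xmul] clinear_0[OF clinear_xmul]

subsection \<open>The action of \<open>gl\<^sub>2\<close>\<close>

text \<open>
  The variables \<open>(a, False)\<close> and \<open>(a, True)\<close> are the entries \<open>p\<^sub>a\<close> and \<open>q\<^sub>a\<close> of the \<open>a\<close>-th doublet. These
  are the four operators of the action of \<open>gl\<^sub>2\<close> that transforms all doublets simultaneously.
\<close>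

definition polarization ::
    "bool \<Rightarrow> bool \<Rightarrow> (('a::finite \<times> bool \<Rightarrow> nat) \<Rightarrow> complex) \<Rightarrow> ('a \<times> bool \<Rightarrow> nat) \<Rightarrow> complex" where
  "polarization s t f = (\<Sum>a\<in>UNIV. xmul (a, s) (pdiff (a, t) f))"

text \<open>
  Read as operators of \<open>sl\<^sub>2\<close>, the raising operator moves one unit of degree from the second row of
  variables to the first, and the lowering operator moves it back.
\<close>

abbreviation raising :: "(('a::finite \<times> bool \<Rightarrow> nat) \<Rightarrow> complex) \<Rightarrow> ('a \<times> bool \<Rightarrow> nat) \<Rightarrow> complex" where
  "raising \<equiv> polarization False True"

abbreviation lowering :: "(('a::finite \<times> bool \<Rightarrow> nat) \<Rightarrow> complex) \<Rightarrow> ('a \<times> bool \<Rightarrow> nat) \<Rightarrow> complex" where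
  "lowering \<equiv> polarization True False"

lemma clinear_polarization: "clinear (polarization s t)"
  unfolding polarization_def [abs_def]
  by (intro clinear_setsum clinear_compose[OF clinear_pdiff clinear_xmul])

lemma pdiff_polarization:
  "pdiff (a, r) (polarization s t f) =
     polarization s t (pdiff (a, r) f) + (if r = s then pdiff (a, t) f else 0)"
proof -
  have "pdiff (a, r) (polarization s t f) =
      (\<Sum>b\<in>UNIV. xmul (b, s) (pdiff (b, t) (pdiff (a, r) f)) + (if r = s \<and> a = b then pdiff (b, t) f else 0))"
    unfolding polarization_def
    by (auto simp: linear_ops pdiff_xmul pdiff_commute[of "(a, r)"] intro!: sum.cong)
  also have "\<dots> = polarization s t (pdiff (a, r) f) + (if r = s then pdiff (a, t) f else 0)"
    by (auto simp: sum.distrib polarization_def)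
  finally show ?thesis .
qed

lemma polarization_xmul:
  "polarization s t (xmul (a, r) f) =
     xmul (a, r) (polarization s t f) + (if r = t then xmul (a, s) f else 0)"
proof -
  have "polarization s t (xmul (a, r) f) =
      (\<Sum>b\<in>UNIV. xmul (a, r) (xmul (b, s) (pdiff (b, t) f)) + (if r = t \<and> a = b then xmul (b, s) f else 0))"
    unfolding polarization_def
    by (auto simp: linear_ops pdiff_xmul xmul_commute[of "(a, r)"] intro!: sum.cong)
  also have "\<dots> = xmul (a, r) (polarization s t f) + (if r = t then xmul (a, s) f else 0)"
    by (auto simp: sum.distrib polarization_def linear_ops)
  finally show ?thesis .
qed

text \<open>
  The commutation relations of \<open>gl\<^sub>2\<close>.
\<close>

lemma polarization_commutator:
  "polarization s t (polarization u v f) = polarization u v (polarization s t f)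
     + (if t = u then polarization s v f else 0) - (if s = v then polarization u t f else 0)"
proof -
  have "polarization s t (polarization u v f) = (\<Sum>a\<in>UNIV. polarization s t (xmul (a, u) (pdiff (a, v) f)))"
    by (subst (2) polarization_def) (simp add: clinear_sum[OF clinear_polarization])
  also have "\<dots> = (\<Sum>a\<in>UNIV. xmul (a, u) (pdiff (a, v) (polarization s t f))
      + (if t = u then xmul (a, s) (pdiff (a, v) f) else 0)
      - (if s = v then xmul (a, u) (pdiff (a, t) f) else 0))"
    by (rule sum.cong) (auto simp: polarization_xmul pdiff_polarization linear_ops algebra_simps)
  also have "\<dots> = polarization u v (polarization s t f)
     + (if t = u then polarization s v f else 0) - (if s = v then polarization u t f else 0)"
    by (auto simp: sum.distrib sum_subtractf polarization_def)
  finally show ?thesis .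
qed

definition bidegree :: "bool \<Rightarrow> ('a::finite \<times> bool \<Rightarrow> nat) \<Rightarrow> nat" where
  "bidegree s e = (\<Sum>a\<in>UNIV. e (a, s))"

text \<open>
  The diagonal operators count degrees, so bihomogeneous polynomials are their joint eigenvectors; this
  turns all statements on degrees below into consequences of the commutation relations.
\<close>

lemma polarization_diag: "polarization s s f e = of_nat (bidegree s e) * f e"
proof -
  have "xmul (a, s) (pdiff (a, s) f) e = of_nat (e (a, s)) * f e" for a
    by (auto simp: xmul_def pdiff_def)
  then show ?thesis by (simp add: polarization_def bidegree_def sum_fun_apply sum_distrib_right)
qed

definition exponents :: "nat \<Rightarrow> nat \<Rightarrow> ('a::finite \<times> bool \<Rightarrow> nat) set" where
  "exponents \<alpha> \<beta> = {e. bidegree False e = \<alpha> \<and> bidegree True e = \<beta>}"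

definition bihom :: "nat \<Rightarrow> nat \<Rightarrow> (('a::finite \<times> bool \<Rightarrow> nat) \<Rightarrow> complex) set" where
  "bihom \<alpha> \<beta> = {f. \<forall>e. f e \<noteq> 0 \<longrightarrow> e \<in> exponents \<alpha> \<beta>}"

lemma bihom_iff: "f \<in> bihom \<alpha> \<beta> \<longleftrightarrow>
    polarization False False f = cscale (of_nat \<alpha>) f \<and> polarization True True f = cscale (of_nat \<beta>) f"
  by (auto simp: bihom_def exponents_def fun_eq_iff polarization_diag cscale_def)

text \<open>
  Exponents of total degree \<open>k\<close> are multisets of size \<open>k\<close>.
\<close>

lemma sum_fun_nat_bij:
  "bij_betw count (multisets_of_size (UNIV :: 'a::finite set) k) {g :: 'a \<Rightarrow> nat. sum g UNIV = k}"
proof (rule bij_betw_imageI)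
  show "inj_on count (multisets_of_size UNIV k)"
    by (rule inj_onI) (rule multiset_eqI, simp)
  have size: "size M = sum (count M) UNIV" for M :: "'a multiset"
    unfolding size_multiset_overloaded_eq by (rule sum.mono_neutral_left) (auto simp: count_eq_zero_iff)
  show "count ` multisets_of_size (UNIV :: 'a set) k = {g. sum g UNIV = k}"
  proof (intro equalityI subsetI)
    fix g assume "g \<in> {g :: 'a \<Rightarrow> nat. sum g UNIV = k}"
    then have "g = count (Abs_multiset g)" "size (Abs_multiset g) = k"
      by (simp_all add: size)
    then show "g \<in> count ` multisets_of_size UNIV k"
      unfolding multisets_of_size_def by (intro image_eqI[of _ _ "Abs_multiset g"]) auto
  qed (auto simp: multisets_of_size_def size)
qed

lemma card_sum_fun_nat:
  "finite {g :: 'a::finite \<Rightarrow> nat. sum g UNIV = k}"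
  "card {g :: 'a::finite \<Rightarrow> nat. sum g UNIV = k} = (CARD('a) + k - 1) choose k"
proof -
  show "finite {g :: 'a \<Rightarrow> nat. sum g UNIV = k}"
    using bij_betw_finite[OF sum_fun_nat_bij] finite_multisets_of_size by (metis finite_class.finite_UNIV)
  show "card {g :: 'a \<Rightarrow> nat. sum g UNIV = k} = (CARD('a) + k - 1) choose k"
    using bij_betw_same_card[OF sum_fun_nat_bij] card_multisets_of_size by (metis finite_class.finite_UNIV)
qed

lemma exponents_bij:
  "bij_betw (\<lambda>(g, h). \<lambda>(a, s). if s then h a else g a)
     ({g :: 'a::finite \<Rightarrow> nat. sum g UNIV = \<alpha>} \<times> {h. sum h UNIV = \<beta>}) (exponents \<alpha> \<beta>)"
proof (rule bij_betw_byWitness[where f' = "\<lambda>e. (\<lambda>a. e (a, False), \<lambda>a. e (a, True))"])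
qed (auto simp: exponents_def bidegree_def fun_eq_iff)

lemma card_exponents:
  "finite (exponents \<alpha> \<beta> :: ('a::finite \<times> bool \<Rightarrow> nat) set)"
  "card (exponents \<alpha> \<beta> :: ('a \<times> bool \<Rightarrow> nat) set) =
    ((CARD('a) + \<alpha> - 1) choose \<alpha>) * ((CARD('a) + \<beta> - 1) choose \<beta>)"
  using bij_betw_finite[OF exponents_bij[where 'a = 'a], of \<alpha> \<beta>]
    bij_betw_same_card[OF exponents_bij[where 'a = 'a], of \<alpha> \<beta>] card_sum_fun_nat[where 'a = 'a]
  by (auto simp: card_cartesian_product)

lemma fin_dim_bihom: "fin_dim (bihom \<alpha> \<beta>)"
  unfolding bihom_def by (rule supported_fin_dim[OF card_exponents(1)])

lemma dim_bihom: "cfun.dim (bihom \<alpha> \<beta> :: (('a::finite \<times> bool \<Rightarrow> nat) \<Rightarrow> complex) set) =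
    ((CARD('a) + \<alpha> - 1) choose \<alpha>) * ((CARD('a) + \<beta> - 1) choose \<beta>)"
  unfolding bihom_def card_exponents(2)[symmetric] by (rule supported_fin_dim[OF card_exponents(1)])

lemma bihom_subspace: "cfun.subspace (bihom \<alpha> \<beta>)"
  by (rule fin_dim_subspace[OF fin_dim_bihom])

subsection \<open>The Laplacian\<close>

text \<open>
  The variable \<open>((j, s), t)\<close> belongs to the \<open>j\<close>-th quaternionic coordinate. Each such coordinate carries
  two doublets, numbered by \<open>s\<close>, for the left action of the unit quaternions, and \<open>t\<close> is the position in
  the doublet.
\<close>

type_synonym 'n qpoly = "(('n \<times> bool) \<times> bool \<Rightarrow> nat) \<Rightarrow> complex"

text \<open>
  This is one quarter of the Laplacian of the Euclidean space: in the coordinates used here, the Euclidean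
  form pairs \<open>p\<close> of one doublet with \<open>q\<close> of the other one of the same quaternionic coordinate, with a sign.
  It is the symplectic form that \<open>sl\<^sub>2\<close> preserves, which is why the Laplacian commutes with \<open>sl\<^sub>2\<close>.
\<close>

definition laplace :: "('n::finite) qpoly \<Rightarrow> 'n qpoly" where
  "laplace f = (\<Sum>j\<in>UNIV. pdiff ((j, True), False) (pdiff ((j, False), True) f)
                        - pdiff ((j, False), False) (pdiff ((j, True), True) f))"

definition radius2 :: "('n::finite) qpoly \<Rightarrow> 'n qpoly" where
  "radius2 f = (\<Sum>j\<in>UNIV. xmul ((j, True), False) (xmul ((j, False), True) f)
                        - xmul ((j, False), False) (xmul ((j, True), True) f))"

lemma clinear_laplace: "clinear laplace"
  unfolding laplace_def [abs_def]
  by (intro clinear_setsum clinear_minus clinear_compose[OF clinear_pdiff clinear_pdiff])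

lemma clinear_radius2: "clinear radius2"
  unfolding radius2_def [abs_def]
  by (intro clinear_setsum clinear_minus clinear_compose[OF clinear_xmul clinear_xmul])

text \<open>
  For \<open>s \<noteq> t\<close> the two terms that differentiation of the new factors produces cancel by the antisymmetry
  of the form.
\<close>

lemma laplace_polarization:
  "s \<noteq> t \<Longrightarrow> laplace (polarization s t f) = polarization s t (laplace f)"
  by (cases s; cases t)
    (auto simp: laplace_def pdiff_polarization linear_ops clinear_sum[OF clinear_polarization]
      clinear_diff[OF clinear_polarization] pdiff_commute intro!: sum.cong)

lemma laplace_polarization_diag:
  "polarization s s (laplace f) = laplace (polarization s s f) - laplace f"
  by (cases s)
    (auto simp: laplace_def pdiff_polarization linear_ops clinear_sum[OF clinear_polarization]
      clinear_diff[OF clinear_polarization] algebra_simps sum.distrib sum_subtractf)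

lemma radius2_polarization_diag:
  "polarization s s (radius2 f) = radius2 (polarization s s f) + radius2 f"
  by (cases s)
    (auto simp: radius2_def polarization_xmul linear_ops clinear_sum[OF clinear_polarization]
      clinear_diff[OF clinear_polarization] algebra_simps sum.distrib sum_subtractf)

lemma pdiff_radius2:
  "pdiff ((j, True), False) (radius2 f) = radius2 (pdiff ((j, True), False) f) + xmul ((j, False), True) f"
  "pdiff ((j, False), True) (radius2 f) = radius2 (pdiff ((j, False), True) f) + xmul ((j, True), False) f"
  "pdiff ((j, False), False) (radius2 f) = radius2 (pdiff ((j, False), False) f) - xmul ((j, True), True) f"
  "pdiff ((j, True), True) (radius2 f) = radius2 (pdiff ((j, True), True) f) - xmul ((j, False), False) f"
proof -
  have *: "pdiff i (radius2 f) = radius2 (pdiff i f) +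
     (\<Sum>k\<in>UNIV. (if i = ((k, True), False) then xmul ((k, False), True) f else 0)
       + (if i = ((k, False), True) then xmul ((k, True), False) f else 0)
       - (if i = ((k, False), False) then xmul ((k, True), True) f else 0)
       - (if i = ((k, True), True) then xmul ((k, False), False) f else 0))" for i
    unfolding radius2_def sum.distrib[symmetric] linear_ops
    by (intro sum.cong) (auto simp: linear_ops pdiff_xmul algebra_simps)
  show "pdiff ((j, True), False) (radius2 f) = radius2 (pdiff ((j, True), False) f) + xmul ((j, False), True) f"
    "pdiff ((j, False), True) (radius2 f) = radius2 (pdiff ((j, False), True) f) + xmul ((j, True), False) f"
    "pdiff ((j, False), False) (radius2 f) = radius2 (pdiff ((j, False), False) f) - xmul ((j, True), True) f"
    "pdiff ((j, True), True) (radius2 f) = radius2 (pdiff ((j, True), True) f) - xmul ((j, False), False) f"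
    by (simp_all add: * sum_subtractf sum_negf)
qed

text \<open>
  The commutator is the total degree plus half the real dimension of the space, hence positive.
\<close>

lemma laplace_radius2:
  fixes f :: "('n::finite) qpoly"
  shows "laplace (radius2 f) = radius2 (laplace f) + polarization False False f + polarization True True f
    + cscale (of_nat (2 * CARD('n))) f"
proof -
  let ?t = "\<lambda>i. xmul i (pdiff i f)"
  have 1: "pdiff ((j, True), False) (pdiff ((j, False), True) (radius2 f))
      - pdiff ((j, False), False) (pdiff ((j, True), True) (radius2 f))
      = radius2 (pdiff ((j, True), False) (pdiff ((j, False), True) f)
          - pdiff ((j, False), False) (pdiff ((j, True), True) f))
        + (?t ((j, True), False) + ?t ((j, False), True) + ?t ((j, False), False) + ?t ((j, True), True)
        + cscale 2 f)" for j
    by (simp add: pdiff_radius2 linear_ops pdiff_xmul clinear_diff[OF clinear_radius2])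
      (simp add: fun_eq_iff cscale_def)
  have 2: "polarization s s f = (\<Sum>j\<in>UNIV. ?t ((j, True), s) + ?t ((j, False), s))" for s
  proof -
    have "polarization s s f = (\<Sum>(j, b)\<in>UNIV \<times> UNIV. ?t ((j, b), s))"
      by (simp add: polarization_def split_def)
    also have "\<dots> = (\<Sum>j\<in>UNIV. \<Sum>b\<in>UNIV. ?t ((j, b), s))"
      by (rule sum.cartesian_product[symmetric])
    also have "\<dots> = (\<Sum>j\<in>UNIV. ?t ((j, True), s) + ?t ((j, False), s))"
      by (simp add: UNIV_bool add.commute)
    finally show ?thesis .
  qed
  have 3: "cscale (of_nat (2 * CARD('n))) f = (\<Sum>j\<in>(UNIV::'n set). cscale 2 f)"
    by (auto simp: fun_eq_iff sum_fun_apply cscale_def)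
  show ?thesis
    unfolding 2 3 unfolding laplace_def clinear_sum[OF clinear_radius2] sum.distrib[symmetric]
    by (intro sum.cong refl) (simp only: 1 add.assoc, simp add: algebra_simps)
qed

section \<open>The Fischer inner product\<close>

definition fin_supp :: "('a \<Rightarrow> complex) \<Rightarrow> bool" where
  "fin_supp f \<longleftrightarrow> finite {e. f e \<noteq> 0}"

definition exp_fact :: "('i::finite \<Rightarrow> nat) \<Rightarrow> real" where
  "exp_fact e = (\<Prod>i\<in>UNIV. fact (e i))"

text \<open>
  Every monomial has as square norm the factorial of its exponent, the weight that makes
  multiplication by a variable adjoint to the derivative.
\<close>

definition fischer :: "(('i::finite \<Rightarrow> nat) \<Rightarrow> complex) \<Rightarrow> (('i \<Rightarrow> nat) \<Rightarrow> complex) \<Rightarrow> complex" where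
  "fischer f g = (\<Sum>e | f e \<noteq> 0. of_real (exp_fact e) * f e * cnj (g e))"

definition fischer_norm2 :: "(('i::finite \<Rightarrow> nat) \<Rightarrow> complex) \<Rightarrow> real" where
  "fischer_norm2 f = (\<Sum>e | f e \<noteq> 0. exp_fact e * (cmod (f e))\<^sup>2)"

lemma exp_fact_pos: "exp_fact e > 0"
  by (simp add: exp_fact_def prod_pos)

lemma exp_fact_Suc: "exp_fact (e(i := Suc (e i))) = of_nat (Suc (e i)) * exp_fact e"
proof -
  have "exp_fact (e(i := Suc (e i))) = fact (Suc (e i)) * (\<Prod>j\<in>UNIV - {i}. fact (e j))"
    unfolding exp_fact_def by (subst prod.remove[of _ i]) auto
  moreover have "exp_fact e = fact (e i) * (\<Prod>j\<in>UNIV - {i}. fact (e j))"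
    unfolding exp_fact_def by (subst prod.remove[of _ i]) auto
  ultimately show ?thesis by (simp add: algebra_simps)
qed

lemma fin_supp_0: "fin_supp 0" by (simp add: fin_supp_def)

lemma fin_supp_add: "fin_supp f \<Longrightarrow> fin_supp g \<Longrightarrow> fin_supp (f + g)"
  unfolding fin_supp_def by (rule finite_subset[of _ "{e. f e \<noteq> 0} \<union> {e. g e \<noteq> 0}"]) auto

lemma fin_supp_diff: "fin_supp f \<Longrightarrow> fin_supp g \<Longrightarrow> fin_supp (f - g)"
  unfolding fin_supp_def by (rule finite_subset[of _ "{e. f e \<noteq> 0} \<union> {e. g e \<noteq> 0}"]) auto

lemma fin_supp_scale: "fin_supp f \<Longrightarrow> fin_supp (cscale c f)"
  unfolding fin_supp_def by (rule finite_subset[of _ "{e. f e \<noteq> 0}"]) (auto simp: cscale_def)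

lemma fin_supp_sum: "(\<And>a. a \<in> A \<Longrightarrow> fin_supp (f a)) \<Longrightarrow> fin_supp (sum f A)"
  by (induction A rule: infinite_finite_induct) (simp_all add: fin_supp_0 fin_supp_add)

lemma xmul_support: "{e. xmul i f e \<noteq> 0} = (\<lambda>e. e(i := Suc (e i))) ` {e. f e \<noteq> 0}"
proof (intro equalityI subsetI)
  fix e assume "e \<in> {e. xmul i f e \<noteq> 0}"
  then have "e = (\<lambda>e. e(i := Suc (e i))) (e(i := e i - 1))" "f (e(i := e i - 1)) \<noteq> 0"
    by (auto simp: xmul_def split: if_splits)
  then show "e \<in> (\<lambda>e. e(i := Suc (e i))) ` {e. f e \<noteq> 0}" by blast
qed (auto simp: xmul_def)

lemma fin_supp_xmul: "fin_supp f \<Longrightarrow> fin_supp (xmul i f)"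
  by (simp add: fin_supp_def xmul_support)

lemma fin_supp_pdiff: "fin_supp f \<Longrightarrow> fin_supp (pdiff i f)"
  unfolding fin_supp_def
proof (rule finite_subset[of _ "(\<lambda>e. e(i := e i - 1)) ` {e. f e \<noteq> 0}"])
  show "{e. pdiff i f e \<noteq> 0} \<subseteq> (\<lambda>e. e(i := e i - 1)) ` {e. f e \<noteq> 0}"
    by (auto simp: pdiff_def intro!: image_eqI[of _ _ "_(i := Suc (_ i))"])
qed auto

lemma fin_supp_polarization: "fin_supp f \<Longrightarrow> fin_supp (polarization s t f)"
  unfolding polarization_def by (intro fin_supp_sum fin_supp_xmul fin_supp_pdiff)

lemma fin_supp_laplace: "fin_supp f \<Longrightarrow> fin_supp (laplace f)"
  unfolding laplace_def by (intro fin_supp_sum fin_supp_diff fin_supp_pdiff)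

lemma fin_supp_radius2: "fin_supp f \<Longrightarrow> fin_supp (radius2 f)"
  unfolding radius2_def by (intro fin_supp_sum fin_supp_diff fin_supp_xmul)

lemma fin_supp_bihom: "f \<in> bihom \<alpha> \<beta> \<Longrightarrow> fin_supp f"
  unfolding fin_supp_def bihom_def by (rule finite_subset[OF _ card_exponents(1)[of \<alpha> \<beta>]]) auto

lemma fischer_superset:
  assumes "finite A" "{e. f e \<noteq> 0} \<subseteq> A"
  shows "fischer f g = (\<Sum>e\<in>A. of_real (exp_fact e) * f e * cnj (g e))"
  unfolding fischer_def by (rule sum.mono_neutral_left) (use assms in auto)

lemma fischer_cnj:
  assumes "fin_supp f" "fin_supp g"
  shows "cnj (fischer f g) = fischer g f"
proof -
  let ?A = "{e. f e \<noteq> 0} \<union> {e. g e \<noteq> 0}"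
  have A: "finite ?A" "{e. f e \<noteq> 0} \<subseteq> ?A" "{e. g e \<noteq> 0} \<subseteq> ?A"
    using assms by (auto simp: fin_supp_def)
  show ?thesis
    unfolding fischer_superset[OF A(1,2)] fischer_superset[OF A(1,3)]
    by (simp add: algebra_simps)
qed

lemma fischer_add_right: "fischer f (g + h) = fischer f g + fischer f h"
  by (simp add: fischer_def algebra_simps sum.distrib)

lemma fischer_diff_right: "fischer f (g - h) = fischer f g - fischer f h"
  by (simp add: fischer_def algebra_simps sum_subtractf)

lemma fischer_0: "fischer f 0 = 0" "fischer 0 f = 0"
  by (simp_all add: fischer_def)

lemma fischer_sum_right: "fischer f (sum g A) = (\<Sum>a\<in>A. fischer f (g a))"
proof (induction A rule: infinite_finite_induct)
  case (insert x F)
  then show ?case unfolding sum.insert[OF insert(1,2)] fischer_add_right by simp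
qed (simp_all only: sum.infinite sum.empty fischer_0 not_False_eq_True)

lemma fischer_scale_right: "fischer f (cscale c g) = cnj c * fischer f g"
  by (simp add: fischer_def cscale_def sum_distrib_left algebra_simps)

lemma fischer_add_left: "fin_supp f \<Longrightarrow> fin_supp g \<Longrightarrow> fin_supp h \<Longrightarrow> fischer (f + g) h = fischer f h + fischer g h"
  by (metis fischer_cnj fischer_add_right fin_supp_add complex_cnj_add)

lemma fischer_diff_left: "fin_supp f \<Longrightarrow> fin_supp g \<Longrightarrow> fin_supp h \<Longrightarrow> fischer (f - g) h = fischer f h - fischer g h"
  by (metis fischer_cnj fischer_diff_right fin_supp_diff complex_cnj_diff)

lemma fischer_sum_left:
  "(\<And>a. a \<in> A \<Longrightarrow> fin_supp (f a)) \<Longrightarrow> fin_supp h \<Longrightarrow> fischer (sum f A) h = (\<Sum>a\<in>A. fischer (f a) h)"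
  by (induction A rule: infinite_finite_induct)
    (simp_all add: fischer_add_left fin_supp_sum fischer_0)

lemma fischer_pdiff_right: "fischer f (pdiff i g) = fischer (xmul i f) g"
proof -
  have "inj_on (\<lambda>e. e(i := Suc (e i))) A" for A :: "('a \<Rightarrow> nat) set"
    by (rule inj_onI) (metis fun_upd_idem_iff fun_upd_same fun_upd_upd nat.inject)
  then have "fischer (xmul i f) g = (\<Sum>e | f e \<noteq> 0. of_real (exp_fact (e(i := Suc (e i)))) *
      xmul i f (e(i := Suc (e i))) * cnj (g (e(i := Suc (e i)))))"
    unfolding fischer_def xmul_support by (subst sum.reindex) auto
  also have "\<dots> = fischer f (pdiff i g)"
    unfolding fischer_def by (rule sum.cong) (auto simp: exp_fact_Suc xmul_def pdiff_def)
  finally show ?thesis by simp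
qed

lemma fischer_xmul_right:
  "fin_supp f \<Longrightarrow> fin_supp g \<Longrightarrow> fischer f (xmul i g) = fischer (pdiff i f) g"
  by (metis fischer_pdiff_right fischer_cnj fin_supp_xmul fin_supp_pdiff)

lemma fischer_polarization:
  assumes "fin_supp f" "fin_supp g"
  shows "fischer f (polarization s t g) = fischer (polarization t s f) g"
  using assms unfolding polarization_def
  by (simp add: fischer_sum_right fischer_sum_left fischer_xmul_right fischer_pdiff_right
      fin_supp_xmul fin_supp_pdiff)

lemma fischer_radius2:
  assumes "fin_supp f" "fin_supp g"
  shows "fischer f (radius2 g) = fischer (laplace f) g"
  using assms unfolding radius2_def laplace_def
  by (simp add: fischer_sum_right fischer_sum_left fischer_diff_right fischer_diff_left
      fischer_xmul_right fin_supp_xmul fin_supp_pdiff fin_supp_diff pdiff_commute)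

lemma fischer_self: "fischer f f = of_real (fischer_norm2 f)"
  unfolding fischer_def fischer_norm2_def of_real_sum
  by (rule sum.cong) (simp_all add: mult.assoc complex_norm_square[symmetric])

lemma fischer_norm2_nonneg: "fischer_norm2 f \<ge> 0"
  unfolding fischer_norm2_def by (intro sum_nonneg mult_nonneg_nonneg) (auto simp: exp_fact_pos less_imp_le)

lemma fischer_norm2_eq_0:
  assumes "fin_supp f" "fischer_norm2 f = 0"
  shows "f = 0"
proof -
  have "exp_fact e * (cmod (f e))\<^sup>2 = 0" if "f e \<noteq> 0" for e
  proof -
    have "(\<Sum>e | f e \<noteq> 0. exp_fact e * (cmod (f e))\<^sup>2) = 0 \<longleftrightarrow>
        (\<forall>e\<in>{e. f e \<noteq> 0}. exp_fact e * (cmod (f e))\<^sup>2 = 0)"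
      using assms(1) by (intro sum_nonneg_eq_0_iff) (auto simp: fin_supp_def less_imp_le[OF exp_fact_pos])
    then show ?thesis using assms(2) that unfolding fischer_norm2_def by simp
  qed
  then have "f e = 0" for e using exp_fact_pos[of e] by force
  then show ?thesis by (simp add: fun_eq_iff)
qed

text \<open>
  The operator is the product of one with its adjoint.
\<close>

lemma polarization_scalar_nonneg:
  assumes f: "fin_supp f" "f \<noteq> 0" and eq: "polarization s t (polarization t s f) = cscale (of_real c) f"
  shows "c \<ge> 0"
proof -
  have "of_real (c * fischer_norm2 f) = fischer f (cscale (of_real c) f)"
    by (simp add: fischer_scale_right fischer_self)
  also have "\<dots> = fischer (polarization t s f) (polarization t s f)"
    unfolding eq[symmetric] using f by (simp add: fischer_polarization fin_supp_polarization)
  finally have "c * fischer_norm2 f = fischer_norm2 (polarization t s f)"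
    unfolding fischer_self of_real_eq_iff .
  moreover have "fischer_norm2 f > 0"
    using fischer_norm2_nonneg[of f] fischer_norm2_eq_0[OF f(1)] f(2) by force
  ultimately show ?thesis using fischer_norm2_nonneg[of "polarization t s f"]
    by (metis zero_le_mult_iff not_less)
qed

section \<open>Harmonic polynomials and the Casimir operator\<close>

lemma lowering_bihom:
  assumes "f \<in> bihom (Suc \<alpha>) \<beta>" shows "lowering f \<in> bihom \<alpha> (Suc \<beta>)"
  using assms
  by (auto simp: bihom_iff polarization_commutator[of False False True False]
      polarization_commutator[of True True True False] clinear_scale[OF clinear_polarization]
      clinear_add[OF clinear_polarization] cfun.scale_left_distrib)

lemma raising_bihom:
  assumes "f \<in> bihom \<alpha> (Suc \<beta>)" shows "raising f \<in> bihom (Suc \<alpha>) \<beta>"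
  using assms
  by (auto simp: bihom_iff polarization_commutator[of False False False True]
      polarization_commutator[of True True False True] clinear_scale[OF clinear_polarization]
      clinear_add[OF clinear_polarization] cfun.scale_left_distrib)

text \<open>
  The eigenvalues of a diagonal operator are degrees, which are natural numbers.
\<close>

lemma polarization_diag_negative:
  assumes "polarization s s f = - f" shows "f = 0"
proof
  fix e
  have "of_nat (bidegree s e) * f e = - f e" using polarization_diag[of s f e] assms by simp
  then have "of_nat (Suc (bidegree s e)) * f e = 0" by (simp add: algebra_simps)
  then show "f e = 0 e" by (simp del: of_nat_Suc)
qed

lemma raising_lowering_bihom_0:
  "f \<in> bihom 0 \<beta> \<Longrightarrow> lowering f = 0"
  "f \<in> bihom \<alpha> 0 \<Longrightarrow> raising f = 0"
proof -
  assume "f \<in> bihom 0 \<beta>"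
  then show "lowering f = 0"
    by (intro polarization_diag_negative[of False])
      (simp add: bihom_iff polarization_commutator[of False False True False] clinear_0[OF clinear_polarization])
next
  assume "f \<in> bihom \<alpha> 0"
  then show "raising f = 0"
    by (intro polarization_diag_negative[of True])
      (simp add: bihom_iff polarization_commutator[of True True False True] clinear_0[OF clinear_polarization])
qed

lemma laplace_bihom: "f \<in> bihom (Suc \<alpha>) (Suc \<beta>) \<Longrightarrow> laplace f \<in> bihom \<alpha> \<beta>"
  by (simp add: bihom_iff laplace_polarization_diag clinear_scale[OF clinear_laplace]
      clinear_add[OF clinear_laplace] cfun.scale_left_distrib)

lemma laplace_bihom_0: "f \<in> bihom \<alpha> \<beta> \<Longrightarrow> \<alpha> = 0 \<or> \<beta> = 0 \<Longrightarrow> laplace f = 0"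
  using polarization_diag_negative[of True "laplace f"] polarization_diag_negative[of False "laplace f"]
  by (auto simp: bihom_iff laplace_polarization_diag clinear_0[OF clinear_laplace])

lemma radius2_bihom: "f \<in> bihom \<alpha> \<beta> \<Longrightarrow> radius2 f \<in> bihom (Suc \<alpha>) (Suc \<beta>)"
  by (simp add: bihom_iff radius2_polarization_diag clinear_scale[OF clinear_radius2]
      clinear_add[OF clinear_radius2] cfun.scale_left_distrib)

text \<open>
  Since the difference of the degrees is the weight, \<open>E F\<close> exceeds \<open>F E\<close> by a positive scalar on positive
  weights; this makes the raising operator onto there.
\<close>

lemma raise_lower:
  assumes "f \<in> bihom \<alpha> \<beta>"
  shows "raising (lowering f) =
    lowering (raising f) + cscale (of_real (real \<alpha> - real \<beta>)) f"
  using assms by (simp add: bihom_iff polarization_commutator[of False True] cfun.scale_left_diff_distrib)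

lemma clinear_laplace_radius2: "clinear (\<lambda>f. laplace (radius2 f))"
  by (rule clinearI)
    (simp_all add: clinear_add[OF clinear_laplace] clinear_add[OF clinear_radius2]
      clinear_scale[OF clinear_laplace] clinear_scale[OF clinear_radius2])

lemma clinear_polarization_polarization: "clinear (\<lambda>f. polarization s t (polarization u v f))"
  by (rule clinearI)
    (simp_all add: clinear_add[OF clinear_polarization] clinear_scale[OF clinear_polarization])

text \<open>
  If \<open>\<Delta> |x|\<^sup>2 f = 0\<close>, then pairing with \<open>f\<close> gives \<open>|\<Delta> f|\<^sup>2\<close> plus a positive multiple of \<open>|f|\<^sup>2\<close>,
  so \<open>f = 0\<close>.
\<close>

lemma laplace_radius2_surj:
  fixes g :: "('n::finite) qpoly"
  assumes "g \<in> bihom \<alpha> \<beta>"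
  shows "\<exists>f\<in>bihom \<alpha> \<beta>. laplace (radius2 f) = g"
proof -
  have "(\<lambda>f. laplace (radius2 f)) ` bihom \<alpha> \<beta> = (bihom \<alpha> \<beta> :: 'n qpoly set)"
  proof (rule injective_endomorphism_surjective)
    show "fin_dim (bihom \<alpha> \<beta>)" by (rule fin_dim_bihom)
    show "clinear (\<lambda>f. laplace (radius2 f))" by (rule clinear_laplace_radius2)
    show "(\<lambda>f. laplace (radius2 f)) ` bihom \<alpha> \<beta> \<subseteq> bihom \<alpha> \<beta>"
      by (auto intro: laplace_bihom radius2_bihom)
    fix f :: "'n qpoly"
    assume f: "f \<in> bihom \<alpha> \<beta>" and 0: "laplace (radius2 f) = 0"
    have fs: "fin_supp f" using f by (rule fin_supp_bihom)
    have "0 = fischer f (laplace (radius2 f))" by (simp add: 0 fischer_def)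
    also have "laplace (radius2 f) = radius2 (laplace f) + cscale (of_real (real (\<alpha> + \<beta> + 2 * CARD('n)))) f"
      using f by (simp add: laplace_radius2 bihom_iff cfun.scale_left_distrib)
    also have "fischer f \<dots> = of_real (fischer_norm2 (laplace f) + real (\<alpha> + \<beta> + 2 * CARD('n)) * fischer_norm2 f)"
      using fs by (simp only: fischer_add_right fischer_radius2 fin_supp_laplace fischer_scale_right
          fischer_self of_real_add of_real_mult complex_cnj_complex_of_real)
    finally have "fischer_norm2 (laplace f) + real (\<alpha> + \<beta> + 2 * CARD('n)) * fischer_norm2 f = 0"
      by (metis of_real_eq_0_iff)
    then have "real (\<alpha> + \<beta> + 2 * CARD('n)) * fischer_norm2 f = 0"
      by (subst (asm) add_nonneg_eq_0_iff) (intro mult_nonneg_nonneg fischer_norm2_nonneg of_nat_0_le_iff | simp)+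
    moreover have "real (\<alpha> + \<beta> + 2 * CARD('n)) > 0"
      using zero_less_card_finite[where 'a = 'n] by (simp only: of_nat_0_less_iff)
    ultimately have "fischer_norm2 f = 0"
      by (metis mult_eq_0_iff less_irrefl)
    then show "f = 0" by (rule fischer_norm2_eq_0[OF fs])
  qed
  then show ?thesis using assms by (metis (no_types, lifting) imageE)
qed

definition harmonic :: "nat \<Rightarrow> nat \<Rightarrow> ('n::finite) qpoly set" where
  "harmonic \<alpha> \<beta> = {f \<in> bihom \<alpha> \<beta>. laplace f = 0}"

lemma fin_dim_harmonic: "fin_dim (harmonic \<alpha> \<beta>)"
  unfolding harmonic_def
  by (rule fin_dim_subset[OF fin_dim_bihom _ kernel_subspace[OF bihom_subspace clinear_laplace]]) auto

lemma harmonic_decomposition: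
  assumes "f \<in> bihom \<alpha> \<beta>"
  obtains g where "g \<in> harmonic \<alpha> \<beta>" "f = g"
  | \<alpha>' \<beta>' g k where "\<alpha> = Suc \<alpha>'" "\<beta> = Suc \<beta>'" "g \<in> harmonic \<alpha> \<beta>" "k \<in> bihom \<alpha>' \<beta>'" "f = g + radius2 k"
proof (cases "\<alpha> = 0 \<or> \<beta> = 0")
  case True
  then show ?thesis using that(1) laplace_bihom_0[OF assms] assms by (auto simp: harmonic_def)
next
  case False
  then obtain \<alpha>' \<beta>' where ab: "\<alpha> = Suc \<alpha>'" "\<beta> = Suc \<beta>'" by (metis not0_implies_Suc)
  obtain k where k: "k \<in> bihom \<alpha>' \<beta>'" "laplace (radius2 k) = laplace f"
    using laplace_radius2_surj laplace_bihom assms ab by metis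
  have "f - radius2 k \<in> harmonic \<alpha> \<beta>"
    using assms k radius2_bihom[OF k(1)] cfun.subspace_diff[OF bihom_subspace]
    by (simp add: harmonic_def ab clinear_diff[OF clinear_laplace])
  then show ?thesis using that(2)[OF ab _ k(1)] by (metis diff_add_cancel)
qed

text \<open>
  The Laplacian maps bidegree \<open>(\<alpha>, \<beta>)\<close> onto bidegree \<open>(\<alpha> - 1, \<beta> - 1)\<close>. The subtracted product of
  binomial coefficients is zero when \<open>\<alpha>\<close> or \<open>\<beta>\<close> is zero, so one formula covers all cases.
\<close>

lemma dim_harmonic:
  fixes \<alpha> \<beta> :: nat and t :: "'n::finite itself"
  defines "N \<equiv> 2 * CARD('n) - 1"
  shows "cfun.dim (harmonic \<alpha> \<beta> :: 'n qpoly set)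
     + ((\<alpha> + N - 1) choose N) * ((\<beta> + N - 1) choose N) = ((\<alpha> + N) choose N) * ((\<beta> + N) choose N)"
proof -
  let ?V = "bihom \<alpha> \<beta> :: 'n qpoly set"
  have N: "N \<ge> 1" unfolding N_def using zero_less_card_finite[where 'a = 'n] by linarith
  have dimb: "cfun.dim (bihom \<alpha> \<beta> :: 'n qpoly set)
      = ((\<alpha> + N) choose N) * ((\<beta> + N) choose N)" for \<alpha> \<beta>
  proof -
    have "(CARD('n \<times> bool) + k - 1) choose k = (k + N) choose N" for k
    proof -
      have "CARD('n \<times> bool) = 2 * CARD('n)" by simp
      then have "CARD('n \<times> bool) + k - 1 = k + N" using N unfolding N_def by linarith
      then show ?thesis using binomial_symmetric[of k "k + N"] by simp
    qed
    then show ?thesis by (simp only: dim_bihom)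
  qed
  have "cfun.dim ?V = cfun.dim {f \<in> ?V. laplace f = 0} + cfun.dim (laplace ` ?V)"
    by (rule rank_nullity[OF fin_dim_bihom clinear_laplace])
  moreover have "cfun.dim (laplace ` ?V) = ((\<alpha> + N - 1) choose N) * ((\<beta> + N - 1) choose N)"
  proof (cases "\<alpha> = 0 \<or> \<beta> = 0")
    case True
    then have "laplace ` ?V \<subseteq> cfun.span {}" using laplace_bihom_0 by auto
    then have "cfun.dim (laplace ` ?V) = 0" using cfun.dim_le_card[of _ "{}"] by simp
    then show ?thesis using True N by (auto simp: binomial_eq_0)
  next
    case False
    then obtain \<alpha>' \<beta>' where ab: "\<alpha> = Suc \<alpha>'" "\<beta> = Suc \<beta>'" by (metis not0_implies_Suc)
    have "laplace ` ?V = bihom \<alpha>' \<beta>'"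
    proof (intro equalityI subsetI)
      fix g :: "'n qpoly" assume "g \<in> bihom \<alpha>' \<beta>'"
      then obtain k where "k \<in> bihom \<alpha>' \<beta>'" "laplace (radius2 k) = g"
        using laplace_radius2_surj by blast
      then show "g \<in> laplace ` ?V"
        unfolding ab by (intro image_eqI[of _ _ "radius2 k"] radius2_bihom) simp_all
    next
      fix g :: "'n qpoly" assume "g \<in> laplace ` ?V"
      then show "g \<in> bihom \<alpha>' \<beta>'" unfolding ab using laplace_bihom by blast
    qed
    then show ?thesis by (simp add: dimb ab)
  qed
  ultimately show ?thesis by (simp add: dimb harmonic_def)
qed

lemma lower_harmonic:
  "f \<in> harmonic (Suc \<alpha>) \<beta> \<Longrightarrow> lowering f \<in> harmonic \<alpha> (Suc \<beta>)"
  by (simp add: harmonic_def lowering_bihom laplace_polarization clinear_0[OF clinear_polarization])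

lemma raise_harmonic:
  "f \<in> harmonic \<alpha> (Suc \<beta>) \<Longrightarrow> raising f \<in> harmonic (Suc \<alpha>) \<beta>"
  by (simp add: harmonic_def raising_bihom laplace_polarization clinear_0[OF clinear_polarization])

lemma raise_surj:
  assumes "\<beta> < Suc \<alpha>" "g \<in> harmonic (Suc \<alpha>) \<beta>"
  shows "\<exists>f\<in>harmonic \<alpha> (Suc \<beta>). raising f = g"
proof -
  let ?W = "harmonic (Suc \<alpha>) \<beta> :: ('a::finite) qpoly set"
  have "(\<lambda>f. raising (lowering f)) ` ?W = ?W"
  proof (rule injective_endomorphism_surjective)
    show "fin_dim ?W" by (rule fin_dim_harmonic)
    show "clinear (\<lambda>f. raising (lowering f))"
      by (rule clinear_polarization_polarization)
    show "(\<lambda>f. raising (lowering f)) ` ?W \<subseteq> ?W"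
      by (auto intro: raise_harmonic lower_harmonic)
    fix f :: "'a qpoly"
    assume f: "f \<in> ?W" and 0: "raising (lowering f) = 0"
    then have fb: "f \<in> bihom (Suc \<alpha>) \<beta>" by (simp add: harmonic_def)
    have "lowering (raising f) + cscale (of_real (real (Suc \<alpha>) - real \<beta>)) f = 0"
      using raise_lower[OF fb] 0 by simp
    then have "lowering (raising f) = cscale (of_real (- (real (Suc \<alpha>) - real \<beta>))) f"
      unfolding of_real_minus cfun.scale_minus_left eq_neg_iff_add_eq_0 .
    note nonneg = polarization_scalar_nonneg[OF fin_supp_bihom[OF fb] _ this]
    show "f = 0"
    proof (rule ccontr)
      assume "f \<noteq> 0"
      from nonneg[OF this] assms(1) show False by linarith
    qed
  qed
  then obtain w where "w \<in> ?W" "raising (lowering w) = g"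
    using assms(2) by (metis (no_types, lifting) imageE)
  then show ?thesis by (intro bexI[of _ "lowering w"] lower_harmonic)
qed

lemma lower_surj:
  assumes "\<alpha> < Suc \<beta>" "g \<in> harmonic \<alpha> (Suc \<beta>)"
  shows "\<exists>f\<in>harmonic (Suc \<alpha>) \<beta>. lowering f = g"
proof -
  let ?W = "harmonic \<alpha> (Suc \<beta>) :: ('a::finite) qpoly set"
  have "(\<lambda>f. lowering (raising f)) ` ?W = ?W"
  proof (rule injective_endomorphism_surjective)
    show "fin_dim ?W" by (rule fin_dim_harmonic)
    show "clinear (\<lambda>f. lowering (raising f))"
      by (rule clinear_polarization_polarization)
    show "(\<lambda>f. lowering (raising f)) ` ?W \<subseteq> ?W"
      by (auto intro: raise_harmonic lower_harmonic)
    fix f :: "'a qpoly"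
    assume f: "f \<in> ?W" and 0: "lowering (raising f) = 0"
    then have fb: "f \<in> bihom \<alpha> (Suc \<beta>)" by (simp add: harmonic_def)
    have "raising (lowering f) = cscale (of_real (real \<alpha> - real (Suc \<beta>))) f"
      using raise_lower[OF fb] 0 by simp
    note nonneg = polarization_scalar_nonneg[OF fin_supp_bihom[OF fb] _ this]
    show "f = 0"
    proof (rule ccontr)
      assume "f \<noteq> 0"
      from nonneg[OF this] assms(1) show False by linarith
    qed
  qed
  then obtain w where "w \<in> ?W" "lowering (raising w) = g"
    using assms(2) by (metis (no_types, lifting) imageE)
  then show ?thesis by (intro bexI[of _ "raising w"] raise_harmonic)
qed

text \<open>
  On evaluations this is \<open>C F (x) = \<Sum>\<^sub>u D\<^sup>2F(x)(u x, u x)\<close> with \<open>u\<close> over the basis of the quaternions, see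
  lemma \<open>casimir_peval\<close>. On degree \<open>h\<close> it is \<open>h (h + 2)\<close> minus the Casimir element of \<open>sl\<^sub>2\<close>, normalized to
  act by \<open>l (l + 2)\<close> in highest weight \<open>l\<close>.
\<close>

definition casimir :: "(('a::finite \<times> bool \<Rightarrow> nat) \<Rightarrow> complex) \<Rightarrow> ('a \<times> bool \<Rightarrow> nat) \<Rightarrow> complex" where
  "casimir f = cscale 4 (polarization False False (polarization True True f) + polarization True True f
      - lowering (raising f))"

definition casimir_value :: "nat \<Rightarrow> nat \<Rightarrow> complex" where
  "casimir_value h m = of_real (4 * real m * (real h - real m + 1))"

lemma clinear_casimir: "clinear casimir"
  by (rule clinearI)
    (simp_all add: casimir_def clinear_add[OF clinear_polarization] clinear_scale[OF clinear_polarization]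
      cfun.scale_right_distrib cfun.scale_right_diff_distrib algebra_simps)

lemma lower_raise_bihom:
  assumes "f \<in> bihom \<alpha> \<beta>"
  shows "lowering (raising f) \<in> bihom \<alpha> \<beta>"
proof (cases \<beta>)
  case 0
  then show ?thesis
    using assms raising_lowering_bihom_0(2) by (metis clinear_0[OF clinear_polarization] cfun.subspace_0[OF bihom_subspace])
next
  case (Suc b)
  then show ?thesis using assms raising_bihom lowering_bihom by blast
qed

lemma casimir_bihom_eq:
  assumes "f \<in> bihom \<alpha> \<beta>"
  shows "casimir f = cscale 4 (cscale (of_real (real (Suc \<alpha>) * real \<beta>)) f
    - lowering (raising f))"
proof -
  have f: "polarization False False f = cscale (of_nat \<alpha>) f" "polarization True True f = cscale (of_nat \<beta>) f"
    using assms by (simp_all add: bihom_iff)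
  have "polarization False False (polarization True True f) + polarization True True f
      = cscale (of_nat \<beta>) (cscale (of_nat \<alpha>) f) + cscale (of_nat \<beta>) f"
    by (simp only: f clinear_scale[OF clinear_polarization])
  also have "\<dots> = cscale (of_real (real (Suc \<alpha>) * real \<beta>)) f"
    by (simp add: fun_eq_iff cscale_def algebra_simps)
  finally have "polarization False False (polarization True True f) + polarization True True f
      = cscale (of_real (real (Suc \<alpha>) * real \<beta>)) f" .
  then show ?thesis by (simp add: casimir_def)
qed

lemma casimir_bihom:
  assumes "f \<in> bihom \<alpha> \<beta>"
  shows "casimir f \<in> bihom \<alpha> \<beta>"
  unfolding casimir_bihom_eq[OF assms]
  by (intro cfun.subspace_scale[OF bihom_subspace] cfun.subspace_diff[OF bihom_subspace] assms lower_raise_bihom)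

text \<open>
  On a fixed bidegree, \<open>C\<close> and \<open>F E\<close> determine each other; the resulting scalar for \<open>F E\<close> factors, with
  zeros at the highest weight \<open>\<beta> = m\<close> and at \<open>\<beta> = h + 1 - m\<close>, just past the lowest weight.
\<close>

lemma casimir_eigen_iff:
  assumes "f \<in> bihom (h - \<beta>) \<beta>" "\<beta> \<le> h"
  shows "casimir f = cscale (casimir_value h m) f \<longleftrightarrow>
    lowering (raising f) =
      cscale (of_real ((real \<beta> - real m) * (real h + 1 - real \<beta> - real m))) f"
proof -
  let ?g = "lowering (raising f)"
  have "casimir f = cscale (casimir_value h m) f \<longleftrightarrow>
     cscale 4 (cscale (of_real (real (Suc (h - \<beta>)) * real \<beta>)) f - ?g) = cscale 4 (cscale (of_real (real m * (real h - real m + 1))) f)"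
    unfolding casimir_bihom_eq[OF assms(1)] by (simp add: casimir_value_def mult.assoc)
  also have "\<dots> \<longleftrightarrow> ?g = cscale (of_real (real (Suc (h - \<beta>)) * real \<beta>)) f - cscale (of_real (real m * (real h - real m + 1))) f"
    by (simp only: cfun.scale_cancel_left) (auto simp: algebra_simps)
  also have "cscale (of_real (real (Suc (h - \<beta>)) * real \<beta>)) f - cscale (of_real (real m * (real h - real m + 1))) f
      = cscale (of_real ((real \<beta> - real m) * (real h + 1 - real \<beta> - real m))) f"
    unfolding cfun.scale_left_diff_distrib[symmetric] of_real_diff[symmetric]
    using assms(2) by (simp add: of_nat_diff) (simp add: algebra_simps)
  finally show ?thesis .
qed

text \<open>
  The part of bidegree \<open>(h - \<beta>, \<beta>)\<close>, that is of weight \<open>h - 2 \<beta>\<close>, of the isotypic component with highest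
  weight \<open>h - 2 m\<close>.
\<close>

definition isotypic_weight :: "nat \<Rightarrow> nat \<Rightarrow> nat \<Rightarrow> ('n::finite) qpoly set" where
  "isotypic_weight h m \<beta> = {f \<in> harmonic (h - \<beta>) \<beta>. casimir f = cscale (casimir_value h m) f}"

lemma isotypic_weight_bihom: "f \<in> isotypic_weight h m \<beta> \<Longrightarrow> f \<in> bihom (h - \<beta>) \<beta>"
  by (simp add: isotypic_weight_def harmonic_def)

lemma fin_dim_isotypic_weight: "fin_dim (isotypic_weight h m \<beta>)"
proof (rule fin_dim_subset[OF fin_dim_harmonic])
  have "isotypic_weight h m \<beta> = {f \<in> harmonic (h - \<beta>) \<beta>. casimir f - cscale (casimir_value h m) f = 0}"
    by (auto simp: isotypic_weight_def)
  also have "cfun.subspace \<dots>"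
    by (rule kernel_subspace[OF fin_dim_subspace[OF fin_dim_harmonic]], rule clinearI)
      (simp_all add: clinear_add[OF clinear_casimir] clinear_scale[OF clinear_casimir] cfun.scale_right_distrib
        cfun.scale_right_diff_distrib cfun.scale_left_commute algebra_simps)
  finally show "cfun.subspace (isotypic_weight h m \<beta>)" .
qed (auto simp: isotypic_weight_def)

lemma lower_raise_isotypic:
  assumes "f \<in> isotypic_weight h m \<beta>" "\<beta> \<le> h"
  shows "lowering (raising f) =
      cscale (of_real ((real \<beta> - real m) * (real h + 1 - real \<beta> - real m))) f"
  using casimir_eigen_iff[of f h \<beta> m] assms by (auto simp: isotypic_weight_def harmonic_def)

lemma raise_lower_isotypic:
  assumes "f \<in> isotypic_weight h m \<beta>" "\<beta> \<le> h"
  shows "raising (lowering f) =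
      cscale (of_real ((real \<beta> + 1 - real m) * (real h - real \<beta> - real m))) f"
  unfolding raise_lower[OF isotypic_weight_bihom[OF assms(1)]] lower_raise_isotypic[OF assms]
    cfun.scale_left_distrib[symmetric] of_real_add[symmetric]
  using assms(2) by (simp add: of_nat_diff) (simp add: algebra_simps)

text \<open>
  Both \<open>F E\<close> and \<open>E F\<close> act by scalars, which positivity forces to be nonnegative; only the weights between
  the highest weight \<open>\<beta> = m\<close> and the lowest weight \<open>\<beta> = h - m\<close> satisfy both conditions.
\<close>

lemma isotypic_weight_range:
  assumes f: "f \<in> isotypic_weight h m \<beta>" "f \<noteq> 0" and b: "\<beta> \<le> h" and m: "2 * m \<le> h"
  shows "m \<le> \<beta>" "\<beta> + m \<le> h"
proof -
  note fs = fin_supp_bihom[OF isotypic_weight_bihom[OF f(1)]]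
  have 1: "(real \<beta> - real m) * (real h + 1 - real \<beta> - real m) \<ge> 0"
    by (rule polarization_scalar_nonneg[OF fs f(2) lower_raise_isotypic[OF f(1) b]])
  have 2: "(real \<beta> + 1 - real m) * (real h - real \<beta> - real m) \<ge> 0"
    by (rule polarization_scalar_nonneg[OF fs f(2) raise_lower_isotypic[OF f(1) b]])
  show "m \<le> \<beta>"
  proof (rule ccontr)
    assume "\<not> m \<le> \<beta>"
    then have "real \<beta> - real m < 0" "real h + 1 - real \<beta> - real m > 0" using m by linarith+
    then show False using 1 by (simp add: mult_less_0_iff zero_le_mult_iff)
  qed
  then show "\<beta> + m \<le> h" using 2 by (auto simp: zero_le_mult_iff)
qed

lemma casimir_commute:
  assumes "f \<in> bihom (Suc \<alpha>) \<beta>"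
  shows "casimir (lowering f) = lowering (casimir f)"
proof -
  note c = clinear_scale[OF clinear_polarization] clinear_add[OF clinear_polarization] clinear_diff[OF clinear_polarization]
  have "casimir (lowering f) = cscale 4 (cscale (of_real (real (Suc \<alpha>) * real (Suc \<beta>))) (lowering f)
     - lowering (raising (lowering f)))"
    by (rule casimir_bihom_eq[OF lowering_bihom[OF assms]])
  also have "\<dots> = lowering (casimir f)"
    unfolding casimir_bihom_eq[OF assms] raise_lower[OF assms] c
    by (simp add: fun_eq_iff cscale_def algebra_simps)
  finally show ?thesis .
qed

lemma lower_isotypic:
  assumes "f \<in> isotypic_weight h m \<beta>" "\<beta> < h"
  shows "lowering f \<in> isotypic_weight h m (Suc \<beta>)"
proof -
  have h: "h - \<beta> = Suc (h - Suc \<beta>)" using assms(2) by simp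
  have "f \<in> harmonic (Suc (h - Suc \<beta>)) \<beta>" "casimir f = cscale (casimir_value h m) f"
    using assms(1) by (auto simp: isotypic_weight_def h)
  then show ?thesis
    by (auto simp: isotypic_weight_def lower_harmonic harmonic_def casimir_commute clinear_scale[OF clinear_polarization]
      lowering_bihom laplace_polarization clinear_0[OF clinear_polarization])
qed

lemma raise_isotypic:
  assumes f: "f \<in> isotypic_weight h m (Suc \<beta>)" and b: "\<beta> < h"
  shows "raising f \<in> isotypic_weight h m \<beta>"
proof -
  have h: "h - \<beta> = Suc (h - Suc \<beta>)" using b by simp
  have "f \<in> harmonic (h - Suc \<beta>) (Suc \<beta>)" using f by (auto simp: isotypic_weight_def)
  then have E: "raising f \<in> harmonic (h - \<beta>) \<beta>" unfolding h by (rule raise_harmonic)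
  then have Eb: "raising f \<in> bihom (h - \<beta>) \<beta>" by (simp add: harmonic_def)
  have 1: "lowering (raising f) =
      cscale (of_real ((real (Suc \<beta>) - real m) * (real h + 1 - real (Suc \<beta>) - real m))) f"
    by (rule lower_raise_isotypic[OF f]) (use b in simp)
  have "raising (lowering (raising f)) =
      cscale (of_real ((real (Suc \<beta>) - real m) * (real h + 1 - real (Suc \<beta>) - real m))) (raising f)"
    unfolding 1 by (rule clinear_scale[OF clinear_polarization])
  then have "lowering (raising (raising f)) =
      cscale (of_real ((real (Suc \<beta>) - real m) * (real h + 1 - real (Suc \<beta>) - real m))) (raising f)
      - cscale (of_real (real (h - \<beta>) - real \<beta>)) (raising f)"
    using raise_lower[OF Eb] by (metis add_diff_cancel_right')
  also have "\<dots> = cscale (of_real ((real \<beta> - real m) * (real h + 1 - real \<beta> - real m))) (raising f)"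
    unfolding cfun.scale_left_diff_distrib[symmetric] of_real_diff[symmetric]
    using b by (simp add: of_nat_diff) (simp add: algebra_simps)
  finally show ?thesis
    using casimir_eigen_iff[OF Eb] E b by (simp add: isotypic_weight_def)
qed

text \<open>
  Lowering is invertible along a weight string, since \<open>E F\<close> and \<open>F E\<close> are nonzero scalars there.
\<close>

lemma isotypic_weight_dim_step:
  assumes b: "m \<le> \<beta>" "\<beta> + m < h"
  shows "cfun.dim (isotypic_weight h m (Suc \<beta>) :: ('n::finite) qpoly set)
    = cfun.dim (isotypic_weight h m \<beta> :: 'n qpoly set)"
proof -
  let ?V = "isotypic_weight h m \<beta> :: 'n qpoly set"
  let ?W = "isotypic_weight h m (Suc \<beta>) :: 'n qpoly set"
  define c :: complex where "c = of_real ((real \<beta> + 1 - real m) * (real h - real \<beta> - real m))"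
  have c: "c \<noteq> 0" unfolding c_def of_real_eq_0_iff using b by simp
  have "lowering ` ?V = ?W"
  proof (intro equalityI subsetI)
    fix w assume w: "w \<in> ?W"
    have "lowering (raising w) =
      cscale (of_real ((real (Suc \<beta>) - real m) * (real h + 1 - real (Suc \<beta>) - real m))) w"
      using w b by (intro lower_raise_isotypic) auto
    also have "\<dots> = cscale c w" by (simp add: c_def algebra_simps)
    finally have "w = lowering (cscale (1 / c) (raising w))"
      using c by (simp add: clinear_scale[OF clinear_polarization])
    moreover have "cscale (1 / c) (raising w) \<in> ?V"
      using b by (intro cfun.subspace_scale[OF fin_dim_subspace[OF fin_dim_isotypic_weight]] raise_isotypic[OF w]) simp
    ultimately show "w \<in> lowering ` ?V" by blast
  qed (use b in \<open>auto intro!: lower_isotypic\<close>)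
  moreover have "cfun.dim (lowering ` ?V) = cfun.dim ?V"
  proof (rule dim_image_injective[OF fin_dim_isotypic_weight clinear_polarization])
    fix v assume v: "v \<in> ?V" "lowering v = 0"
    have "cscale c v = 0"
      using raise_lower_isotypic[OF v(1)] b v(2) unfolding c_def by (simp add: clinear_0[OF clinear_polarization])
    then show "v = 0" using c by simp
  qed
  ultimately show ?thesis by simp
qed

lemma isotypic_weight_dim_const:
  assumes "\<beta> + m \<le> h" "m \<le> \<beta>"
  shows "cfun.dim (isotypic_weight h m \<beta> :: ('n::finite) qpoly set)
    = cfun.dim (isotypic_weight h m m :: 'n qpoly set)"
  using assms(2,1)
proof (induction \<beta> rule: dec_induct)
  case (step \<beta>)
  then show ?case using isotypic_weight_dim_step[of m \<beta> h, where 'n = 'n] by simp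
qed simp

text \<open>
  The scalar by which \<open>F E\<close> acts vanishes at \<open>\<beta> = m\<close>, and \<open>F E f = 0\<close> forces \<open>E f = 0\<close> by positivity.
\<close>

lemma isotypic_highest:
  assumes "2 * m \<le> h"
  shows "isotypic_weight h m m = {f \<in> harmonic (h - m) m. raising f = 0}"
proof -
  have "casimir f = cscale (casimir_value h m) f \<longleftrightarrow> raising f = 0" if f: "f \<in> harmonic (h - m) m"
    for f :: "'a qpoly"
  proof -
    have fb: "f \<in> bihom (h - m) m" using f by (simp add: harmonic_def)
    have fs: "fin_supp f" by (rule fin_supp_bihom[OF fb])
    have "casimir f = cscale (casimir_value h m) f \<longleftrightarrow> lowering (raising f) = 0"
      using casimir_eigen_iff[OF fb] assms by simp
    also have "\<dots> \<longleftrightarrow> raising f = 0"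
    proof
      assume 0: "lowering (raising f) = 0"
      have "of_real (fischer_norm2 (raising f)) = fischer f (lowering (raising f))"
        by (simp add: fischer_polarization fs fin_supp_polarization fischer_self)
      then have "fischer_norm2 (raising f) = 0" by (simp only: 0 fischer_0 of_real_eq_0_iff)
      then show "raising f = 0" by (rule fischer_norm2_eq_0[OF fin_supp_polarization[OF fs]])
    qed (simp add: clinear_0[OF clinear_polarization])
    finally show ?thesis .
  qed
  then show ?thesis by (auto simp: isotypic_weight_def)
qed

text \<open>
  Complete reducibility, by induction on \<open>\<beta>\<close>. On nonnegative weights (\<open>2 \<beta> \<le> h\<close>) the components of \<open>E f\<close>
  are pulled back along \<open>E\<close>, which leaves a highest weight vector; on negative weights \<open>f\<close> is the image
  under \<open>F\<close> of a polynomial with smaller \<open>\<beta>\<close>.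
\<close>

lemma harmonic_isotypic_span:
  assumes "\<beta> \<le> h" "f \<in> harmonic (h - \<beta>) \<beta>"
  shows "f \<in> cfun.span (\<Union>m\<in>{m. 2 * m \<le> h}. isotypic_weight h m \<beta>)"
  using assms
proof (induction \<beta> arbitrary: f)
  case 0
  then have "f \<in> isotypic_weight h 0 0"
    using raising_lowering_bihom_0(2)[of f h] by (simp add: isotypic_highest[of 0 h, simplified] harmonic_def)
  then show ?case by (intro cfun.span_base UN_I[of 0]) auto
next
  case (Suc \<beta>)
  let ?S = "\<lambda>\<beta>. \<Union>m\<in>{m. 2 * m \<le> h}. isotypic_weight h m \<beta> :: 'a qpoly set"
  have h: "h - \<beta> = Suc (h - Suc \<beta>)" using Suc.prems(1) by simp
  show ?case
  proof (cases "2 * Suc \<beta> \<le> h")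
    case True
    have Ef: "raising f \<in> harmonic (h - \<beta>) \<beta>"
      unfolding h using Suc.prems by (intro raise_harmonic)
    have "?S \<beta> \<subseteq> raising ` cfun.span (?S (Suc \<beta>))"
    proof
      fix x assume "x \<in> ?S \<beta>"
      then obtain m where m: "2 * m \<le> h" "x \<in> isotypic_weight h m \<beta>" by auto
      show "x \<in> raising ` cfun.span (?S (Suc \<beta>))"
      proof (cases "x = 0")
        case True
        then show ?thesis using clinear_0[OF clinear_polarization, of False True] cfun.span_zero by (intro image_eqI[of _ _ 0]) auto
      next
        case False
        then have "m \<le> \<beta>" using isotypic_weight_range[OF m(2)] Suc.prems(1) m(1) by simp
        define c :: complex where "c = of_real ((real \<beta> + 1 - real m) * (real h - real \<beta> - real m))"
        have c: "c \<noteq> 0" unfolding c_def of_real_eq_0_iff using \<open>m \<le> \<beta>\<close> True by simp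
        have "raising (lowering x) = cscale c x"
          unfolding c_def by (rule raise_lower_isotypic[OF m(2)]) (use Suc.prems(1) in simp)
        then have "x = raising (cscale (1 / c) (lowering x))"
          using c by (simp add: clinear_scale[OF clinear_polarization])
        moreover have "cscale (1 / c) (lowering x) \<in> cfun.span (?S (Suc \<beta>))"
          using lower_isotypic[OF m(2)] Suc.prems(1) m(1) by (intro cfun.span_scale cfun.span_base) auto
        ultimately show ?thesis by blast
      qed
    qed
    moreover have "cfun.subspace (raising ` cfun.span (?S (Suc \<beta>)))"
      by (rule cpair.linear_subspace_image[OF clinear_polarization cfun.subspace_span])
    ultimately have "cfun.span (?S \<beta>) \<subseteq> raising ` cfun.span (?S (Suc \<beta>))"
      by (rule cfun.span_minimal)
    moreover have "raising f \<in> cfun.span (?S \<beta>)"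
      using Suc.IH[OF _ Ef] Suc.prems(1) by simp
    ultimately obtain g where g: "g \<in> cfun.span (?S (Suc \<beta>))" "raising f = raising g"
      by blast
    have "?S (Suc \<beta>) \<subseteq> harmonic (h - Suc \<beta>) (Suc \<beta>)" by (auto simp: isotypic_weight_def)
    then have "g \<in> harmonic (h - Suc \<beta>) (Suc \<beta>)"
      using g(1) cfun.span_minimal[OF _ fin_dim_subspace[OF fin_dim_harmonic]] by blast
    then have "f - g \<in> harmonic (h - Suc \<beta>) (Suc \<beta>)"
      using Suc.prems(2) by (intro cfun.subspace_diff[OF fin_dim_subspace[OF fin_dim_harmonic]])
    then have "f - g \<in> isotypic_weight h (Suc \<beta>) (Suc \<beta>)"
      unfolding isotypic_highest[OF True] using g(2) by (simp add: clinear_diff[OF clinear_polarization])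
    then have "f - g \<in> cfun.span (?S (Suc \<beta>))" using True by (intro cfun.span_base UN_I[of "Suc \<beta>"]) auto
    from cfun.span_add[OF this g(1)] show ?thesis by simp
  next
    case False
    then have "h - Suc \<beta> < Suc \<beta>" by auto
    then obtain g where g: "g \<in> harmonic (Suc (h - Suc \<beta>)) \<beta>" "lowering g = f"
      using lower_surj[OF _ Suc.prems(2)] by blast
    then have "g \<in> cfun.span (?S \<beta>)" using Suc.IH[of g] Suc.prems(1) h by simp
    moreover have "lowering ` cfun.span (?S \<beta>) \<subseteq> cfun.span (?S (Suc \<beta>))"
      unfolding cpair.linear_span_image[OF clinear_polarization, symmetric]
      by (rule cfun.span_mono) (use lower_isotypic Suc.prems(1) in fastforce)
    ultimately show ?thesis using g(2) by blast
  qed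
qed

section \<open>Isotypic components and their dimensions\<close>

definition total_degree :: "('i::finite \<Rightarrow> nat) \<Rightarrow> nat" where
  "total_degree e = (\<Sum>i\<in>UNIV. e i)"

text \<open>
  The harmonic polynomials of degree \<open>h\<close> in the isotypic component of \<open>sl\<^sub>2\<close> with highest weight \<open>h - 2 m\<close>;
  by complete reducibility the eigenvalue of \<open>C\<close> characterizes it.
\<close>

definition isotypic :: "nat \<Rightarrow> nat \<Rightarrow> ('n::finite) qpoly set" where
  "isotypic h m = {f. (\<forall>e. f e \<noteq> 0 \<longrightarrow> total_degree e = h) \<and> laplace f = 0 \<and> casimir f = cscale (casimir_value h m) f}"

definition weight_part :: "nat \<Rightarrow> (('a::finite \<times> bool \<Rightarrow> nat) \<Rightarrow> complex) \<Rightarrow> ('a \<times> bool \<Rightarrow> nat) \<Rightarrow> complex" where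
  "weight_part \<beta> f = (\<lambda>e. if bidegree True e = \<beta> then f e else 0)"

lemma clinear_weight_part: "clinear (weight_part \<beta>)"
  by (rule clinearI) (auto simp: weight_part_def cscale_def fun_eq_iff)

lemma total_degree_bidegree: "total_degree e = bidegree False e + bidegree True e"
proof -
  have "total_degree e = (\<Sum>(a, s)\<in>UNIV \<times> UNIV. e (a, s))" by (simp add: total_degree_def split_def)
  also have "\<dots> = (\<Sum>a\<in>UNIV. \<Sum>s\<in>UNIV. e (a, s))" by (rule sum.cartesian_product[symmetric])
  finally show ?thesis by (simp add: bidegree_def UNIV_bool sum.distrib)
qed

lemma weight_part_sum:
  assumes "\<And>e. f e \<noteq> 0 \<Longrightarrow> total_degree e = h"
  shows "f = (\<Sum>\<beta>\<le>h. weight_part \<beta> f)"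
proof
  fix e
  have "(\<Sum>\<beta>\<le>h. weight_part \<beta> f) e = (\<Sum>\<beta>\<le>h. if \<beta> = bidegree True e then f e else 0)"
    by (auto simp: sum_fun_apply weight_part_def intro!: sum.cong)
  also have "\<dots> = f e" using assms[of e] total_degree_bidegree[of e] by (cases "f e = 0") auto
  finally show "f e = (\<Sum>\<beta>\<le>h. weight_part \<beta> f) e" by simp
qed

lemma weight_part_bihom:
  assumes "\<And>e. f e \<noteq> 0 \<Longrightarrow> total_degree e = h"
  shows "weight_part \<beta> f \<in> bihom (h - \<beta>) \<beta>"
proof -
  have "bidegree False e = h - bidegree True e" if "f e \<noteq> 0" for e
    using assms[OF that] total_degree_bidegree[of e] by simp
  then show ?thesis by (auto simp: bihom_def exponents_def weight_part_def)
qed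

lemma disjoint_supports_sum_eq_0:
  assumes 0: "(\<Sum>i\<in>I. g i) = 0" and I: "finite I" "j \<in> I"
    and disj: "\<And>i e. i \<in> I \<Longrightarrow> g i e \<noteq> 0 \<Longrightarrow> key e = i"
  shows "g j = (0 :: 'a \<Rightarrow> complex)"
proof
  fix e
  show "g j e = 0 e"
  proof (rule ccontr)
    assume "g j e \<noteq> 0 e"
    then have key: "key e = j" using disj I by simp
    have "(\<Sum>i\<in>I. g i e) = 0" using fun_cong[OF 0, of e] by (simp add: sum_fun_apply)
    moreover have "(\<Sum>i\<in>I. g i e) = (\<Sum>i\<in>I. if i = j then g j e else 0)"
      using disj key by (intro sum.cong) auto
    ultimately show False using \<open>g j e \<noteq> 0 e\<close> I by (simp add: sum.delta)
  qed
qed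

text \<open>
  The Laplacian and \<open>C\<close> respect bidegrees, so the parts of \<open>f\<close> satisfy the defining equations separately.
\<close>

lemma isotypic_weight_part:
  assumes f: "f \<in> isotypic h m" and b: "\<beta> \<le> h"
  shows "weight_part \<beta> f \<in> isotypic_weight h m \<beta>"
proof -
  have deg: "\<And>e. f e \<noteq> 0 \<Longrightarrow> total_degree e = h" using f by (simp add: isotypic_def)
  note w = weight_part_bihom[of f h, OF deg]
  note s = weight_part_sum[of f h, OF deg]
  have "laplace (weight_part \<beta> f) = 0"
  proof (rule disjoint_supports_sum_eq_0[where I = "{..h}" and g = "\<lambda>\<beta>. laplace (weight_part \<beta> f)"
        and key = "\<lambda>e. Suc (bidegree True e)"])
    have "(\<Sum>\<beta>\<le>h. laplace (weight_part \<beta> f)) = laplace f"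
      unfolding clinear_sum[OF clinear_laplace, symmetric] using s by simp
    then show "(\<Sum>\<beta>\<le>h. laplace (weight_part \<beta> f)) = 0" using f by (simp add: isotypic_def)
    fix i e assume i: "i \<in> {..h}" "laplace (weight_part i f) e \<noteq> 0"
    then have "laplace (weight_part i f) \<noteq> 0" by auto
    then have "\<not> (h - i = 0 \<or> i = 0)" using laplace_bihom_0[OF w[of i]] by blast
    then have "i \<noteq> 0" "h - i \<noteq> 0" by auto
    then obtain \<alpha>' \<beta>' where ab: "h - i = Suc \<alpha>'" "i = Suc \<beta>'" by (metis not0_implies_Suc)
    have "weight_part i f \<in> bihom (Suc \<alpha>') (Suc \<beta>')" using w[of i] unfolding ab(1) by (simp add: ab(2))
    then have "laplace (weight_part i f) \<in> bihom \<alpha>' \<beta>'" by (rule laplace_bihom)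
    then show "Suc (bidegree True e) = i"
      using i(2) by (simp add: bihom_def exponents_def ab(2))
  qed (use b in auto)
  moreover have "casimir (weight_part \<beta> f) - cscale (casimir_value h m) (weight_part \<beta> f) = 0"
  proof (rule disjoint_supports_sum_eq_0[where I = "{..h}" and key = "\<lambda>e. bidegree True e"
        and g = "\<lambda>\<beta>. casimir (weight_part \<beta> f) - cscale (casimir_value h m) (weight_part \<beta> f)"])
    have "(\<Sum>\<beta>\<le>h. casimir (weight_part \<beta> f) - cscale (casimir_value h m) (weight_part \<beta> f)) =
        casimir f - cscale (casimir_value h m) f"
      unfolding sum_subtractf clinear_sum[OF clinear_casimir, symmetric] cfun.scale_sum_right[symmetric]
      using s by simp
    then show "(\<Sum>\<beta>\<le>h. casimir (weight_part \<beta> f) - cscale (casimir_value h m) (weight_part \<beta> f)) = 0"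
      using f by (simp add: isotypic_def)
    fix i e assume i: "(casimir (weight_part i f) - cscale (casimir_value h m) (weight_part i f)) e \<noteq> 0"
    have "casimir (weight_part i f) - cscale (casimir_value h m) (weight_part i f) \<in> bihom (h - i) i"
      by (intro cfun.subspace_diff[OF bihom_subspace] cfun.subspace_scale[OF bihom_subspace] casimir_bihom w)
    then show "bidegree True e = i" using i unfolding bihom_def exponents_def by blast
  qed (use b in auto)
  ultimately show ?thesis using w by (simp add: isotypic_weight_def harmonic_def)
qed

lemma isotypic_weight_subset: "\<beta> \<le> h \<Longrightarrow> isotypic_weight h m \<beta> \<subseteq> isotypic h m"
  by (auto simp: isotypic_weight_def harmonic_def isotypic_def bihom_def exponents_def total_degree_bidegree)

lemma finite_total_degree: "finite {e :: 'a::finite \<times> bool \<Rightarrow> nat. total_degree e = h}"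
proof (rule finite_subset)
  show "{e :: 'a::finite \<times> bool \<Rightarrow> nat. total_degree e = h} \<subseteq> (\<Union>\<alpha>\<in>{..h}. \<Union>\<beta>\<in>{..h}. exponents \<alpha> \<beta>)"
    by (auto simp: exponents_def total_degree_bidegree)
qed (auto simp: card_exponents)

lemma fin_dim_isotypic: "fin_dim (isotypic h m)"
proof (rule fin_dim_subset[OF supported_fin_dim(1)[OF finite_total_degree[of h]]])
  have "isotypic h m = {f \<in> {f \<in> {f. \<forall>e. f e \<noteq> 0 \<longrightarrow> e \<in> {e. total_degree e = h}}. laplace f = 0}.
      casimir f - cscale (casimir_value h m) f = 0}"
    by (auto simp: isotypic_def)
  also have "cfun.subspace \<dots>"
    by (rule kernel_subspace[OF kernel_subspace[OF fin_dim_subspace[OF supported_fin_dim(1)[OF finite_total_degree]] clinear_laplace]], rule clinearI)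
      (simp_all add: clinear_add[OF clinear_casimir] clinear_scale[OF clinear_casimir] cfun.scale_right_distrib
        cfun.scale_right_diff_distrib cfun.scale_left_commute algebra_simps)
  finally show "cfun.subspace (isotypic h m)" .
qed (auto simp: isotypic_def)

text \<open>
  The subspaces of weights below \<open>k\<close> form a filtration; projecting to the top weight is a linear map with
  the previous step as its kernel.
\<close>

lemma dim_isotypic_sum:
  "cfun.dim (isotypic h m :: 'n qpoly set) = (\<Sum>\<beta>\<le>h. cfun.dim (isotypic_weight h m \<beta> :: ('n::finite) qpoly set))"
  (is "cfun.dim ?K = _")
proof -
  (* The filtration by weight. *)
  define P where "P k = {f \<in> ?K. \<forall>e. f e \<noteq> 0 \<longrightarrow> bidegree True e < k}" for k
  have P: "fin_dim (P k)" for k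
  proof (rule fin_dim_subset[OF fin_dim_isotypic])
    have K: "cfun.subspace ?K" by (rule fin_dim_subspace[OF fin_dim_isotypic])
    have "P k = {f \<in> ?K. \<forall>e. \<not> bidegree True e < k \<longrightarrow> f e = 0}" unfolding P_def by blast
    then show "cfun.subspace (P k)"
      using cfun.subspace_0[OF K] cfun.subspace_add[OF K] cfun.subspace_scale[OF K]
      by (simp add: cfun.subspace_def cscale_def)
  qed (auto simp: P_def)
  have step: "cfun.dim (P (Suc k)) = cfun.dim (P k) + cfun.dim (isotypic_weight h m k :: 'n qpoly set)"
    if k: "k \<le> h" for k
  proof -
    have "{f \<in> P (Suc k). weight_part k f = 0} = P k"
      by (auto simp: P_def weight_part_def fun_eq_iff less_Suc_eq)
    moreover have "weight_part k ` P (Suc k) = isotypic_weight h m k"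
    proof (intro equalityI subsetI)
      fix f :: "'n qpoly" assume f: "f \<in> isotypic_weight h m k"
      then have "weight_part k f = f" "\<forall>e. f e \<noteq> 0 \<longrightarrow> bidegree True e < Suc k"
        using isotypic_weight_bihom[OF f] by (auto simp: bihom_def exponents_def weight_part_def fun_eq_iff)
      then show "f \<in> weight_part k ` P (Suc k)"
        using f isotypic_weight_subset[OF k] by (intro image_eqI[of _ _ f]) (auto simp: P_def)
    qed (use isotypic_weight_part k in \<open>auto simp: P_def\<close>)
    ultimately show ?thesis using rank_nullity[OF P[of "Suc k"] clinear_weight_part[of k]] by simp
  qed
  have "cfun.dim (P k) = (\<Sum>\<beta><k. cfun.dim (isotypic_weight h m \<beta> :: 'n qpoly set))"
    if "k \<le> Suc h" for k
    using that
  proof (induction k)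
    case 0
    have "P 0 \<subseteq> cfun.span {}" by (auto simp: P_def fun_eq_iff)
    then show ?case using cfun.dim_le_card[of "P 0" "{}"] by simp
  next
    case (Suc k)
    then show ?case using step[of k] by simp
  qed
  from this[of "Suc h"] have "cfun.dim (P (Suc h)) = (\<Sum>\<beta>\<le>h. cfun.dim (isotypic_weight h m \<beta> :: 'n qpoly set))"
    by (simp add: lessThan_Suc_atMost)
  moreover have "P (Suc h) = ?K"
    unfolding P_def isotypic_def by (auto simp: total_degree_bidegree)
  ultimately show ?thesis by simp
qed

text \<open>
  All binomial coefficients in the dimension count are multiples of one, by quadratic factors; the
  dimension formula then is a polynomial identity.
\<close>

lemma binomial_absorb2:
  fixes N n :: nat
  assumes "N \<ge> 2" "n + 2 \<ge> N"
  defines "c \<equiv> real (n choose (N - 2))" and "d \<equiv> real N * (real N - 1)"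
  shows "real (n choose N) * d = c * (real n - real N + 2) * (real n - real N + 1)"
    "real (Suc n choose N) * d = c * (real n + 1) * (real n - real N + 2)"
    "real (Suc (Suc n) choose N) * d = c * (real n + 2) * (real n + 1)"
proof -
  obtain k where N: "N = Suc (Suc k)" using assms(1) by (metis One_nat_def Suc_1 Suc_le_D Suc_le_mono)
  have up: "real (a choose Suc b) * real (Suc b) = real (a choose b) * (real a - real b)" for a b
  proof (cases "b \<le> a")
    case True
    have "Suc b * (a choose Suc b) = (a - b) * (a choose b)" by (rule binomial_absorb_comp[symmetric, THEN trans[OF binomial_absorption]])
    then have "real (Suc b * (a choose Suc b)) = real ((a - b) * (a choose b))" by (rule arg_cong)
    then show ?thesis using True by (simp add: of_nat_diff algebra_simps del: binomial_Suc_Suc)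
  qed (simp add: binomial_eq_0)
  have diag: "real (Suc a choose Suc b) * real (Suc b) = real (Suc a) * real (a choose b)" for a b
    using Suc_times_binomial_eq[of a b] by (metis of_nat_mult)
  have d: "d = real (Suc (Suc k)) * real (Suc k)" by (simp add: d_def N)
  show "real (n choose N) * d = c * (real n - real N + 2) * (real n - real N + 1)"
  proof -
    have "real (n choose N) * d = (real (n choose Suc (Suc k)) * real (Suc (Suc k))) * real (Suc k)"
      unfolding d N by (simp only: mult.assoc)
    also have "\<dots> = (real (n choose Suc k) * real (Suc k)) * (real n - real (Suc k))"
      unfolding up[of n "Suc k"] by (simp only: mult_ac)
    also have "\<dots> = c * (real n - real N + 2) * (real n - real N + 1)"
      unfolding up[of n k] c_def N by simp
    finally show ?thesis .
  qed
  show "real (Suc n choose N) * d = c * (real n + 1) * (real n - real N + 2)"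
  proof -
    have "real (Suc n choose N) * d = (real (Suc n choose Suc (Suc k)) * real (Suc (Suc k))) * real (Suc k)"
      unfolding d N by (simp only: mult.assoc)
    also have "\<dots> = real (Suc n) * (real (n choose Suc k) * real (Suc k))"
      unfolding diag[of n "Suc k"] by (simp only: mult_ac)
    also have "\<dots> = c * (real n + 1) * (real n - real N + 2)"
      unfolding up[of n k] c_def N by simp
    finally show ?thesis .
  qed
  show "real (Suc (Suc n) choose N) * d = c * (real n + 2) * (real n + 1)"
  proof -
    have "real (Suc (Suc n) choose N) * d = (real (Suc (Suc n) choose Suc (Suc k)) * real (Suc (Suc k))) * real (Suc k)"
      unfolding d N by (simp only: mult.assoc)
    also have "\<dots> = real (Suc (Suc n)) * (real (Suc n choose Suc k) * real (Suc k))"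
      unfolding diag[of "Suc n" "Suc k"] by (simp only: mult_ac)
    also have "\<dots> = c * (real n + 2) * (real n + 1)"
      unfolding diag[of n k] c_def N by (simp add: algebra_simps)
    finally show ?thesis .
  qed
qed

text \<open>
  There are \<open>h - 2 m + 1\<close> weights of equal multiplicity \<open>D\<close>. The highest weight space is the kernel of \<open>E\<close>
  on harmonic polynomials of bidegree \<open>(h - m, m)\<close>, and \<open>E\<close> is onto, so \<open>D\<close> is a difference of two values
  of \<open>dim_harmonic\<close>.
\<close>

lemma dim_isotypic:
  fixes h m :: nat
  assumes m: "2 * m \<le> h" and n: "CARD('n) \<ge> 2"
  defines "n \<equiv> CARD('n::finite)"
  shows "real (cfun.dim (isotypic h m :: 'n qpoly set)) =
         (real h - 2 * real m + 1)\<^sup>2 * (real h + 2 * real n - 1)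
           / ((2 * real n - 2) * (2 * real n - 1))
         * real ((h - m + 2 * n - 2) choose (2 * n - 3))
         * real ((m + 2 * n - 3) choose (2 * n - 3))"
proof -
  define N where "N = 2 * n - 1"
  define D where "D = cfun.dim (isotypic_weight h m m :: 'n qpoly set)"
  have N: "N \<ge> 3" "real N = 2 * real n - 1" using n by (auto simp: N_def n_def of_nat_diff)
  define dh where "dh \<alpha> \<beta> = real (cfun.dim (harmonic \<alpha> \<beta> :: 'n qpoly set))" for \<alpha> \<beta>
  have dh: "dh \<alpha> \<beta> = real ((\<alpha> + N) choose N) * real ((\<beta> + N) choose N)
      - real ((\<alpha> + N - 1) choose N) * real ((\<beta> + N - 1) choose N)" for \<alpha> \<beta>
    using arg_cong[OF dim_harmonic[where 'n = 'n, of \<alpha> \<beta>], of real]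
    unfolding dh_def N_def n_def of_nat_add of_nat_mult by linarith
  define \<alpha> where "\<alpha> = h - m"
  have \<alpha>: "m \<le> \<alpha>" "real \<alpha> = real h - real m" "h = \<alpha> + m" using m by (auto simp: \<alpha>_def)
  have D: "real D = dh \<alpha> m - real ((\<alpha> + 1 + N) choose N) * real ((m + N - 1) choose N)
      + real ((\<alpha> + N) choose N) * real ((m + N - 2) choose N)"
  proof -
    have "cfun.dim (harmonic \<alpha> m :: 'n qpoly set) = D +
        cfun.dim (raising ` (harmonic \<alpha> m :: 'n qpoly set))"
      unfolding D_def isotypic_highest[OF m] \<alpha>_def by (rule rank_nullity[OF fin_dim_harmonic clinear_polarization])
    moreover have "real (cfun.dim (raising ` (harmonic \<alpha> m :: 'n qpoly set)))
        = real ((\<alpha> + 1 + N) choose N) * real ((m + N - 1) choose N) - real ((\<alpha> + N) choose N) * real ((m + N - 2) choose N)"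
    proof (cases m)
      case 0
      have "raising ` (harmonic \<alpha> m :: 'n qpoly set) \<subseteq> cfun.span {}"
        using raising_lowering_bihom_0(2) by (auto simp: harmonic_def 0)
      then have "cfun.dim (raising ` (harmonic \<alpha> m :: 'n qpoly set)) = 0"
        using cfun.dim_le_card[of _ "{}"] by simp
      then show ?thesis using N by (simp add: 0 binomial_eq_0)
    next
      case (Suc b)
      have "raising ` harmonic \<alpha> m = (harmonic (Suc \<alpha>) b :: 'n qpoly set)"
      proof (intro equalityI subsetI)
        fix g :: "'n qpoly" assume g: "g \<in> harmonic (Suc \<alpha>) b"
        obtain f where "f \<in> harmonic \<alpha> m" "raising f = g"
          using raise_surj[OF _ g] \<alpha>(1) unfolding Suc by auto
        then show "g \<in> raising ` harmonic \<alpha> m" by blast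
      next
        fix g :: "'n qpoly" assume "g \<in> raising ` harmonic \<alpha> m"
        then show "g \<in> harmonic (Suc \<alpha>) b" unfolding Suc using raise_harmonic by blast
      qed
      then have "real (cfun.dim (raising ` (harmonic \<alpha> m :: 'n qpoly set))) = dh (Suc \<alpha>) b"
        by (simp add: dh_def)
      then show ?thesis unfolding dh by (simp add: Suc)
    qed
    ultimately show ?thesis unfolding dh_def by simp
  qed
  have "real (cfun.dim (isotypic h m :: 'n qpoly set)) =
      real (\<Sum>\<beta>\<le>h. if \<beta> \<in> {m..h - m} then D else 0)"
    unfolding dim_isotypic_sum
  proof (intro arg_cong[of _ _ real] sum.cong refl)
    fix \<beta> assume \<beta>: "\<beta> \<in> {..h}"
    show "cfun.dim (isotypic_weight h m \<beta> :: 'n qpoly set) = (if \<beta> \<in> {m..h - m} then D else 0)"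
    proof (cases "\<beta> \<in> {m..h - m}")
      case True
      then have "\<beta> + m \<le> h" using m by auto
      then show ?thesis using isotypic_weight_dim_const[of \<beta> m h, where 'n = 'n] True by (simp add: D_def)
    next
      case False
      have "f = 0" if f: "f \<in> isotypic_weight h m \<beta>" for f :: "'n qpoly"
      proof (rule ccontr)
        assume "f \<noteq> 0"
        from isotypic_weight_range[OF f this _ m] \<beta> False m show False by auto
      qed
      then have "(isotypic_weight h m \<beta> :: 'n qpoly set) \<subseteq> cfun.span {}" by auto
      then have "cfun.dim (isotypic_weight h m \<beta> :: 'n qpoly set) = 0"
        using cfun.dim_le_card[of _ "{}"] by simp
      then show ?thesis using False by (simp only: if_False)
    qed
  qed
  also have "(\<Sum>\<beta>\<le>h. if \<beta> \<in> {m..h - m} then D else 0) = (\<Sum>\<beta>\<in>{m..h - m}. D)"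
    by (subst sum.inter_restrict[symmetric]) (auto intro!: sum.cong)
  also have "\<dots> = (h - 2 * m + 1) * D"
  proof -
    have "card {m..h - m} = h - 2 * m + 1" using m by simp
    then show ?thesis by (simp only: sum_constant of_nat_id)
  qed
  finally have "real (cfun.dim (isotypic h m :: 'n qpoly set)) =
      real (h - 2 * m + 1) * real D" by (simp only: of_nat_mult)
  moreover have "real (h - 2 * m + 1) = real h - 2 * real m + 1" using m by (simp add: of_nat_diff)
  ultimately have dim: "real (cfun.dim (isotypic h m :: 'n qpoly set)) =
      (real h - 2 * real m + 1) * real D" by (simp only:)
  define ca where "ca = real ((\<alpha> + N - 1) choose (N - 2))"
  define cb where "cb = real ((m + N - 2) choose (N - 2))"
  define d where "d = real N * (real N - 1)"
  have d: "d \<noteq> 0" using N by (simp add: d_def)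
  have N2: "N \<ge> 2" using N by simp
  have a: "real ((\<alpha> + N - 1) choose N) * d = ca * (real \<alpha> + 1) * real \<alpha>"
    "real ((\<alpha> + N) choose N) * d = ca * (real \<alpha> + real N) * (real \<alpha> + 1)"
    "real ((\<alpha> + 1 + N) choose N) * d = ca * (real \<alpha> + real N + 1) * (real \<alpha> + real N)"
  proof -
    have e: "real (\<alpha> + N - 1) = real \<alpha> + real N - 1" "Suc (\<alpha> + N - 1) = \<alpha> + N" "Suc (\<alpha> + N) = \<alpha> + 1 + N"
      "\<alpha> + N - 1 + 2 \<ge> N" using N by (auto simp: of_nat_diff)
    show "real ((\<alpha> + N - 1) choose N) * d = ca * (real \<alpha> + 1) * real \<alpha>"
    "real ((\<alpha> + N) choose N) * d = ca * (real \<alpha> + real N) * (real \<alpha> + 1)"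
    "real ((\<alpha> + 1 + N) choose N) * d = ca * (real \<alpha> + real N + 1) * (real \<alpha> + real N)"
      using binomial_absorb2[OF N2 e(4)] unfolding e(1-3) d_def ca_def by simp_all
  qed
  have b: "real ((m + N - 2) choose N) * d = cb * real m * (real m - 1)"
    "real ((m + N - 1) choose N) * d = cb * (real m + real N - 1) * real m"
    "real ((m + N) choose N) * d = cb * (real m + real N) * (real m + real N - 1)"
  proof -
    have e: "real (m + N - 2) = real m + real N - 2" "Suc (m + N - 2) = m + N - 1" "Suc (m + N - 1) = m + N"
      "m + N - 2 + 2 \<ge> N" using N by (auto simp: of_nat_diff)
    show "real ((m + N - 2) choose N) * d = cb * real m * (real m - 1)"
    "real ((m + N - 1) choose N) * d = cb * (real m + real N - 1) * real m"
    "real ((m + N) choose N) * d = cb * (real m + real N) * (real m + real N - 1)"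
      using binomial_absorb2[OF N2 e(4)] unfolding e(1-3) d_def cb_def by (simp_all add: algebra_simps)
  qed
  (* Each binomial coefficient is multiplied by one factor d, so that a and b apply. *)
  have "real D * (d * d) =
      (real ((\<alpha> + N) choose N) * d) * (real ((m + N) choose N) * d)
      - (real ((\<alpha> + N - 1) choose N) * d) * (real ((m + N - 1) choose N) * d)
      - (real ((\<alpha> + 1 + N) choose N) * d) * (real ((m + N - 1) choose N) * d)
      + (real ((\<alpha> + N) choose N) * d) * (real ((m + N - 2) choose N) * d)"
    unfolding D dh by algebra
  also have "\<dots> = ca * cb * (real \<alpha> - real m + 1) * (real \<alpha> + real m + real N) * d"
    unfolding a b unfolding d_def by algebra
  finally have "real D * d = ca * cb * (real \<alpha> - real m + 1) * (real \<alpha> + real m + real N)"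
    using d by (metis mult.assoc mult_right_cancel)
  then have "real D = ca * cb * (real h - 2 * real m + 1) * (real h + 2 * real n - 1) / d"
    using d \<alpha>(2) N(2) by (simp add: field_simps)
  moreover have "d = (2 * real n - 2) * (2 * real n - 1)" by (simp add: d_def N(2))
  moreover have "ca = real ((h - m + 2 * n - 2) choose (2 * n - 3))" "cb = real ((m + 2 * n - 3) choose (2 * n - 3))"
    using n by (simp_all add: ca_def cb_def \<alpha>_def N_def n_def diff_diff_add numeral_eq_Suc)
  ultimately show ?thesis unfolding dim by (simp add: power2_eq_square)
qed

section \<open>Evaluation of formal polynomials\<close>

text \<open>
  With \<open>x\<^sub>l = z + w j\<close> for complex \<open>z\<close>, \<open>w\<close>, the two doublets are \<open>(z, cnj w)\<close> and \<open>(w, - cnj z)\<close>. Left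
  multiplication by a quaternion transforms them by the same matrix, as \<open>coord_quat_mult\<close> shows.
\<close>

definition coord :: "('n::finite \<times> bool) \<times> bool \<Rightarrow> quat ^ 'n \<Rightarrow> complex" where
  "coord i x = (case i of ((j, s), t) \<Rightarrow>
     if s then (if t then Complex (- qRe (x $ j)) (qIm1 (x $ j)) else Complex (qIm2 (x $ j)) (qIm3 (x $ j)))
     else (if t then Complex (qIm2 (x $ j)) (- qIm3 (x $ j)) else Complex (qRe (x $ j)) (qIm1 (x $ j))))"

lemma coord_simps:
  "coord ((j, False), False) x = Complex (qRe (x $ j)) (qIm1 (x $ j))"
  "coord ((j, False), True) x = Complex (qIm2 (x $ j)) (- qIm3 (x $ j))"
  "coord ((j, True), False) x = Complex (qIm2 (x $ j)) (qIm3 (x $ j))"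
  "coord ((j, True), True) x = Complex (- qRe (x $ j)) (qIm1 (x $ j))"
  by (simp_all add: coord_def)

lemma linear_coord: "linear (coord i)"
proof (rule linearI)
  obtain j s t where i: "i = ((j, s), t)" by (metis prod.exhaust)
  show "coord i (x + y) = coord i x + coord i y" for x y
    unfolding i by (cases s; cases t) (simp_all add: coord_simps plus_quat_def complex_eq_iff)
  show "coord i (c *\<^sub>R x) = c *\<^sub>R coord i x" for c x
    unfolding i by (cases s; cases t) (simp_all add: coord_simps scaleR_quat_def complex_eq_iff)
qed

lemma bounded_linear_coord: "bounded_linear (coord i)"
  using linear_coord by (simp add: linear_conv_bounded_linear)

lemma coord_has_derivative: "(coord i has_derivative coord i) F"
  by (rule bounded_linear_imp_has_derivative[OF bounded_linear_coord])

lemma coord_quat_mult: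
  "coord (a, False) (quat_i *s x) = \<i> * coord (a, False) x"
  "coord (a, True) (quat_i *s x) = - \<i> * coord (a, True) x"
  "coord (a, False) (quat_j *s x) = - coord (a, True) x"
  "coord (a, True) (quat_j *s x) = coord (a, False) x"
  "coord (a, False) (quat_k *s x) = - \<i> * coord (a, True) x"
  "coord (a, True) (quat_k *s x) = - \<i> * coord (a, False) x"
proof -
  obtain j s where a: "a = (j, s)" by (metis prod.exhaust)
  show "coord (a, False) (quat_i *s x) = \<i> * coord (a, False) x"
  "coord (a, True) (quat_i *s x) = - \<i> * coord (a, True) x"
  "coord (a, False) (quat_j *s x) = - coord (a, True) x"
  "coord (a, True) (quat_j *s x) = coord (a, False) x"
  "coord (a, False) (quat_k *s x) = - \<i> * coord (a, True) x"
  "coord (a, True) (quat_k *s x) = - \<i> * coord (a, False) x"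
    unfolding a by (cases s; simp add: coord_simps vector_scalar_mult_def times_quat_def
        quat_i_def quat_j_def quat_k_def complex_eq_iff)+
qed

definition peval :: "('n::finite) qpoly \<Rightarrow> quat ^ 'n \<Rightarrow> complex" where
  "peval f x = (\<Sum>e | f e \<noteq> 0. f e * (\<Prod>i\<in>UNIV. coord i x ^ e i))"

lemma peval_superset:
  assumes "finite A" "{e. f e \<noteq> 0} \<subseteq> A"
  shows "peval f x = (\<Sum>e\<in>A. f e * (\<Prod>i\<in>UNIV. coord i x ^ e i))"
  unfolding peval_def by (rule sum.mono_neutral_left) (use assms in auto)

lemma peval_0: "peval 0 x = 0"
  by (simp add: peval_def)

lemma peval_add:
  assumes "fin_supp f" "fin_supp g"
  shows "peval (f + g) x = peval f x + peval g x"
proof -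
  let ?A = "{e. f e \<noteq> 0} \<union> {e. g e \<noteq> 0}"
  have A: "finite ?A" "{e. f e \<noteq> 0} \<subseteq> ?A" "{e. g e \<noteq> 0} \<subseteq> ?A" "{e. (f + g) e \<noteq> 0} \<subseteq> ?A"
    using assms by (auto simp: fin_supp_def)
  show ?thesis
    unfolding peval_superset[OF A(1,2)] peval_superset[OF A(1,3)] peval_superset[OF A(1,4)]
    by (simp add: algebra_simps sum.distrib)
qed

lemma peval_scale:
  assumes "fin_supp f"
  shows "peval (cscale c f) x = c * peval f x"
proof -
  have A: "finite {e. f e \<noteq> 0}" "{e. cscale c f e \<noteq> 0} \<subseteq> {e. f e \<noteq> 0}" "{e. f e \<noteq> 0} \<subseteq> {e. f e \<noteq> 0}"
    using assms by (auto simp: fin_supp_def cscale_def)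
  show ?thesis unfolding peval_superset[OF A(1,2)] peval_superset[OF A(1,3)]
    by (simp add: cscale_def sum_distrib_left algebra_simps)
qed

lemma peval_diff:
  assumes "fin_supp f" "fin_supp g"
  shows "peval (f - g) x = peval f x - peval g x"
  using peval_add[OF assms(1) fin_supp_scale[OF assms(2)], of "-1" x] peval_scale[OF assms(2), of "-1" x]
  by (simp add: cfun.scale_minus_left)

lemma peval_sum:
  assumes "finite A" "\<And>a. a \<in> A \<Longrightarrow> fin_supp (f a)"
  shows "peval (sum f A) x = (\<Sum>a\<in>A. peval (f a) x)"
  using assms
proof (induction A rule: finite_induct)
  case (insert a A)
  then show ?case
    unfolding sum.insert[OF insert(1,2)] by (subst peval_add) (auto intro: fin_supp_sum)
qed (simp only: sum.empty peval_0)

lemma peval_xmul: "peval (xmul i f) x = coord i x * peval f x"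
proof -
  have "inj_on (\<lambda>e. e(i := Suc (e i))) A" for A :: "(('a \<times> bool) \<times> bool \<Rightarrow> nat) set"
    by (rule inj_onI) (metis fun_upd_idem_iff fun_upd_same fun_upd_upd nat.inject)
  then have "peval (xmul i f) x = (\<Sum>e | f e \<noteq> 0. xmul i f (e(i := Suc (e i))) *
      (\<Prod>k\<in>UNIV. coord k x ^ (e(i := Suc (e i))) k))"
    unfolding peval_def xmul_support by (subst sum.reindex) auto
  also have "\<dots> = (\<Sum>e | f e \<noteq> 0. coord i x * (f e * (\<Prod>k\<in>UNIV. coord k x ^ e k)))"
  proof (rule sum.cong[OF refl])
    fix e
    have "(\<Prod>k\<in>UNIV. coord k x ^ (e(i := Suc (e i))) k) = coord i x ^ Suc (e i) * (\<Prod>k\<in>UNIV - {i}. coord k x ^ e k)"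
      by (subst prod.remove[of _ i]) auto
    moreover have "(\<Prod>k\<in>UNIV. coord k x ^ e k) = coord i x ^ e i * (\<Prod>k\<in>UNIV - {i}. coord k x ^ e k)"
      by (subst prod.remove[of _ i]) auto
    ultimately show "xmul i f (e(i := Suc (e i))) * (\<Prod>k\<in>UNIV. coord k x ^ (e(i := Suc (e i))) k) =
       coord i x * (f e * (\<Prod>k\<in>UNIV. coord k x ^ e k))"
      by (simp add: xmul_def)
  qed
  finally show ?thesis by (simp add: peval_def sum_distrib_left)
qed

definition monomial :: "('i \<Rightarrow> nat) \<Rightarrow> ('i \<Rightarrow> nat) \<Rightarrow> complex" where
  "monomial d = (\<lambda>e. if e = d then 1 else 0)"

lemma fin_supp_monomial: "fin_supp (monomial d)"
  unfolding fin_supp_def monomial_def by (rule finite_subset[of _ "{d}"]) auto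

text \<open>
  Induction along the construction of a polynomial from variables, which matches the Leibniz rule and
  the closure properties of polynomial functions better than sums of monomials do.
\<close>

lemma fin_supp_induct [consumes 1, case_names one add scale xmul]:
  fixes f :: "('i::finite \<Rightarrow> nat) \<Rightarrow> complex"
  assumes f: "fin_supp f"
    and one: "P (monomial (\<lambda>_. 0))"
    and add: "\<And>f g. fin_supp f \<Longrightarrow> fin_supp g \<Longrightarrow> P f \<Longrightarrow> P g \<Longrightarrow> P (f + g)"
    and scale: "\<And>c f. fin_supp f \<Longrightarrow> P f \<Longrightarrow> P (cscale c f)"
    and xmul: "\<And>i f. fin_supp f \<Longrightarrow> P f \<Longrightarrow> P (xmul i f)"
  shows "P f"
proof -
  have mono: "P (monomial d)" for d :: "'i \<Rightarrow> nat"
  proof (induction "total_degree d" arbitrary: d)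
    case 0
    then have "d = (\<lambda>_. 0)" by (simp add: total_degree_def fun_eq_iff)
    then show ?case using one by simp
  next
    case (Suc n)
    then obtain i where i: "d i \<noteq> 0"
      by (metis Zero_neq_Suc sum.not_neutral_contains_not_neutral total_degree_def)
    have "total_degree d = d i + (\<Sum>k\<in>UNIV - {i}. d k)"
      "total_degree (d(i := d i - 1)) = d i - 1 + (\<Sum>k\<in>UNIV - {i}. d k)"
      unfolding total_degree_def by (subst sum.remove[of _ i]; simp)+
    then have "n = total_degree (d(i := d i - 1))" using Suc(2) i by simp
    from Suc(1)[OF this] have "P (xmul i (monomial (d(i := d i - 1))))"
      by (rule xmul[OF fin_supp_monomial])
    moreover have "xmul i (monomial (d(i := d i - 1))) = monomial d"
    proof
      fix e
      have "e(i := e i - 1) = d(i := d i - 1) \<longleftrightarrow> e = d" if "e i \<noteq> 0"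
      proof
        assume eq: "e(i := e i - 1) = d(i := d i - 1)"
        have "e k = d k" for k using fun_cong[OF eq, of k] i that by (cases "k = i") auto
        then show "e = d" by auto
      qed simp
      then show "xmul i (monomial (d(i := d i - 1))) e = monomial d e"
        using i by (auto simp: xmul_def monomial_def)
    qed
    ultimately show ?case by simp
  qed
  have zero: "P 0" using scale[OF fin_supp_monomial one, of 0] by simp
  have "P (\<Sum>d\<in>A. cscale (f d) (monomial d)) \<and> fin_supp (\<Sum>d\<in>A. cscale (f d) (monomial d))" if "finite A" for A
    using that
  proof (induction A rule: finite_induct)
    case (insert a A)
    then show ?case
      unfolding sum.insert[OF insert(1,2)]
      by (intro conjI add fin_supp_add fin_supp_scale fin_supp_monomial scale mono) auto
  qed (simp only: sum.empty zero fin_supp_0 simp_thms)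
  moreover have "(\<Sum>d | f d \<noteq> 0. cscale (f d) (monomial d)) = f"
  proof
    fix e
    have "(\<Sum>d | f d \<noteq> 0. cscale (f d) (monomial d)) e = (\<Sum>d | f d \<noteq> 0. if d = e then f d else 0)"
      unfolding sum_fun_apply by (rule sum.cong) (auto simp: cscale_def monomial_def)
    also have "\<dots> = f e" using f by (subst sum.delta) (auto simp: fin_supp_def)
    finally show "(\<Sum>d | f d \<noteq> 0. cscale (f d) (monomial d)) e = f e" .
  qed
  ultimately show ?thesis using f unfolding fin_supp_def by metis
qed

lemma peval_one: "peval (monomial (\<lambda>_. 0)) x = 1"
proof -
  have "{e. monomial (\<lambda>_. 0) e \<noteq> 0} = {\<lambda>_. 0}" by (auto simp: monomial_def)
  then show ?thesis by (simp add: peval_def monomial_def)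
qed

text \<open>
  Total derivatives of the evaluation, written in terms of formal partial derivatives; these two
  definitions carry all the calculus on the sphere.
\<close>

definition deriv1 :: "('n::finite) qpoly \<Rightarrow> quat ^ 'n \<Rightarrow> quat ^ 'n \<Rightarrow> complex" where
  "deriv1 f x v = (\<Sum>i\<in>UNIV. peval (pdiff i f) x * coord i v)"

definition deriv2 :: "('n::finite) qpoly \<Rightarrow> quat ^ 'n \<Rightarrow> quat ^ 'n \<Rightarrow> quat ^ 'n \<Rightarrow> complex" where
  "deriv2 f x v w = (\<Sum>i\<in>UNIV. \<Sum>k\<in>UNIV. peval (pdiff k (pdiff i f)) x * (coord i v * coord k w))"

lemma pdiff_one: "pdiff i (monomial (\<lambda>_. 0)) = 0"
  by (auto simp: pdiff_def monomial_def fun_eq_iff split: if_splits)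

lemma peval_has_derivative:
  fixes f :: "('n::finite) qpoly"
  assumes "fin_supp f"
  shows "(peval f has_derivative deriv1 f x) (at x)"
  using assms
proof (induction f rule: fin_supp_induct)
  case one
  have "peval (monomial (\<lambda>_. 0)) = (\<lambda>x :: quat ^ 'n. 1)" by (simp add: fun_eq_iff peval_one)
  moreover have "deriv1 (monomial (\<lambda>_. 0)) x = (\<lambda>_. 0)" by (simp add: fun_eq_iff deriv1_def pdiff_one peval_0)
  ultimately show ?case by (metis has_derivative_const)
next
  case (add f g)
  have "peval (f + g) = (\<lambda>x. peval f x + peval g x)" using add by (simp add: fun_eq_iff peval_add)
  moreover have "deriv1 (f + g) x = (\<lambda>v. deriv1 f x v + deriv1 g x v)"
    using add by (simp add: fun_eq_iff deriv1_def linear_ops peval_add fin_supp_pdiff algebra_simps sum.distrib)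
  ultimately show ?case using has_derivative_add[OF add.IH] by (simp only:)
next
  case (scale c f)
  have "peval (cscale c f) = (\<lambda>x. c * peval f x)" using scale by (simp add: fun_eq_iff peval_scale)
  moreover have "deriv1 (cscale c f) x = (\<lambda>v. c * deriv1 f x v)"
    using scale by (simp add: fun_eq_iff deriv1_def linear_ops peval_scale fin_supp_pdiff sum_distrib_left algebra_simps)
  ultimately show ?case using has_derivative_mult_right[OF scale.IH] by (simp only:)
next
  case (xmul i f)
  have "peval (xmul i f) = (\<lambda>x. coord i x * peval f x)" by (simp add: fun_eq_iff peval_xmul)
  moreover have "deriv1 (xmul i f) x v = coord i x * deriv1 f x v + coord i v * peval f x" for v
  proof -
    have "peval (pdiff k (xmul i f)) x * coord k v =
        coord i x * (peval (pdiff k f) x * coord k v) + (if k = i then coord i v * peval f x else 0)" for k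
      using xmul by (simp add: pdiff_xmul peval_add peval_xmul fin_supp_xmul fin_supp_pdiff algebra_simps)
    then show ?thesis by (simp add: deriv1_def sum.distrib sum_distrib_left)
  qed
  ultimately show ?case
    using has_derivative_mult[OF coord_has_derivative[of i] xmul.IH] by (simp add: fun_eq_iff)
qed

lemma deriv1_has_derivative:
  assumes "fin_supp f"
  shows "((\<lambda>x. deriv1 f x v) has_derivative deriv2 f x v) (at x)"
proof -
  have "((\<lambda>x. \<Sum>i\<in>UNIV. peval (pdiff i f) x * coord i v) has_derivative
      (\<lambda>w. \<Sum>i\<in>UNIV. deriv1 (pdiff i f) x w * coord i v)) (at x)"
    by (intro has_derivative_sum has_derivative_mult_left peval_has_derivative fin_supp_pdiff assms)
  then show ?thesis
    by (simp add: deriv1_def[abs_def] deriv2_def[abs_def] sum_distrib_right sum_distrib_left mult_ac)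
qed

lemma linear_deriv1: "linear (deriv1 f x)"
  unfolding deriv1_def [abs_def]
  by (intro linear_compose_sum ballI linear_compose[OF linear_coord, unfolded o_def] bounded_linear.linear[OF bounded_linear_mult_right])

lemma continuous_on_peval: "fin_supp f \<Longrightarrow> continuous_on S (peval f)"
  by (meson continuous_at_imp_continuous_on has_derivative_continuous peval_has_derivative)

lemma sum_pairs: "(\<Sum>i\<in>UNIV. g i) = (\<Sum>a\<in>UNIV. \<Sum>t\<in>UNIV. g (a, t))"
  by (simp add: sum.cartesian_product)

lemma sum_index: "(\<Sum>i\<in>UNIV. g i) = (\<Sum>k\<in>UNIV. \<Sum>s\<in>UNIV. \<Sum>t\<in>UNIV. g ((k, s), t))"
  unfolding sum_pairs[of g] by (rule sum_pairs)

text \<open>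
  The coordinates are only real-linear on the quaternionic space, but they are independent over the
  complex numbers as functions on it.
\<close>

lemma coord_dual:
  assumes "\<And>v. (\<Sum>i\<in>UNIV. c i * coord i v) = 0"
  shows "c i = 0"
proof -
  obtain j s t where i: "i = ((j, s), t)" by (metis prod.exhaust)
  have *: "(\<Sum>i\<in>UNIV. c i * coord i (axis j u)) = c ((j, False), False) * Complex (qRe u) (qIm1 u)
     + c ((j, False), True) * Complex (qIm2 u) (- qIm3 u) + c ((j, True), False) * Complex (qIm2 u) (qIm3 u)
     + c ((j, True), True) * Complex (- qRe u) (qIm1 u)" for u :: quat
  proof -
    have "(\<Sum>i\<in>UNIV. c i * coord i (axis j u)) =
        (\<Sum>k\<in>UNIV. \<Sum>s\<in>UNIV. \<Sum>t\<in>UNIV. c ((k, s), t) * coord ((k, s), t) (axis j u))"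
      by (rule sum_index)
    also have "\<dots> = (\<Sum>k\<in>UNIV. if k = j then c ((j, False), False) * Complex (qRe u) (qIm1 u)
     + c ((j, False), True) * Complex (qIm2 u) (- qIm3 u) + c ((j, True), False) * Complex (qIm2 u) (qIm3 u)
     + c ((j, True), True) * Complex (- qRe u) (qIm1 u) else 0)"
      by (rule sum.cong) (auto simp: UNIV_bool coord_simps axis_def zero_quat_def zero_complex.code[symmetric])
    finally show ?thesis by simp
  qed
  have 1: "c ((j, False), False) - c ((j, True), True) = 0"
    using assms[of "axis j 1"] unfolding * by (simp add: one_quat_def complex_eq_iff algebra_simps)
  have 2: "c ((j, False), False) + c ((j, True), True) = 0"
    using assms[of "axis j quat_i"] unfolding * by (simp add: quat_i_def complex_eq_iff algebra_simps)
  have 3: "c ((j, False), True) + c ((j, True), False) = 0"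
    using assms[of "axis j quat_j"] unfolding * by (simp add: quat_j_def complex_eq_iff algebra_simps)
  have 4: "c ((j, False), True) - c ((j, True), False) = 0"
    using assms[of "axis j quat_k"] unfolding * by (simp add: quat_k_def complex_eq_iff algebra_simps)
  from 1 2 have "c ((j, False), False) = 0" "c ((j, True), True) = 0" by (auto simp: complex_eq_iff)
  moreover from 3 4 have "c ((j, False), True) = 0" "c ((j, True), False) = 0" by (auto simp: complex_eq_iff)
  ultimately show ?thesis unfolding i by (cases s; cases t) auto
qed

text \<open>
  Derivatives of the zero function vanish, and by \<open>coord_dual\<close> so do the evaluations of all formal
  derivatives. Their values at the origin are the coefficients up to factorials.
\<close>

lemma peval_injective:
  assumes "fin_supp f" "\<And>x. peval f x = 0"
  shows "f = 0"
proof -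
  have diff: "peval (pdiff i f) x = 0" if "fin_supp f" "\<And>x. peval f x = 0" for f :: "'a qpoly" and i x
  proof -
    have "peval f = (\<lambda>_. 0)" using that by (simp add: fun_eq_iff)
    then have "(peval f has_derivative (\<lambda>_. 0)) (at x)" by simp
    from has_derivative_unique[OF this peval_has_derivative[OF that(1)]]
    have "deriv1 f x v = 0" for v by (metis)
    then show ?thesis unfolding deriv1_def by (rule coord_dual)
  qed
  have "f e = 0" for e
    using assms
  proof (induction "total_degree e" arbitrary: e f)
    case 0
    then have e: "e = (\<lambda>_. 0)" by (simp add: total_degree_def fun_eq_iff)
    have "coord i 0 = 0" for i :: "('a \<times> bool) \<times> bool" using linear_coord linear_0 by blast
    then have "(\<Prod>i\<in>UNIV. coord i (0 :: quat ^ 'a) ^ d i) = (if d = e then 1 else 0)" for d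
    proof (cases "d = e")
      case False
      then obtain i where "d i \<noteq> 0" by (auto simp: e fun_eq_iff simp del: split_paired_All split_paired_Ex)
      then have "coord i (0 :: quat ^ 'a) ^ d i = 0" using \<open>\<And>i. coord i 0 = 0\<close> by simp
      then show ?thesis using False by (simp only: if_False) (rule prod_zero[OF finite], blast)
    qed (simp add: e)
    then have "peval f 0 = (\<Sum>d | f d \<noteq> 0. if d = e then f d else 0)"
      unfolding peval_def by (intro sum.cong) auto
    also have "\<dots> = f e" using 0(2) by (subst sum.delta) (auto simp: fin_supp_def)
    finally show ?case using 0 by simp
  next
    case (Suc n)
    then obtain i where i: "e i \<noteq> 0"
      by (metis Zero_neq_Suc sum.not_neutral_contains_not_neutral total_degree_def)
    have "total_degree e = e i + (\<Sum>k\<in>UNIV - {i}. e k)"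
      "total_degree (e(i := e i - 1)) = e i - 1 + (\<Sum>k\<in>UNIV - {i}. e k)"
      unfolding total_degree_def by (subst sum.remove[of _ i]; simp)+
    then have "n = total_degree (e(i := e i - 1))" using Suc(2) i by simp
    from Suc(1)[OF this fin_supp_pdiff[OF Suc(3)] diff[OF Suc(3,4)]] have "pdiff i f (e(i := e i - 1)) = 0" .
    then show ?case using i by (simp add: pdiff_def)
  qed
  then show ?thesis by (simp add: fun_eq_iff)
qed

lemma bilinear_deriv2: "bilinear (deriv2 f x)"
proof -
  have 1: "linear (\<lambda>v. c * (coord i v * d))" for c d :: complex and i :: "('n::finite \<times> bool) \<times> bool"
    using linear_coord[of i] by (auto intro!: linearI simp: linear_add linear_cmul algebra_simps)
  have 2: "linear (\<lambda>v. c * (d * coord i v))" for c d :: complex and i :: "('n::finite \<times> bool) \<times> bool"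
    using linear_coord[of i] by (auto intro!: linearI simp: linear_add linear_cmul algebra_simps)
  show ?thesis
    unfolding bilinear_def deriv2_def by (intro conjI allI linear_compose_sum ballI 1 2)
qed

lemma sum_Basis_vec: "(\<Sum>b\<in>(Basis :: ('a::euclidean_space ^ 'n) set). g b) = (\<Sum>j\<in>UNIV. \<Sum>u\<in>Basis. g (axis j u))"
proof -
  have inj: "inj_on (\<lambda>(j, u). axis j u :: 'a ^ 'n) (UNIV \<times> Basis)"
    by (auto simp: inj_on_def axis_eq_axis)
  have "(Basis :: ('a ^ 'n) set) = (\<lambda>(j, u). axis j u) ` (UNIV \<times> Basis)"
    by (auto simp: Basis_vec_def)
  then have "(\<Sum>b\<in>(Basis :: ('a ^ 'n) set). g b) = (\<Sum>(j, u)\<in>UNIV \<times> Basis. g (axis j u))"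
    using sum.reindex[OF inj, of g] by (simp add: o_def split_def)
  then show ?thesis by (simp add: sum.cartesian_product)
qed

lemma sum_Basis_quat: "(\<Sum>u\<in>(Basis :: quat set). g u) = g 1 + g quat_i + g quat_j + g quat_k"
proof -
  have "(1 :: quat) \<noteq> quat_i" "(1 :: quat) \<noteq> quat_j" "(1 :: quat) \<noteq> quat_k" "quat_i \<noteq> quat_j"
    "quat_i \<noteq> quat_k" "quat_j \<noteq> quat_k"
    by (simp_all add: one_quat_def quat_i_def quat_j_def quat_k_def)
  then show ?thesis by (simp add: Basis_quat_def add.assoc)
qed

text \<open>
  The coefficients of the dual Euclidean form in the coordinates used here.
\<close>

lemma coord_trace:
  "(\<Sum>b\<in>Basis. coord ((j, s), t) b * coord ((k, s'), t') b) =
     (if j = k \<and> s \<noteq> s' \<and> t \<noteq> t' then (if s = t then - 2 else 2) else 0)"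
proof -
  define Q where "Q j s t u = coord ((j, s), t) (axis j u)" for j :: 'a and s t u
  have ax: "coord ((j, s), t) (axis l u) = (if l = j then Q j s t u else 0)" for j l s t u
    unfolding Q_def
    by (cases s; cases t) (simp_all add: coord_simps axis_def zero_quat_def zero_complex.code[symmetric])
  have "(\<Sum>b\<in>Basis. coord ((j, s), t) b * coord ((k, s'), t') b) =
      (\<Sum>l\<in>UNIV. if l = j then (if j = k then \<Sum>u\<in>Basis. Q j s t u * Q j s' t' u else 0) else 0)"
    unfolding sum_Basis_vec ax by (rule sum.cong[OF refl]) auto
  also have "\<dots> = (if j = k then \<Sum>u\<in>Basis. Q j s t u * Q j s' t' u else 0)"
    by simp
  also have "(\<Sum>u\<in>Basis. Q j s t u * Q j s' t' u) =
      (if s \<noteq> s' \<and> t \<noteq> t' then (if s = t then - 2 else 2) else 0)"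
    unfolding sum_Basis_quat Q_def
    by (cases s; cases t; cases s'; cases t')
      (simp_all add: coord_simps one_quat_def quat_i_def quat_j_def quat_k_def complex_eq_iff)
  finally show ?thesis by simp
qed

lemma sum_swap_pairs:
  "(\<Sum>b\<in>B. \<Sum>i\<in>I. \<Sum>k\<in>K. c i k * (g b i k :: complex)) = (\<Sum>i\<in>I. \<Sum>k\<in>K. c i k * (\<Sum>b\<in>B. g b i k))"
  unfolding sum_distrib_left by (subst sum.swap, rule sum.cong[OF refl], rule sum.swap)

lemma laplacian_peval:
  assumes f: "fin_supp f"
  shows "(\<Sum>b\<in>Basis. deriv2 f x b b) = 4 * peval (laplace f) x"
proof -
  let ?c = "\<lambda>i k. peval (pdiff k (pdiff i f)) x"
  have "(\<Sum>b\<in>Basis. deriv2 f x b b) = (\<Sum>i\<in>UNIV. \<Sum>k\<in>UNIV. ?c i k * (\<Sum>b\<in>Basis. coord i b * coord k b))"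
    unfolding deriv2_def by (rule sum_swap_pairs)
  also have "\<dots> = (\<Sum>j\<in>UNIV. - 2 * ?c ((j, False), False) ((j, True), True) - 2 * ?c ((j, True), True) ((j, False), False)
      + 2 * ?c ((j, False), True) ((j, True), False) + 2 * ?c ((j, True), False) ((j, False), True))"
    unfolding sum_index coord_trace
    by (rule sum.cong[OF refl]) (simp add: UNIV_bool sum.distrib if_distrib[of "(*) _"] cong: if_cong)
  also have "\<dots> = (\<Sum>j\<in>UNIV. 4 * (?c ((j, False), True) ((j, True), False) - ?c ((j, True), True) ((j, False), False)))"
    by (rule sum.cong[OF refl]) (simp add: pdiff_commute[of "((_, True), True)"] pdiff_commute[of "((_, False), True)"])
  also have "\<dots> = 4 * peval (laplace f) x"
    using f by (simp add: laplace_def peval_sum peval_diff fin_supp_pdiff fin_supp_diff sum_distrib_left)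
  finally show ?thesis .
qed

lemma casimir_expand:
  "casimir f = (\<Sum>a\<in>UNIV. \<Sum>b\<in>UNIV.
      cscale 4 (xmul (a, False) (xmul (b, True) (pdiff (a, False) (pdiff (b, True) f)))
        - xmul (a, True) (xmul (b, False) (pdiff (a, False) (pdiff (b, True) f)))))"
proof -
  have 1: "polarization False False (polarization True True f) =
      (\<Sum>a\<in>UNIV. \<Sum>b\<in>UNIV. xmul (a, False) (xmul (b, True) (pdiff (a, False) (pdiff (b, True) f))))"
    unfolding polarization_def by (simp add: linear_ops pdiff_xmul)
  have 2: "lowering (raising f) =
      (\<Sum>a\<in>UNIV. \<Sum>b\<in>UNIV. xmul (a, True) (xmul (b, False) (pdiff (a, False) (pdiff (b, True) f))))
       + polarization True True f"
    unfolding polarization_def by (simp add: linear_ops pdiff_xmul sum.distrib if_distrib[of "xmul _"] cong: if_cong)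
  show ?thesis
    unfolding casimir_def 1 2
    by (simp add: cfun.scale_sum_right[symmetric] sum_subtractf)
qed

text \<open>
  In the sum over \<open>1, i, j, k\<close> the products of two entries in the same position of their doublets
  cancel, and the others add up to twice a determinant.
\<close>

lemma casimir_peval:
  assumes f: "fin_supp f"
  shows "(\<Sum>u\<in>Basis. deriv2 f x (u *s x) (u *s x)) = peval (casimir f) x"
proof -
  let ?c = "\<lambda>i k. peval (pdiff k (pdiff i f)) x"
  have G: "(\<Sum>u\<in>Basis. coord (a, s) (u *s x) * coord (b, t) (u *s x)) =
     (if s = t then 0 else 2 * (coord (a, s) x * coord (b, t) x - coord (a, t) x * coord (b, s) x))" for a b s t
    unfolding sum_Basis_quat by (cases s; cases t) (simp_all add: coord_quat_mult algebra_simps)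
  have "(\<Sum>u\<in>Basis. deriv2 f x (u *s x) (u *s x)) =
      (\<Sum>i\<in>UNIV. \<Sum>k\<in>UNIV. ?c i k * (\<Sum>u\<in>Basis. coord i (u *s x) * coord k (u *s x)))"
    unfolding deriv2_def by (rule sum_swap_pairs)
  also have "\<dots> = (\<Sum>a\<in>UNIV. \<Sum>s\<in>UNIV. \<Sum>b\<in>UNIV. \<Sum>t\<in>UNIV. ?c (a, s) (b, t) *
      (if s = t then 0 else 2 * (coord (a, s) x * coord (b, t) x - coord (a, t) x * coord (b, s) x)))"
    unfolding sum_pairs G ..
  also have "\<dots> = (\<Sum>a\<in>UNIV. \<Sum>b\<in>UNIV. 2 * (?c (a, False) (b, True) * (coord (a, False) x * coord (b, True) x - coord (a, True) x * coord (b, False) x)))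
     + (\<Sum>a\<in>UNIV. \<Sum>b\<in>UNIV. 2 * (?c (a, True) (b, False) * (coord (a, True) x * coord (b, False) x - coord (a, False) x * coord (b, True) x)))"
    unfolding sum.distrib[symmetric]
    by (rule sum.cong[OF refl]) (simp add: UNIV_bool sum.distrib[symmetric] algebra_simps)
  also have "(\<Sum>a\<in>UNIV. \<Sum>b\<in>UNIV. 2 * (?c (a, True) (b, False) * (coord (a, True) x * coord (b, False) x - coord (a, False) x * coord (b, True) x)))
    = (\<Sum>a\<in>UNIV. \<Sum>b\<in>UNIV. 2 * (?c (a, False) (b, True) * (coord (a, False) x * coord (b, True) x - coord (a, True) x * coord (b, False) x)))"
    by (subst sum.swap) (simp add: pdiff_commute[of "(_, True)"] mult_ac)
  also have "\<dots> + \<dots> = (\<Sum>a\<in>UNIV. \<Sum>b\<in>UNIV. 4 * (?c (b, True) (a, False) * (coord (a, False) x * coord (b, True) x - coord (a, True) x * coord (b, False) x)))"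
    unfolding sum.distrib[symmetric] by (simp add: pdiff_commute[of "(_, True)"])
  also have "\<dots> = peval (casimir f) x"
    using f unfolding casimir_expand
    by (simp add: peval_sum peval_diff peval_scale peval_xmul fin_supp_pdiff fin_supp_xmul fin_supp_scale fin_supp_diff
        fin_supp_sum algebra_simps)
  finally show ?thesis .
qed

lemma peval_radius2:
  assumes f: "fin_supp f"
  shows "peval (radius2 f) x = of_real ((norm x)\<^sup>2) * peval f x"
proof -
  have "peval (radius2 f) x = (\<Sum>j\<in>UNIV. coord ((j, True), False) x * (coord ((j, False), True) x * peval f x)
      - coord ((j, False), False) x * (coord ((j, True), True) x * peval f x))"
    using f by (simp add: radius2_def peval_sum peval_diff peval_xmul fin_supp_xmul fin_supp_diff)
  also have "\<dots> = (\<Sum>j\<in>UNIV. of_real (x $ j \<bullet> x $ j) * peval f x)"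
    by (rule sum.cong) (simp_all add: coord_simps inner_quat_def complex_eq_iff algebra_simps)
  also have "\<dots> = of_real (x \<bullet> x) * peval f x"
    by (simp add: inner_vec_def sum_distrib_right)
  finally show ?thesis by (simp add: dot_square_norm)
qed

definition homogeneous :: "nat \<Rightarrow> (('i::finite \<Rightarrow> nat) \<Rightarrow> complex) \<Rightarrow> bool" where
  "homogeneous h f \<longleftrightarrow> (\<forall>e. f e \<noteq> 0 \<longrightarrow> total_degree e = h)"

lemma euler_sum: "(\<Sum>i\<in>UNIV. xmul i (pdiff i f)) = (\<lambda>e. of_nat (total_degree e) * f e)"
proof
  fix e
  have "xmul i (pdiff i f) e = of_nat (e i) * f e" for i
    by (auto simp: xmul_def pdiff_def)
  then show "(\<Sum>i\<in>UNIV. xmul i (pdiff i f)) e = of_nat (total_degree e) * f e"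
    by (simp add: sum_fun_apply total_degree_def sum_distrib_right)
qed

lemma deriv1_self: "fin_supp f \<Longrightarrow> deriv1 f x x = peval (\<lambda>e. of_nat (total_degree e) * f e) x"
  unfolding euler_sum[symmetric] deriv1_def
  by (simp add: peval_sum fin_supp_xmul fin_supp_pdiff peval_xmul mult.commute)

lemma deriv1_homogeneous:
  assumes "fin_supp f" "homogeneous h f"
  shows "deriv1 f x x = of_nat h * peval f x"
proof -
  have "(\<lambda>e. of_nat (total_degree e) * f e) = cscale (of_nat h) f"
    using assms(2) by (auto simp: homogeneous_def cscale_def fun_eq_iff)
  then show ?thesis using assms(1) by (simp add: deriv1_self peval_scale)
qed

lemma homogeneous_if_euler:
  assumes "fin_supp f" "\<And>x. deriv1 f x x = of_nat h * peval f x"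
  shows "homogeneous h f"
proof -
  let ?g = "\<lambda>e. of_nat (total_degree e) * f e"
  have g: "fin_supp ?g" using assms(1) unfolding fin_supp_def by (rule rev_finite_subset) auto
  have "?g - cscale (of_nat h) f = 0"
    by (rule peval_injective)
      (use assms g in \<open>simp_all add: fin_supp_diff fin_supp_scale peval_diff peval_scale deriv1_self[symmetric]\<close>)
  then have "of_nat (total_degree e) * f e = of_nat h * f e" for e
    by (auto simp: fun_eq_iff cscale_def)
  then show ?thesis by (auto simp: homogeneous_def)
qed

lemma homogeneous_pdiff: "homogeneous h f \<Longrightarrow> homogeneous (h - 1) (pdiff i f)"
  unfolding homogeneous_def
proof (intro allI impI)
  fix e assume h: "\<forall>e. f e \<noteq> 0 \<longrightarrow> total_degree e = h" and "pdiff i f e \<noteq> 0"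
  then have "total_degree (e(i := Suc (e i))) = h" by (auto simp: pdiff_def)
  moreover have "total_degree e = e i + (\<Sum>k\<in>UNIV - {i}. e k)"
    "total_degree (e(i := Suc (e i))) = Suc (e i) + (\<Sum>k\<in>UNIV - {i}. e k)"
    unfolding total_degree_def by (subst sum.remove[of _ i]; simp)+
  ultimately show "total_degree e = h - 1" by simp
qed

lemma deriv2_homogeneous:
  assumes "fin_supp f" "homogeneous h f"
  shows "deriv2 f x x x = of_real (real h * (real h - 1)) * peval f x"
proof -
  have "deriv2 f x x x = (\<Sum>i\<in>UNIV. deriv1 (pdiff i f) x x * coord i x)"
    by (simp add: deriv2_def deriv1_def sum_distrib_right sum_distrib_left mult_ac)
  also have "\<dots> = of_nat (h - 1) * deriv1 f x x"
    unfolding deriv1_homogeneous[OF fin_supp_pdiff[OF assms(1)] homogeneous_pdiff[OF assms(2)]]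
    by (simp add: sum_distrib_left deriv1_def mult_ac)
  also have "\<dots> = of_real (real h * (real h - 1)) * peval f x"
    using assms by (cases h) (simp_all add: deriv1_homogeneous)
  finally show ?thesis .
qed

lemma homogeneous_peval_scale:
  assumes f: "homogeneous h f"
  shows "peval f (r *\<^sub>R x) = of_real r ^ h * peval f x"
proof -
  have c: "coord i (r *\<^sub>R x) = of_real r * coord i x" for i
    unfolding linear_cmul[OF linear_coord] by (rule scaleR_conv_of_real)
  have "f e * (\<Prod>i\<in>UNIV. coord i (r *\<^sub>R x) ^ e i) = of_real r ^ h * (f e * (\<Prod>i\<in>UNIV. coord i x ^ e i))" if "f e \<noteq> 0" for e
  proof -
    have "(\<Prod>i\<in>UNIV. (of_real r :: complex) ^ e i) = of_real r ^ total_degree e"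
      by (simp add: total_degree_def power_sum)
    then show ?thesis using f that by (simp add: homogeneous_def c power_mult_distrib prod.distrib)
  qed
  then show ?thesis unfolding peval_def sum_distrib_left by (intro sum.cong) auto
qed

lemma fin_supp_homogeneous: "homogeneous h (f :: ('a::finite \<times> bool \<Rightarrow> nat) \<Rightarrow> complex) \<Longrightarrow> fin_supp f"
  unfolding homogeneous_def fin_supp_def by (rule finite_subset[OF _ finite_total_degree[of h]]) auto

lemma isotypic_homogeneous: "f \<in> isotypic h m \<Longrightarrow> homogeneous h f"
  by (simp add: isotypic_def homogeneous_def)

text \<open>
  The conditions on the right mention only the function and its derivatives, hence can be transported
  along linear maps.
\<close>

lemma isotypic_iff:
  assumes f: "fin_supp f"
  shows "f \<in> isotypic h m \<longleftrightarrow> (\<forall>x. deriv1 f x x = of_nat h * peval f x) \<and>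
    (\<forall>x. (\<Sum>b\<in>Basis. deriv2 f x b b) = 0) \<and>
    (\<forall>x. (\<Sum>u\<in>Basis. deriv2 f x (u *s x) (u *s x)) = casimir_value h m * peval f x)"
proof -
  have fc: "fin_supp (casimir f)"
    unfolding casimir_def by (intro fin_supp_scale fin_supp_diff fin_supp_add fin_supp_polarization f)
  have "laplace f = 0 \<longleftrightarrow> (\<forall>x. peval (laplace f) x = 0)"
    using peval_injective[OF fin_supp_laplace[OF f]] peval_0 by metis
  moreover have "casimir f = cscale (casimir_value h m) f \<longleftrightarrow> (\<forall>x. peval (casimir f) x = casimir_value h m * peval f x)"
  proof
    assume "\<forall>x. peval (casimir f) x = casimir_value h m * peval f x"
    then have "peval (casimir f - cscale (casimir_value h m) f) x = 0" for x
      using f fc by (simp add: peval_diff peval_scale fin_supp_scale)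
    then have "casimir f - cscale (casimir_value h m) f = 0"
      using f fc by (intro peval_injective fin_supp_diff fin_supp_scale)
    then show "casimir f = cscale (casimir_value h m) f" by simp
  qed (simp add: peval_scale f)
  moreover have "(\<forall>e. f e \<noteq> 0 \<longrightarrow> total_degree e = h) \<longleftrightarrow> (\<forall>x. deriv1 f x x = of_nat h * peval f x)"
    using homogeneous_if_euler[OF f] deriv1_homogeneous[OF f] unfolding homogeneous_def by metis
  ultimately show ?thesis
    unfolding isotypic_def by (simp add: laplacian_peval[OF f] casimir_peval[OF f])
qed

section \<open>Polynomial functions and linear substitutions\<close>

definition polyfun :: "(quat ^ 'n::finite \<Rightarrow> complex) set" where
  "polyfun = {peval f | f. fin_supp f}"

lemma polyfun_const: "(\<lambda>_. c) \<in> polyfun"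
proof -
  have "(\<lambda>_. c) = peval (cscale c (monomial (\<lambda>_. 0)))"
    by (simp add: fun_eq_iff peval_scale fin_supp_monomial peval_one)
  then show ?thesis unfolding polyfun_def using fin_supp_scale fin_supp_monomial by blast
qed

lemma polyfun_add:
  assumes "F \<in> polyfun" "G \<in> polyfun" shows "(\<lambda>x. F x + G x) \<in> polyfun"
proof -
  obtain f g where "F = peval f" "fin_supp f" "G = peval g" "fin_supp g" using assms by (auto simp: polyfun_def)
  then have "(\<lambda>x. F x + G x) = peval (f + g)" "fin_supp (f + g)"
    by (simp_all only: fun_eq_iff peval_add fin_supp_add simp_thms)
  then show ?thesis unfolding polyfun_def by blast
qed

lemma polyfun_scale:
  assumes "F \<in> polyfun" shows "(\<lambda>x. c * F x) \<in> polyfun"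
proof -
  obtain f where "F = peval f" "fin_supp f" using assms by (auto simp: polyfun_def)
  then have "(\<lambda>x. c * F x) = peval (cscale c f)" "fin_supp (cscale c f)"
    by (simp_all add: fun_eq_iff peval_scale fin_supp_scale)
  then show ?thesis unfolding polyfun_def by blast
qed

lemma polyfun_coord_mult:
  assumes "F \<in> polyfun" shows "(\<lambda>x. coord i x * F x) \<in> polyfun"
proof -
  obtain f where "F = peval f" "fin_supp f" using assms by (auto simp: polyfun_def)
  then have "(\<lambda>x. coord i x * F x) = peval (xmul i f)" "fin_supp (xmul i f)"
    by (simp_all add: fun_eq_iff peval_xmul fin_supp_xmul)
  then show ?thesis unfolding polyfun_def by blast
qed

lemma polyfun_sum: "(\<And>a. a \<in> A \<Longrightarrow> F a \<in> polyfun) \<Longrightarrow> (\<lambda>x. \<Sum>a\<in>A. F a x) \<in> polyfun"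
  by (induction A rule: infinite_finite_induct) (simp_all add: polyfun_const polyfun_add)

lemma polyfun_mult:
  assumes "F \<in> polyfun" "G \<in> polyfun" shows "(\<lambda>x. F x * G x) \<in> polyfun"
proof -
  obtain f where F: "F = peval f" and f: "fin_supp f" using assms(1) by (auto simp: polyfun_def)
  from f have "(\<lambda>x. peval f x * G x) \<in> polyfun"
  proof (induction f rule: fin_supp_induct)
    case one
    then show ?case using assms(2) by (simp add: peval_one)
  next
    case (add f g)
    have "(\<lambda>x. peval (f + g) x * G x) = (\<lambda>x. peval f x * G x + peval g x * G x)"
      using add by (simp only: fun_eq_iff peval_add distrib_right simp_thms)
    then show ?case using polyfun_add[OF add.IH] by (simp only:)
  next
    case (scale c f)
    then show ?case using polyfun_scale[OF scale.IH] by (simp add: peval_scale mult.assoc)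
  next
    case (xmul i f)
    then show ?case using polyfun_coord_mult[OF xmul.IH] by (simp add: peval_xmul mult.assoc)
  qed
  then show ?thesis by (simp add: F)
qed

lemma polyfun_coord: "coord i \<in> polyfun"
  using polyfun_coord_mult[OF polyfun_const[of 1], of i] by simp

lemma polyfun_inner_Basis:
  fixes b :: "quat ^ 'n"
  assumes "b \<in> Basis" shows "(\<lambda>x. of_real (x \<bullet> b)) \<in> polyfun"
proof -
  obtain j u where b: "b = axis j u" "u \<in> Basis" using assms by (auto simp: Basis_vec_def)
  have in_poly: "(\<lambda>x. c * coord i x + d * coord k x) \<in> polyfun" for c d and i k :: "('n \<times> bool) \<times> bool"
    by (intro polyfun_add polyfun_scale polyfun_coord)
  have ax: "x \<bullet> b = x $ j \<bullet> u" for x :: "quat ^ 'n" by (simp add: b inner_axis)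
  note cs = coord_simps complex_eq_iff inner_quat_def one_quat_def quat_i_def quat_j_def quat_k_def
  consider "u = 1" | "u = quat_i" | "u = quat_j" | "u = quat_k" using b(2) by (auto simp: Basis_quat_def)
  then show ?thesis
  proof cases
    case 1
    have "(\<lambda>x. of_real (x \<bullet> b)) = (\<lambda>x. 1/2 * coord ((j, False), False) x + (-1/2) * coord ((j, True), True) x)"
      by (simp add: fun_eq_iff ax 1 cs)
    then show ?thesis using in_poly by metis
  next
    case 2
    have "(\<lambda>x. of_real (x \<bullet> b)) = (\<lambda>x. (-\<i>/2) * coord ((j, False), False) x + (-\<i>/2) * coord ((j, True), True) x)"
      by (simp add: fun_eq_iff ax 2 cs)
    then show ?thesis using in_poly by metis
  next
    case 3
    have "(\<lambda>x. of_real (x \<bullet> b)) = (\<lambda>x. 1/2 * coord ((j, False), True) x + 1/2 * coord ((j, True), False) x)"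
      by (simp add: fun_eq_iff ax 3 cs)
    then show ?thesis using in_poly by metis
  next
    case 4
    have "(\<lambda>x. of_real (x \<bullet> b)) = (\<lambda>x. (\<i>/2) * coord ((j, False), True) x + (-\<i>/2) * coord ((j, True), False) x)"
      by (simp add: fun_eq_iff ax 4 cs)
    then show ?thesis using in_poly by metis
  qed
qed

text \<open>
  Real and imaginary parts of the quaternionic coordinates are complex combinations of the coordinates
  used here, because these contain each complex coordinate together with its conjugate up to sign.
\<close>

lemma polyfun_linear:
  fixes L :: "quat ^ 'n \<Rightarrow> complex"
  assumes "linear L" shows "L \<in> polyfun"
proof -
  have "L x = (\<Sum>b\<in>Basis. L b * of_real (x \<bullet> b))" for x
  proof -
    have "L x = L (\<Sum>b\<in>Basis. (x \<bullet> b) *\<^sub>R b)" by (simp add: euclidean_representation)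
    also have "\<dots> = (\<Sum>b\<in>Basis. (x \<bullet> b) *\<^sub>R L b)"
      using assms by (simp only: linear_sum linear_cmul)
    finally show ?thesis by (simp add: scaleR_conv_of_real mult.commute)
  qed
  then have "L = (\<lambda>x. \<Sum>b\<in>Basis. L b * of_real (x \<bullet> b))" by blast
  also have "\<dots> \<in> polyfun" by (intro polyfun_sum polyfun_scale polyfun_inner_Basis)
  finally show ?thesis .
qed

lemma polyfun_compose_linear:
  fixes A :: "quat ^ 'n \<Rightarrow> quat ^ 'n"
  assumes "F \<in> polyfun" "linear A" shows "(\<lambda>x. F (A x)) \<in> polyfun"
proof -
  obtain f where F: "F = peval f" and f: "fin_supp f" using assms(1) by (auto simp: polyfun_def)
  from f have "(\<lambda>x. peval f (A x)) \<in> polyfun"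
  proof (induction f rule: fin_supp_induct)
    case one
    then show ?case by (simp add: peval_one polyfun_const)
  next
    case (add f g)
    have "(\<lambda>x. peval (f + g) (A x)) = (\<lambda>x. peval f (A x) + peval g (A x))"
      using add by (simp only: fun_eq_iff peval_add simp_thms)
    then show ?case using polyfun_add[OF add.IH] by (simp only:)
  next
    case (scale c f)
    then show ?case using polyfun_scale[OF scale.IH] by (simp add: peval_scale)
  next
    case (xmul i f)
    have "(\<lambda>x. coord i (A x)) \<in> polyfun"
      by (intro polyfun_linear linear_compose[OF assms(2) linear_coord, unfolded o_def])
    from polyfun_mult[OF this xmul.IH] show ?case by (simp add: peval_xmul)
  qed
  then show ?thesis by (simp add: F)
qed

lemma polyfun_real_polynomial_function:
  assumes "real_polynomial_function (g :: quat ^ 'n \<Rightarrow> real)"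
  shows "(\<lambda>x. of_real (g x)) \<in> polyfun"
  using assms
proof (induction g rule: real_polynomial_function.induct)
  case (linear f)
  then have "linear (\<lambda>x. of_real (f x) :: complex)"
    using bounded_linear.linear[OF linear]
    by (intro linearI) (simp_all only: linear_add linear_cmul of_real_add of_real_mult real_scaleR_def
        scaleR_conv_of_real[where 'a = complex])
  then show ?case by (rule polyfun_linear)
next
  case (add f g)
  then show ?case using polyfun_add[of "\<lambda>x. of_real (f x)" "\<lambda>x. of_real (g x)"] by simp
next
  case (mult f g)
  then show ?case using polyfun_mult[of "\<lambda>x. of_real (f x)" "\<lambda>x. of_real (g x)"] by simp
qed (simp add: polyfun_const)

text \<open>
  The trace of a bilinear form does not depend on the orthonormal basis. Applied to second derivatives
  it gives the invariance of the Laplacian, and applied to \<open>(u, v) \<mapsto> D\<^sup>2F(x)(u x, v x)\<close> that of \<open>C\<close>.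
\<close>

lemma trace_orthogonal:
  fixes B :: "'a::euclidean_space \<Rightarrow> 'a \<Rightarrow> complex" and A :: "'a \<Rightarrow> 'a"
  assumes B: "bilinear B" and A: "orthogonal_transformation A"
  shows "(\<Sum>b\<in>Basis. B (A b) (A b)) = (\<Sum>b\<in>Basis. B b b)"
proof -
  have coord: "(\<Sum>b\<in>Basis. (A b \<bullet> c) * (A b \<bullet> d)) = c \<bullet> d" for c d
  proof -
    define A' where "A' = inv_into UNIV A"
    have A': "orthogonal_transformation A'" "A (A' y) = y" for y
      using A orthogonal_transformation_inv bij_is_surj[OF orthogonal_transformation_bij[OF A]]
      by (auto simp: A'_def surj_f_inv_f)
    have "A b \<bullet> c = b \<bullet> A' c" for b c
      using A A'(2)[of c] by (metis orthogonal_transformation_def)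
    then have "(\<Sum>b\<in>Basis. (A b \<bullet> c) * (A b \<bullet> d)) = (\<Sum>b\<in>Basis. (A' c \<bullet> b) * (A' d \<bullet> b))"
      by (simp add: inner_commute)
    also have "\<dots> = A' c \<bullet> A' d" by (rule euclidean_inner[symmetric])
    also have "\<dots> = c \<bullet> d" using A'(1) by (simp add: orthogonal_transformation_def)
    finally show ?thesis .
  qed
  have expand: "B x y = (\<Sum>c\<in>Basis. \<Sum>d\<in>Basis. ((x \<bullet> c) * (y \<bullet> d)) *\<^sub>R B c d)" for x y
  proof -
    have "B x y = B (\<Sum>c\<in>Basis. (x \<bullet> c) *\<^sub>R c) (\<Sum>d\<in>Basis. (y \<bullet> d) *\<^sub>R d)"
      by (simp only: euclidean_representation)
    also have "\<dots> = (\<Sum>(c, d)\<in>Basis \<times> Basis. B ((x \<bullet> c) *\<^sub>R c) ((y \<bullet> d) *\<^sub>R d))"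
      by (rule bilinear_sum[OF B])
    also have "\<dots> = (\<Sum>c\<in>Basis. \<Sum>d\<in>Basis. ((x \<bullet> c) * (y \<bullet> d)) *\<^sub>R B c d)"
      unfolding sum.cartesian_product[symmetric] by (simp add: bilinear_lmul[OF B] bilinear_rmul[OF B] mult.commute)
    finally show ?thesis .
  qed
  have "(\<Sum>b\<in>Basis. B (A b) (A b)) = (\<Sum>b\<in>Basis. \<Sum>c\<in>Basis. \<Sum>d\<in>Basis. ((A b \<bullet> c) * (A b \<bullet> d)) *\<^sub>R B c d)"
    by (subst expand) simp
  also have "\<dots> = (\<Sum>c\<in>Basis. \<Sum>d\<in>Basis. \<Sum>b\<in>Basis. ((A b \<bullet> c) * (A b \<bullet> d)) *\<^sub>R B c d)"
    by (subst sum.swap, rule sum.cong[OF refl], rule sum.swap)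
  also have "\<dots> = (\<Sum>c\<in>Basis. \<Sum>d\<in>Basis. (c \<bullet> d) *\<^sub>R B c d)"
    by (simp only: scaleR_left.sum[symmetric] coord)
  also have "\<dots> = (\<Sum>c\<in>Basis. \<Sum>d\<in>Basis. if c = d then B c d else 0)"
    by (intro sum.cong refl) (simp add: inner_Basis)
  also have "\<dots> = (\<Sum>b\<in>Basis. B b b)" by simp
  finally show ?thesis .
qed

lemma deriv_compose_linear:
  assumes f: "fin_supp f" and g: "fin_supp g" and A: "linear A"
    and eq: "\<And>x. peval g x = peval f (A x)"
  shows "deriv1 g x v = deriv1 f (A x) (A v)" "deriv2 g x v w = deriv2 f (A x) (A v) (A w)"
proof -
  have dA: "(A has_derivative A) F" for F
    using A by (intro bounded_linear_imp_has_derivative) (simp add: linear_conv_bounded_linear)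
  have 1: "deriv1 g x v = deriv1 f (A x) (A v)" for x v
  proof -
    have "peval g = (\<lambda>x. peval f (A x))" using eq by blast
    then have "(peval g has_derivative (\<lambda>v. deriv1 f (A x) (A v))) (at x)"
      using has_derivative_compose[OF dA peval_has_derivative[OF f]] by (simp only:)
    from has_derivative_unique[OF peval_has_derivative[OF g] this] show ?thesis by metis
  qed
  show "deriv1 g x v = deriv1 f (A x) (A v)" by (rule 1)
  have "((\<lambda>x. deriv1 g x v) has_derivative (\<lambda>w. deriv2 f (A x) (A v) (A w))) (at x)"
    unfolding 1 by (rule has_derivative_compose[OF dA deriv1_has_derivative[OF f]])
  from has_derivative_unique[OF deriv1_has_derivative[OF g] this]
  show "deriv2 g x v w = deriv2 f (A x) (A v) (A w)" by metis
qed

text \<open>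
  A common property of the two kinds of generators: linear maps over the quaternions, with \<open>\<phi>\<close> the
  identity, and multiplications by a unit \<open>c\<close>, with \<open>\<phi>\<close> the conjugation by \<open>c\<close>.
\<close>

definition quaternionic_isometry :: "(quat ^ 'n \<Rightarrow> quat ^ 'n) \<Rightarrow> bool" where
  "quaternionic_isometry A \<longleftrightarrow> orthogonal_transformation A \<and>
     (\<exists>\<phi>. orthogonal_transformation \<phi> \<and> (\<forall>u x. A (u *s x) = \<phi> u *s A x))"

lemma linear_scalar_left: "linear (\<lambda>u. u *s (x :: quat ^ 'n))"
  by (rule linearI)
    (simp_all add: vec_eq_iff vector_scalar_mult_def algebra_simps)

lemma linear_scalar_right: "linear (\<lambda>x :: quat ^ 'n. c *s x)"
  by (rule linearI)
    (simp_all add: vec_eq_iff vector_scalar_mult_def algebra_simps)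

lemma isotypic_invariant:
  assumes A: "quaternionic_isometry A" and f: "f \<in> isotypic h m"
  obtains g where "g \<in> isotypic h m" "\<And>x. peval g x = peval f (A x)"
proof -
  have oA: "orthogonal_transformation A" and lA: "linear A"
    using A by (auto simp: quaternionic_isometry_def orthogonal_transformation_linear)
  obtain \<phi> where \<phi>: "orthogonal_transformation \<phi>" "\<And>u x. A (u *s x) = \<phi> u *s A x"
    using A by (auto simp: quaternionic_isometry_def)
  have ff: "fin_supp f" using f isotypic_homogeneous fin_supp_homogeneous by metis
  have "peval f \<in> polyfun" using ff unfolding polyfun_def by blast
  then have "(\<lambda>x. peval f (A x)) \<in> polyfun" by (rule polyfun_compose_linear[OF _ lA])
  then obtain g where g: "fin_supp g" "(\<lambda>x. peval f (A x)) = peval g"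
    unfolding polyfun_def by blast
  then have gA: "peval g x = peval f (A x)" for x by metis
  note D = deriv_compose_linear[OF ff g(1) lA gA]
  have F: "deriv1 f x x = of_nat h * peval f x" "(\<Sum>b\<in>Basis. deriv2 f x b b) = 0"
    "(\<Sum>u\<in>Basis. deriv2 f x (u *s x) (u *s x)) = casimir_value h m * peval f x" for x
    using f unfolding isotypic_iff[OF ff] by auto
  have "(\<Sum>b\<in>Basis. deriv2 g x b b) = 0" for x
    unfolding D using trace_orthogonal[OF bilinear_deriv2 oA] F(2) by simp
  moreover have "(\<Sum>u\<in>Basis. deriv2 g x (u *s x) (u *s x)) = casimir_value h m * peval g x" for x
  proof -
    have bl: "bilinear (\<lambda>u v. deriv2 f (A x) (u *s A x) (v *s A x))"
      using bilinear_deriv2[of f "A x"] linear_compose[OF linear_scalar_left]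
      unfolding bilinear_def o_def by blast
    show ?thesis
      unfolding D \<phi>(2) using trace_orthogonal[OF bl \<phi>(1)] F(3) gA by simp
  qed
  ultimately have "g \<in> isotypic h m"
    unfolding isotypic_iff[OF g(1)] by (simp add: D F gA)
  then show thesis using gA by (rule that)
qed

lemma orthogonal_group: "group orthogonal_group"
proof (rule groupI)
  fix A :: "quat ^ 'a \<Rightarrow> quat ^ 'a" assume A: "A \<in> carrier orthogonal_group"
  then have "orthogonal_transformation (inv_into UNIV A)" "inv_into UNIV A \<circ> A = id"
    by (auto simp: orthogonal_group_def orthogonal_transformation_inv orthogonal_transformation_inj)
  then show "\<exists>B\<in>carrier orthogonal_group. B \<otimes>\<^bsub>orthogonal_group\<^esub> A = \<one>\<^bsub>orthogonal_group\<^esub>"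
    by (auto simp: orthogonal_group_def)
qed (auto simp: orthogonal_group_def orthogonal_transformation_compose o_assoc id_def)

lemma quaternionic_isometry_Sp1:
  assumes "A \<in> Sp1_bar" shows "quaternionic_isometry A"
proof -
  obtain c where c: "norm c = 1" "A = (\<lambda>x. c *s x)" using assms by (auto simp: Sp1_bar_def)
  have c0: "c \<noteq> 0" using c(1) by auto
  have "norm (c *s x) = norm x" for x :: "quat ^ 'a"
    unfolding norm_vec_def by (simp add: vector_scalar_mult_def norm_mult c(1))
  then have "orthogonal_transformation A"
    unfolding c(2) orthogonal_transformation using linear_scalar_right by blast
  moreover have "orthogonal_transformation (\<lambda>u. c * u * inverse c)"
    unfolding orthogonal_transformation
    by (auto intro!: linearI simp: algebra_simps norm_mult norm_inverse c(1))
  moreover have "A (u *s x) = (c * u * inverse c) *s A x" for u x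
    using c0 by (simp add: c(2) vec_eq_iff vector_scalar_mult_def mult.assoc)
      (simp add: mult.assoc[symmetric])
  ultimately show ?thesis unfolding quaternionic_isometry_def by blast
qed

lemma quaternionic_isometry_Sp:
  assumes "A \<in> Sp_group" shows "quaternionic_isometry A"
proof -
  have A: "A (x + y) = A x + A y" "A (c *s x) = c *s A x" "A x \<bullet> A y = x \<bullet> y" for x y c
    using assms by (auto simp: Sp_group_def)
  have "r *\<^sub>R x = (of_real r :: quat) *s x" for r and x :: "quat ^ 'a"
  proof -
    have "(r *\<^sub>R x) $ i = ((of_real r :: quat) *s x) $ i" for i
      using scaleR_conv_of_real[of r "x $ i"] by simp
    then show ?thesis unfolding vec_eq_iff ..
  qed
  then have "linear A" by (intro linearI) (simp_all add: A)
  then have "orthogonal_transformation A" by (simp add: orthogonal_transformation_def A)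
  moreover have "orthogonal_transformation (id :: quat \<Rightarrow> quat)" by (simp add: id_def)
  ultimately show ?thesis unfolding quaternionic_isometry_def using A(2) by (metis id_apply)
qed

lemma quaternionic_isometry_compose:
  assumes "quaternionic_isometry A" "quaternionic_isometry B"
  shows "quaternionic_isometry (A \<circ> B)"
proof -
  obtain \<phi> where \<phi>: "orthogonal_transformation \<phi>" "\<And>u x. A (u *s x) = \<phi> u *s A x"
    using assms by (auto simp: quaternionic_isometry_def)
  obtain \<psi> where \<psi>: "orthogonal_transformation \<psi>" "\<And>u x. B (u *s x) = \<psi> u *s B x"
    using assms by (auto simp: quaternionic_isometry_def)
  have "orthogonal_transformation (\<phi> \<circ> \<psi>)" "\<forall>u x. (A \<circ> B) (u *s x) = (\<phi> \<circ> \<psi>) u *s (A \<circ> B) x"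
    using \<phi> \<psi> by (auto intro: orthogonal_transformation_compose)
  then show ?thesis using assms unfolding quaternionic_isometry_def
    by (metis orthogonal_transformation_compose)
qed

lemma quaternionic_isometry_inverse:
  assumes A: "quaternionic_isometry A" and B: "orthogonal_transformation B" and AB: "A \<circ> B = id" "B \<circ> A = id"
  shows "quaternionic_isometry B"
proof -
  obtain \<phi> where \<phi>: "orthogonal_transformation \<phi>" "\<And>u x. A (u *s x) = \<phi> u *s A x"
    using A by (auto simp: quaternionic_isometry_def)
  let ?\<psi> = "inv_into UNIV \<phi>"
  have "\<phi> (?\<psi> u) = u" for u using bij_is_surj[OF orthogonal_transformation_bij[OF \<phi>(1)]] by (simp add: surj_f_inv_f)
  moreover have AB': "A (B x) = x" "B (A x) = x" for x using AB by (simp_all add: fun_eq_iff)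
  ultimately have "B (u *s y) = ?\<psi> u *s B y" for u y
    using \<phi>(2)[of "?\<psi> u" "B y"] by metis
  then show ?thesis unfolding quaternionic_isometry_def
    using B orthogonal_transformation_inv[OF \<phi>(1)] by blast
qed

lemma quaternionic_isometry_Sp1_Sp:
  assumes "A \<in> Sp1_Sp_group" shows "quaternionic_isometry A"
  using assms unfolding Sp1_Sp_group_def
proof (induction rule: generate.induct)
  case one
  have "orthogonal_transformation (id :: quat ^ 'a \<Rightarrow> quat ^ 'a)" "orthogonal_transformation (id :: quat \<Rightarrow> quat)"
    by (simp_all add: id_def)
  then show ?case unfolding orthogonal_group_def quaternionic_isometry_def by (metis id_apply monoid.simps(2))
next
  case (incl A)
  then show ?case using quaternionic_isometry_Sp1 quaternionic_isometry_Sp by blast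
next
  case (inv A)
  then have A: "quaternionic_isometry A" using quaternionic_isometry_Sp1 quaternionic_isometry_Sp by blast
  then have c: "A \<in> carrier orthogonal_group" by (simp add: orthogonal_group_def quaternionic_isometry_def)
  interpret group "orthogonal_group :: (quat ^ 'a \<Rightarrow> quat ^ 'a) monoid" by (rule orthogonal_group)
  show ?case
    using inv_closed[OF c] l_inv[OF c] r_inv[OF c]
    by (intro quaternionic_isometry_inverse[OF A]) (simp_all add: orthogonal_group_def)
next
  case (eng A B)
  have "A \<otimes>\<^bsub>orthogonal_group\<^esub> B = A \<circ> B" unfolding orthogonal_group_def by simp
  then show ?case using quaternionic_isometry_compose[OF eng.IH] by (simp only:)
qed

section \<open>Integration against the invariant measure\<close>

locale invariant_measure =
  fixes \<sigma> :: "(quat ^ 'n::finite) measure"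
  assumes invariant: "rotation_invariant_prob \<sigma>"

sublocale invariant_measure \<subseteq> prob_space \<sigma>
  using invariant by (simp add: rotation_invariant_prob_def)

context invariant_measure
begin

lemma sets_sigma: "sets \<sigma> = sets (restrict_space borel qsphere)"
  using invariant by (simp add: rotation_invariant_prob_def)

lemma space_sigma: "space \<sigma> = qsphere"
  using sets_eq_imp_space_eq[OF sets_sigma] by (simp add: space_restrict_space)

lemma measurable_sigma: "F \<in> borel_measurable borel \<Longrightarrow> F \<in> borel_measurable \<sigma>"
  using measurable_restrict_space1[of F borel borel qsphere] measurable_cong_sets[OF sets_sigma refl] by blast

lemma measurable_continuous: "continuous_on UNIV F \<Longrightarrow> F \<in> borel_measurable \<sigma>"
  by (intro measurable_sigma borel_measurable_continuous_onI)

lemma continuous_bounded_sphere: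
  fixes F :: "quat ^ 'n \<Rightarrow> 'b::real_normed_vector"
  assumes "continuous_on UNIV F"
  obtains M where "M > 0" "\<And>x. x \<in> qsphere \<Longrightarrow> norm (F x) \<le> M"
proof -
  have "compact (F ` qsphere)"
    unfolding qsphere_eq_sphere by (intro compact_continuous_image continuous_on_subset[OF assms]) auto
  then obtain M where "M > 0" "\<forall>y\<in>F ` qsphere. norm y \<le> M"
    using compact_imp_bounded bounded_pos by blast
  then show thesis using that by blast
qed

lemma integrable_continuous_sphere:
  fixes F :: "quat ^ 'n \<Rightarrow> complex"
  assumes "continuous_on UNIV F"
  shows "integrable \<sigma> F"
proof -
  obtain M where M: "\<And>x. x \<in> qsphere \<Longrightarrow> norm (F x) \<le> M"
    using continuous_bounded_sphere[OF assms] by metis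
  show ?thesis
    by (rule integrable_const_bound[of _ M]) (use M assms in \<open>auto simp: space_sigma measurable_continuous\<close>)
qed

lemma measurable_orthogonal:
  assumes "orthogonal_transformation A" shows "A \<in> measurable \<sigma> \<sigma>"
proof -
  have "A \<in> borel_measurable borel"
    using assms by (intro borel_measurable_continuous_onI linear_continuous_on)
      (simp add: linear_conv_bounded_linear[symmetric] orthogonal_transformation_linear)
  then have "A \<in> measurable (restrict_space borel qsphere) (restrict_space borel qsphere)"
    using assms by (intro measurable_restrict_space3) (auto simp: qsphere_eq_sphere orthogonal_transformation_norm)
  then show ?thesis by (simp add: measurable_cong_sets[OF sets_sigma sets_sigma])
qed

lemma distr_orthogonal: "orthogonal_transformation A \<Longrightarrow> distr \<sigma> \<sigma> A = \<sigma>"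
  using invariant by (simp add: rotation_invariant_prob_def)

lemma integral_orthogonal:
  fixes F :: "quat ^ 'n \<Rightarrow> complex"
  assumes "orthogonal_transformation A" "continuous_on UNIV F"
  shows "(LINT x|\<sigma>. F (A x)) = (LINT x|\<sigma>. F x)"
proof -
  have "F \<in> borel_measurable \<sigma>" using assms(2) by (rule measurable_continuous)
  then have "integral\<^sup>L (distr \<sigma> \<sigma> A) F = (LINT x|\<sigma>. F (A x))"
    by (rule integral_distr[OF measurable_orthogonal[OF assms(1)]])
  moreover have "distr \<sigma> \<sigma> A = \<sigma>" using assms(1) by (rule distr_orthogonal)
  ultimately show ?thesis by metis
qed

end

text \<open>
  The condition \<open>A\<^sup>3 = - A\<close> holds both for infinitesimal rotations in a coordinate plane and for left
  multiplication by a quaternionic unit, and it makes the exponential of \<open>t A\<close> the explicit expression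
  of \<open>rotation_flow\<close>.
\<close>

definition rotation_generator :: "('a::euclidean_space \<Rightarrow> 'a) \<Rightarrow> bool" where
  "rotation_generator A \<longleftrightarrow> linear A \<and> (\<forall>x. x \<bullet> A x = 0) \<and> (\<forall>x. A (A (A x)) = - A x)"

definition rotation_flow :: "('a::euclidean_space \<Rightarrow> 'a) \<Rightarrow> real \<Rightarrow> 'a \<Rightarrow> 'a" where
  "rotation_flow A t x = x + sin t *\<^sub>R A x + (1 - cos t) *\<^sub>R A (A x)"

lemma rotation_flow_orthogonal:
  assumes "rotation_generator A" shows "orthogonal_transformation (rotation_flow A t)"
proof -
  have A: "linear A" "x \<bullet> A x = 0" "A (A (A x)) = - A x" for x
    using assms by (auto simp: rotation_generator_def)
  have skew: "x \<bullet> A y = - (A x \<bullet> y)" for x y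
    using A(2)[of "x + y"] by (simp add: linear_add[OF A(1)] inner_add_left inner_add_right A(2) inner_commute[of "A x"])
  have "linear (rotation_flow A t)"
    unfolding rotation_flow_def
    by (rule linearI) (simp_all add: linear_add[OF A(1)] linear_cmul[OF A(1)] algebra_simps)
  moreover have "norm (rotation_flow A t x) = norm x" for x
  proof -
    define a where "a = A x \<bullet> A x"
    have 1: "x \<bullet> A (A x) = - a" by (simp add: skew[of x] a_def)
    have 2: "A (A x) \<bullet> A (A x) = a"
      using skew[of "A (A x)" "A x"] by (simp add: A(3) a_def inner_minus_left)
    have 3: "A x \<bullet> A (A x) = 0" by (rule A(2))
    have 4: "A x \<bullet> x = 0" "A (A x) \<bullet> x = - a" "A (A x) \<bullet> A x = 0"
      using 1 3 A(2)[of x] by (simp_all add: inner_commute)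
    have "rotation_flow A t x \<bullet> rotation_flow A t x = x \<bullet> x + ((sin t)\<^sup>2 + (1 - cos t)\<^sup>2 - 2 * (1 - cos t)) * a"
      unfolding rotation_flow_def inner_add_left inner_add_right inner_scaleR_left inner_scaleR_right
        1 2 3 4 A(2)[of x] a_def[symmetric] by algebra
    also have "(sin t)\<^sup>2 + (1 - cos t)\<^sup>2 - 2 * (1 - cos t) = 0"
      using sin_cos_squared_add[of t] by (simp add: power2_eq_square algebra_simps)
    finally show ?thesis by (simp add: norm_eq)
  qed
  ultimately show ?thesis unfolding orthogonal_transformation by blast
qed

lemma rotation_flow_derivative:
  assumes "rotation_generator A"
  shows "((\<lambda>t. rotation_flow A t x) has_vector_derivative A (rotation_flow A t x)) (at t)"
proof -
  have A: "linear A" "A (A (A x)) = - A x" for x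
    using assms by (auto simp: rotation_generator_def)
  have "((\<lambda>t. x + sin t *\<^sub>R A x + (1 - cos t) *\<^sub>R A (A x)) has_vector_derivative
      (cos t *\<^sub>R A x + sin t *\<^sub>R A (A x))) (at t)"
    by (auto intro!: derivative_eq_intros simp: has_real_derivative_iff_has_vector_derivative[symmetric])
  moreover have "A (rotation_flow A t x) = cos t *\<^sub>R A x + sin t *\<^sub>R A (A x)"
    unfolding rotation_flow_def linear_add[OF A(1)] linear_cmul[OF A(1)] A(2) by (simp add: algebra_simps)
  ultimately show ?thesis by (simp add: rotation_flow_def[abs_def])
qed

context invariant_measure
begin

text \<open>
  The integral of \<open>F\<close> composed with the flow is constant in time. Difference quotients are bounded by the
  maximum of the derivative on the sphere, so they may be integrated termwise.
\<close>

lemma integral_infinitesimal_rotation: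
  fixes F :: "quat ^ 'n \<Rightarrow> complex"
  assumes F: "\<And>x. (F has_derivative F' x) (at x)" and A: "rotation_generator A"
    and cont: "continuous_on UNIV (\<lambda>x. F' x (A x))"
  shows "(LINT x|\<sigma>. F' x (A x)) = 0"
proof -
  let ?R = "rotation_flow A"
  define g where "g k x = (F (?R (1 / Suc k) x) - F x) / of_real (1 / Suc k)" for k x
  have cF: "continuous_on UNIV F"
    using F by (meson continuous_at_imp_continuous_on has_derivative_continuous)
  have cR: "continuous_on UNIV (?R t)" for t
    using rotation_flow_orthogonal[OF A]
    by (intro linear_continuous_on) (simp add: linear_conv_bounded_linear[symmetric] orthogonal_transformation_linear)
  have cFR: "continuous_on UNIV (\<lambda>x. F (?R t x))" for t
    using continuous_on_compose2[OF cF cR] by simp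
  have der: "((\<lambda>t. F (?R t x)) has_vector_derivative F' (?R t x) (A (?R t x))) (at t)" for x t
    using rotation_flow_derivative[OF A, of x t] has_derivative_compose[OF _ F]
    unfolding has_vector_derivative_def
    by (fastforce simp: linear_cmul[OF has_derivative_linear[OF F]])
  obtain M where M: "M > 0" "\<And>x. x \<in> qsphere \<Longrightarrow> norm (F' x (A x)) \<le> M"
    using continuous_bounded_sphere[OF cont] by metis
  have zero: "(LINT x|\<sigma>. g k x) = 0" for k
  proof -
    have "(LINT x|\<sigma>. g k x) = (LINT x|\<sigma>. F (?R (1 / Suc k) x) - F x) / of_real (1 / Suc k)"
      unfolding g_def by simp
    also have "(LINT x|\<sigma>. F (?R (1 / Suc k) x) - F x) = (LINT x|\<sigma>. F (?R (1 / Suc k) x)) - (LINT x|\<sigma>. F x)"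
      by (intro Bochner_Integration.integral_diff integrable_continuous_sphere cF cFR)
    also have "\<dots> = 0"
      using integral_orthogonal[OF rotation_flow_orthogonal[OF A] cF] by simp
    finally show ?thesis by simp
  qed
  have lim: "(\<lambda>k. g k x) \<longlonglongrightarrow> F' x (A x)" for x
  proof -
    have R0: "?R 0 x = x" by (simp add: rotation_flow_def)
    have "((\<lambda>t. F (?R t x)) has_derivative (\<lambda>s. s *\<^sub>R F' (?R 0 x) (A (?R 0 x)))) (at 0)"
      using der[of x 0] by (simp add: has_vector_derivative_def)
    then have L: "((\<lambda>h. norm (F (?R h x) - F x - h *\<^sub>R F' x (A x)) / norm h) \<longlongrightarrow> 0) (at 0)"
      unfolding has_derivative_at by (simp add: R0)
    have "filterlim (\<lambda>k. 1 / real (Suc k)) (at 0) sequentially"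
      by (rule filterlim_atI[OF LIMSEQ_inverse_real_of_nat[unfolded inverse_eq_divide]]) simp
    from filterlim_compose[OF L this]
    have "(\<lambda>k. norm (F (?R (1 / Suc k) x) - F x - (1 / Suc k) *\<^sub>R F' x (A x)) / norm (1 / real (Suc k))) \<longlonglongrightarrow> 0" .
    moreover have "norm (F (?R (1 / Suc k) x) - F x - (1 / Suc k) *\<^sub>R F' x (A x)) / norm (1 / real (Suc k))
        = norm (g k x - F' x (A x))" for k
    proof -
      have "(of_real (1 / real (Suc k)) :: complex) \<noteq> 0" by (simp del: of_nat_Suc)
      moreover have "(a - b) / c - d = (a - b - c * d) / c" if "c \<noteq> 0" for a b c d :: complex
        using that by (simp add: field_simps)
      ultimately have "g k x - F' x (A x) = (F (?R (1 / Suc k) x) - F x - (1 / Suc k) *\<^sub>R F' x (A x)) / of_real (1 / Suc k)"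
        unfolding g_def scaleR_conv_of_real[where 'a = complex]
        by blast
      then show ?thesis by (simp only: norm_divide norm_of_real real_norm_def)
    qed
    ultimately have "(\<lambda>k. norm (g k x - F' x (A x))) \<longlonglongrightarrow> 0" by (simp only:)
    then show ?thesis by (rule LIM_zero_cancel[OF tendsto_norm_zero_cancel])
  qed
  have "(\<lambda>k. LINT x|\<sigma>. g k x) \<longlonglongrightarrow> (LINT x|\<sigma>. F' x (A x))"
  proof (rule integral_dominated_convergence[where w = "\<lambda>_. M"])
    show "AE x in \<sigma>. norm (g k x) \<le> M" for k
    proof (rule AE_I2)
      fix x assume x: "x \<in> space \<sigma>"
      have R: "?R t x \<in> qsphere" for t
        using x orthogonal_transformation_norm[OF rotation_flow_orthogonal[OF A]] by (simp add: space_sigma qsphere_eq_sphere)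
      have "norm (F (?R (1 / Suc k) x) - F (?R 0 x)) \<le> M * norm (1 / real (Suc k) - 0)"
      proof (rule differentiable_bound[where S = UNIV and f = "\<lambda>t. F (?R t x)"
            and f' = "\<lambda>t s. s *\<^sub>R F' (?R t x) (A (?R t x))"])
        show "((\<lambda>t. F (?R t x)) has_derivative (\<lambda>s. s *\<^sub>R F' (?R t x) (A (?R t x)))) (at t within UNIV)" for t
          using der[of x t] by (simp add: has_vector_derivative_def)
        show "onorm (\<lambda>s. s *\<^sub>R F' (?R t x) (A (?R t x))) \<le> M" for t
        proof (rule onorm_le)
          show "norm (s *\<^sub>R F' (?R t x) (A (?R t x))) \<le> M * norm s" for s :: real
            using mult_right_mono[OF M(2)[OF R[of t]] norm_ge_zero[of s]] by (simp add: mult.commute)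
        qed
      qed auto
      then have "norm (F (?R (1 / Suc k) x) - F x) \<le> M * (1 / real (Suc k))"
        by (simp add: rotation_flow_def)
      then show "norm (g k x) \<le> M"
        unfolding g_def norm_divide norm_of_real by (subst pos_divide_le_eq) auto
    qed
    show "g k \<in> borel_measurable \<sigma>" for k
      unfolding g_def by (intro borel_measurable_divide borel_measurable_diff borel_measurable_const measurable_continuous cF cFR)
  qed (use lim cont measurable_continuous in auto)
  then have "(\<lambda>k. 0) \<longlonglongrightarrow> (LINT x|\<sigma>. F' x (A x))" unfolding zero .
  then show ?thesis by (simp add: LIMSEQ_const_iff)
qed

end

text \<open>
  The second derivative of the evaluation of \<open>f\<close> along the vector field \<open>A\<close>; the second summand comes from
  differentiating the field itself.
\<close>

definition second_lie :: "('n::finite) qpoly \<Rightarrow> (quat ^ 'n \<Rightarrow> quat ^ 'n) \<Rightarrow> quat ^ 'n \<Rightarrow> complex" where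
  "second_lie f A x = deriv2 f x (A x) (A x) + deriv1 f x (A (A x))"

lemma lie_derivative:
  assumes f: "fin_supp f" and A: "linear A"
  shows "((\<lambda>x. deriv1 f x (A x)) has_derivative (\<lambda>w. deriv2 f x (A x) w + deriv1 f x (A w))) (at x)"
proof -
  have "linear (\<lambda>x. coord i (A x))" for i using linear_compose[OF A linear_coord[of i]] by (simp add: o_def)
  then have c: "((\<lambda>x. coord i (A x)) has_derivative (\<lambda>x. coord i (A x))) (at x)" for i
    by (intro bounded_linear_imp_has_derivative) (simp add: linear_conv_bounded_linear)
  have "((\<lambda>x. \<Sum>i\<in>UNIV. peval (pdiff i f) x * coord i (A x)) has_derivative
      (\<lambda>w. \<Sum>i\<in>UNIV. peval (pdiff i f) x * coord i (A w) + deriv1 (pdiff i f) x w * coord i (A x))) (at x)"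
    by (intro has_derivative_sum has_derivative_mult peval_has_derivative fin_supp_pdiff f c)
  moreover have "(\<Sum>i\<in>UNIV. peval (pdiff i f) x * coord i (A w) + deriv1 (pdiff i f) x w * coord i (A x)) =
      deriv2 f x (A x) w + deriv1 f x (A w)" for w
    by (simp add: deriv1_def deriv2_def sum.distrib sum_distrib_left sum_distrib_right mult_ac)
  ultimately show ?thesis by (simp add: deriv1_def)
qed

lemma continuous_on_deriv1:
  assumes "fin_supp f" "linear A" shows "continuous_on S (\<lambda>x. deriv1 f x (A x))"
  using lie_derivative[OF assms] by (meson continuous_at_imp_continuous_on has_derivative_continuous)

lemma continuous_on_second_lie:
  assumes f: "fin_supp f" and A: "linear A" shows "continuous_on S (second_lie f A)"
proof -
  have c: "continuous_on S (\<lambda>x. coord i (A x))" for i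
    using linear_compose[OF A linear_coord[of i]]
    by (intro linear_continuous_on) (simp add: linear_conv_bounded_linear[symmetric] o_def)
  have AA: "linear (\<lambda>x. A (A x))" using linear_compose[OF A A] by (simp add: o_def)
  show ?thesis
    unfolding second_lie_def [abs_def] deriv2_def
    by (intro continuous_on_add continuous_on_sum continuous_on_mult c continuous_on_peval fin_supp_pdiff f
        continuous_on_deriv1 AA)
qed

context invariant_measure
begin

text \<open>
  Integration by parts twice: both sides equal minus the integral of the product of the first
  derivatives.
\<close>

lemma second_lie_symmetric:
  fixes f g :: "'n qpoly"
  assumes f: "fin_supp f" and g: "fin_supp g" and A: "rotation_generator A"
  shows "(LINT x|\<sigma>. second_lie f A x * cnj (peval g x)) = (LINT x|\<sigma>. peval f x * cnj (second_lie g A x))"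
proof -
  have lA: "linear A" using A by (simp add: rotation_generator_def)
  let ?d = "\<lambda>f x. deriv1 f x (A x)"
  note cc = continuous_on_peval continuous_on_second_lie[OF _ lA] continuous_on_deriv1[OF _ lA]
  have dcnj: "((\<lambda>x. cnj (G x)) has_derivative (\<lambda>v. cnj (G' v))) F" if "(G has_derivative G') F" for G :: "quat ^ 'n \<Rightarrow> complex" and G' F
    using bounded_linear.has_derivative[OF bounded_linear_cnj that] .
  have 1: "(LINT x|\<sigma>. ?d f x * cnj (?d g x) + second_lie f A x * cnj (peval g x)) = 0"
  proof -
    have "(LINT x|\<sigma>. (\<lambda>v. ?d f x * cnj (deriv1 g x v) + (deriv2 f x (A x) v + deriv1 f x (A v)) * cnj (peval g x)) (A x)) = 0"
    proof (rule integral_infinitesimal_rotation[OF _ A, where F = "\<lambda>x. ?d f x * cnj (peval g x)"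
          and F' = "\<lambda>x v. ?d f x * cnj (deriv1 g x v) + (deriv2 f x (A x) v + deriv1 f x (A v)) * cnj (peval g x)"])
      show "((\<lambda>x. ?d f x * cnj (peval g x)) has_derivative
          (\<lambda>v. ?d f x * cnj (deriv1 g x v) + (deriv2 f x (A x) v + deriv1 f x (A v)) * cnj (peval g x))) (at x)" for x
        by (intro has_derivative_mult lie_derivative[OF f lA] dcnj peval_has_derivative g)
      show "continuous_on UNIV (\<lambda>x. ?d f x * cnj (deriv1 g x (A x)) + (deriv2 f x (A x) (A x) + deriv1 f x (A (A x))) * cnj (peval g x))"
        unfolding second_lie_def[symmetric] using f g by (intro continuous_intros cc)
    qed
    then show ?thesis by (simp add: second_lie_def)
  qed
  have 2: "(LINT x|\<sigma>. peval f x * cnj (second_lie g A x) + ?d f x * cnj (?d g x)) = 0"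
  proof -
    have "(LINT x|\<sigma>. (\<lambda>v. peval f x * cnj (deriv2 g x (A x) v + deriv1 g x (A v)) + deriv1 f x v * cnj (?d g x)) (A x)) = 0"
    proof (rule integral_infinitesimal_rotation[OF _ A, where F = "\<lambda>x. peval f x * cnj (?d g x)"
          and F' = "\<lambda>x v. peval f x * cnj (deriv2 g x (A x) v + deriv1 g x (A v)) + deriv1 f x v * cnj (?d g x)"])
      show "((\<lambda>x. peval f x * cnj (?d g x)) has_derivative
          (\<lambda>v. peval f x * cnj (deriv2 g x (A x) v + deriv1 g x (A v)) + deriv1 f x v * cnj (?d g x))) (at x)" for x
        by (intro has_derivative_mult dcnj[OF lie_derivative[OF g lA]] peval_has_derivative f)
      show "continuous_on UNIV (\<lambda>x. peval f x * cnj (deriv2 g x (A x) (A x) + deriv1 g x (A (A x))) + deriv1 f x (A x) * cnj (?d g x))"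
        unfolding second_lie_def[symmetric] using f g by (intro continuous_intros cc)
    qed
    then show ?thesis by (simp add: second_lie_def)
  qed
  have I: "integrable \<sigma> (\<lambda>x. ?d f x * cnj (?d g x))" "integrable \<sigma> (\<lambda>x. second_lie f A x * cnj (peval g x))"
    "integrable \<sigma> (\<lambda>x. peval f x * cnj (second_lie g A x))"
    by (intro integrable_continuous_sphere continuous_intros cc f g)+
  have "(LINT x|\<sigma>. ?d f x * cnj (?d g x)) + (LINT x|\<sigma>. second_lie f A x * cnj (peval g x)) = 0"
    using 1 Bochner_Integration.integral_add[OF I(1,2)] by simp
  moreover have "(LINT x|\<sigma>. peval f x * cnj (second_lie g A x)) + (LINT x|\<sigma>. ?d f x * cnj (?d g x)) = 0"
    using 2 Bochner_Integration.integral_add[OF I(3,1)] by simp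
  moreover have "b = c" if "a + b = 0" "c + a = 0" for a b c :: complex
    using that by (metis add.commute add_left_cancel)
  ultimately show ?thesis by blast
qed

lemma eigenfunctions_orthogonal:
  fixes f g :: "'n qpoly" and A :: "'k \<Rightarrow> quat ^ 'n \<Rightarrow> quat ^ 'n"
  assumes f: "fin_supp f" and g: "fin_supp g" and A: "\<And>k. k \<in> K \<Longrightarrow> rotation_generator (A k)" and K: "finite K"
    and fe: "\<And>x. x \<in> qsphere \<Longrightarrow> (\<Sum>k\<in>K. second_lie f (A k) x) = of_real a * peval f x"
    and ge: "\<And>x. x \<in> qsphere \<Longrightarrow> (\<Sum>k\<in>K. second_lie g (A k) x) = of_real b * peval g x"
    and ab: "a \<noteq> b"
  shows "(LINT x|\<sigma>. peval f x * cnj (peval g x)) = 0"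
proof -
  have lA: "k \<in> K \<Longrightarrow> linear (A k)" for k using A by (simp add: rotation_generator_def)
  have int: "integrable \<sigma> (\<lambda>x. second_lie f (A k) x * cnj (peval g x))"
    "integrable \<sigma> (\<lambda>x. peval f x * cnj (second_lie g (A k) x))" if "k \<in> K" for k
    by (intro integrable_continuous_sphere continuous_intros continuous_on_peval continuous_on_second_lie f g lA[OF that])+
  have "of_real a * (LINT x|\<sigma>. peval f x * cnj (peval g x)) = (LINT x|\<sigma>. (\<Sum>k\<in>K. second_lie f (A k) x * cnj (peval g x)))"
    unfolding integral_mult_right_zero[symmetric]
    by (rule Bochner_Integration.integral_cong) (auto simp: space_sigma sum_distrib_right[symmetric] fe)
  also have "\<dots> = (\<Sum>k\<in>K. LINT x|\<sigma>. second_lie f (A k) x * cnj (peval g x))"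
    by (intro Bochner_Integration.integral_sum int)
  also have "\<dots> = (\<Sum>k\<in>K. LINT x|\<sigma>. peval f x * cnj (second_lie g (A k) x))"
    by (intro sum.cong refl second_lie_symmetric f g A)
  also have "\<dots> = (LINT x|\<sigma>. (\<Sum>k\<in>K. peval f x * cnj (second_lie g (A k) x)))"
    by (intro Bochner_Integration.integral_sum[symmetric] int)
  also have "\<dots> = (LINT x|\<sigma>. of_real b * (peval f x * cnj (peval g x)))"
    by (rule Bochner_Integration.integral_cong)
      (auto simp: space_sigma sum_distrib_left[symmetric] ge cnj_sum[symmetric])
  also have "\<dots> = of_real b * (LINT x|\<sigma>. peval f x * cnj (peval g x))"
    by (rule integral_mult_right_zero)
  finally show ?thesis using ab by simp
qed

end

definition plane_rotation :: "'a::euclidean_space \<times> 'a \<Rightarrow> 'a \<Rightarrow> 'a" where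
  "plane_rotation p x = (x \<bullet> fst p) *\<^sub>R snd p - (x \<bullet> snd p) *\<^sub>R fst p"

lemma rotation_generator_plane:
  assumes "p \<in> Basis \<times> Basis"
  shows "rotation_generator (plane_rotation p)"
proof -
  obtain b c where p: "p = (b, c)" "b \<in> Basis" "c \<in> Basis" using assms by auto
  have "linear (plane_rotation p)"
    by (rule linearI) (simp_all add: plane_rotation_def inner_add_left algebra_simps)
  moreover have "x \<bullet> plane_rotation p x = 0" for x
    by (simp add: plane_rotation_def inner_diff_right)
  moreover have "plane_rotation p (plane_rotation p (plane_rotation p x)) = - plane_rotation p x" for x
    using p(2,3) by (cases "b = c") (auto simp: p(1) plane_rotation_def inner_diff_left inner_Basis algebra_simps)
  ultimately show ?thesis by (simp add: rotation_generator_def)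
qed

lemma deriv2_self_expand: "deriv2 f x x x = (\<Sum>b\<in>Basis. \<Sum>c\<in>Basis. of_real ((x \<bullet> b) * (x \<bullet> c)) * deriv2 f x b c)"
proof -
  note B = bilinear_deriv2[of f x]
  have "deriv2 f x x x = deriv2 f x (\<Sum>b\<in>Basis. (x \<bullet> b) *\<^sub>R b) (\<Sum>c\<in>Basis. (x \<bullet> c) *\<^sub>R c)"
    by (simp only: euclidean_representation)
  also have "\<dots> = (\<Sum>(b, c)\<in>Basis \<times> Basis. deriv2 f x ((x \<bullet> b) *\<^sub>R b) ((x \<bullet> c) *\<^sub>R c))"
    by (rule bilinear_sum[OF B])
  also have "\<dots> = (\<Sum>b\<in>Basis. \<Sum>c\<in>Basis. of_real ((x \<bullet> b) * (x \<bullet> c)) * deriv2 f x b c)"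
    unfolding sum.cartesian_product[symmetric]
    by (simp add: bilinear_lmul[OF B] bilinear_rmul[OF B] scaleR_conv_of_real[where 'a = complex] mult_ac)
  finally show ?thesis .
qed

text \<open>
  On homogeneous harmonic polynomials restricted to the unit sphere this operator is a scalar that
  decreases strictly with the degree.
\<close>

lemma sum_plane_rotation:
  "(\<Sum>p\<in>Basis \<times> Basis. second_lie f (plane_rotation p) x) =
     2 * of_real (x \<bullet> x) * (\<Sum>b\<in>Basis. deriv2 f x b b) - 2 * deriv2 f x x x
     + of_real (2 - 2 * real DIM(quat ^ 'n)) * deriv1 f x (x :: quat ^ 'n)"
proof -
  note B = bilinear_deriv2[of f x]
  let ?D = "deriv2 f x"
  define tr where "tr = (\<Sum>b\<in>Basis. ?D b b)"
  have xx: "of_real (x \<bullet> x) = (\<Sum>b\<in>Basis. of_real ((x \<bullet> b) * (x \<bullet> b)) :: complex)"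
    by (subst euclidean_inner) simp
  have "(\<Sum>p\<in>Basis \<times> Basis. ?D (plane_rotation p x) (plane_rotation p x)) =
     (\<Sum>b\<in>Basis. \<Sum>c\<in>Basis. ?D (plane_rotation (b, c) x) (plane_rotation (b, c) x))"
    by (simp add: sum.cartesian_product split_def)
  also have "\<dots> = (\<Sum>b\<in>Basis. \<Sum>c\<in>Basis. of_real ((x \<bullet> b) * (x \<bullet> b)) * ?D c c
      - of_real ((x \<bullet> b) * (x \<bullet> c)) * ?D b c - of_real ((x \<bullet> c) * (x \<bullet> b)) * ?D c b + of_real ((x \<bullet> c) * (x \<bullet> c)) * ?D b b)"
    by (intro sum.cong refl)
      (simp add: plane_rotation_def bilinear_lsub[OF B] bilinear_rsub[OF B] bilinear_lmul[OF B] bilinear_rmul[OF B]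
        scaleR_conv_of_real[where 'a = complex] algebra_simps)
  also have "\<dots> = (\<Sum>b\<in>Basis. \<Sum>c\<in>Basis. of_real ((x \<bullet> b) * (x \<bullet> b)) * ?D c c)
      - (\<Sum>b\<in>Basis. \<Sum>c\<in>Basis. of_real ((x \<bullet> b) * (x \<bullet> c)) * ?D b c)
      - (\<Sum>b\<in>Basis. \<Sum>c\<in>Basis. of_real ((x \<bullet> c) * (x \<bullet> b)) * ?D c b)
      + (\<Sum>b\<in>Basis. \<Sum>c\<in>Basis. of_real ((x \<bullet> c) * (x \<bullet> c)) * ?D b b)"
    by (simp only: sum.distrib sum_subtractf)
  also have "(\<Sum>b\<in>Basis. \<Sum>c\<in>Basis. of_real ((x \<bullet> b) * (x \<bullet> b)) * ?D c c) = of_real (x \<bullet> x) * tr"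
    unfolding xx tr_def sum_product ..
  also have "(\<Sum>b\<in>Basis. \<Sum>c\<in>Basis. of_real ((x \<bullet> c) * (x \<bullet> c)) * ?D b b) = of_real (x \<bullet> x) * tr"
    unfolding xx tr_def sum_product by (rule sum.swap)
  also have "(\<Sum>b\<in>Basis. \<Sum>c\<in>Basis. of_real ((x \<bullet> c) * (x \<bullet> b)) * ?D c b) = ?D x x"
    unfolding deriv2_self_expand by (rule sum.swap)
  also have "(\<Sum>b\<in>Basis. \<Sum>c\<in>Basis. of_real ((x \<bullet> b) * (x \<bullet> c)) * ?D b c) = ?D x x"
    unfolding deriv2_self_expand ..
  finally have 1: "(\<Sum>p\<in>Basis \<times> Basis. ?D (plane_rotation p x) (plane_rotation p x)) = 2 * of_real (x \<bullet> x) * tr - 2 * ?D x x"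
    by simp
  have "(\<Sum>p\<in>Basis \<times> Basis. plane_rotation p (plane_rotation p x)) =
    (\<Sum>b\<in>Basis. \<Sum>c\<in>Basis. plane_rotation (b, c) (plane_rotation (b, c) x))"
    by (simp add: sum.cartesian_product split_def)
  also have "\<dots> = (\<Sum>b\<in>Basis. \<Sum>c\<in>Basis. (if b = c then (x \<bullet> b) *\<^sub>R b else 0) - (x \<bullet> c) *\<^sub>R c - (x \<bullet> b) *\<^sub>R b
      + (if b = c then (x \<bullet> b) *\<^sub>R b else 0))"
    by (intro sum.cong refl) (auto simp: plane_rotation_def inner_diff_left inner_Basis algebra_simps)
  also have "\<dots> = (\<Sum>b\<in>Basis. (x \<bullet> b) *\<^sub>R b) - (\<Sum>b\<in>(Basis :: (quat ^ 'n) set). \<Sum>c\<in>Basis. (x \<bullet> c) *\<^sub>R c)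
      - (\<Sum>b\<in>Basis. \<Sum>c\<in>(Basis :: (quat ^ 'n) set). (x \<bullet> b) *\<^sub>R b) + (\<Sum>b\<in>Basis. (x \<bullet> b) *\<^sub>R b)"
    by (simp only: sum.distrib sum_subtractf) simp
  also have "\<dots> = x - real DIM(quat ^ 'n) *\<^sub>R x - real DIM(quat ^ 'n) *\<^sub>R x + x"
    by (simp only: euclidean_representation sum_constant_scaleR scaleR_sum_right[symmetric])
  also have "\<dots> = (2 - 2 * real DIM(quat ^ 'n)) *\<^sub>R x"
    by (simp only: scaleR_left_diff_distrib mult_2 scaleR_left_distrib scaleR_one scaleR_2) simp
  finally have 2: "(\<Sum>p\<in>Basis \<times> Basis. plane_rotation p (plane_rotation p x)) = (2 - 2 * real DIM(quat ^ 'n)) *\<^sub>R x" .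
  have "(\<Sum>p\<in>Basis \<times> Basis. deriv1 f x (plane_rotation p (plane_rotation p x))) =
      deriv1 f x (\<Sum>p\<in>Basis \<times> Basis. plane_rotation p (plane_rotation p x))"
    by (rule linear_sum[OF linear_deriv1, symmetric])
  also have "\<dots> = of_real (2 - 2 * real DIM(quat ^ 'n)) * deriv1 f x x"
    unfolding 2 linear_cmul[OF linear_deriv1] by (rule scaleR_conv_of_real)
  finally show ?thesis using 1 by (simp only: second_lie_def sum.distrib tr_def)
qed

lemma rotation_generator_unit:
  assumes "u \<in> {quat_i, quat_j, quat_k}"
  shows "rotation_generator (\<lambda>x :: quat ^ 'n. u *s x)"
proof -
  have u: "u * u = - 1" using assms quat_units by auto
  have "q \<bullet> (u * q) = 0" for q
    using assms by (auto simp: quat_i_def quat_j_def quat_k_def inner_quat_def times_quat_def)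
  then have "x \<bullet> (u *s x) = 0" for x :: "quat ^ 'n"
    by (simp add: inner_vec_def)
  moreover have "u *s (u *s (u *s x)) = - (u *s x)" for x :: "quat ^ 'n"
    by (simp add: vec_eq_iff mult.assoc[symmetric] u)
  ultimately show ?thesis by (simp add: rotation_generator_def linear_scalar_right)
qed

lemma sum_unit_rotation:
  fixes x :: "quat ^ 'n"
  shows "(\<Sum>u\<in>{quat_i, quat_j, quat_k}. second_lie f (\<lambda>x. u *s x) x) =
    (\<Sum>u\<in>Basis. deriv2 f x (u *s x) (u *s x)) - deriv2 f x x x - 3 * deriv1 f x x"
proof -
  have ne: "quat_i \<noteq> quat_j" "quat_i \<noteq> quat_k" "quat_j \<noteq> quat_k"
    by (simp_all add: quat_i_def quat_j_def quat_k_def)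
  have m: "u *s (u *s x) = - x" if "u * u = - 1" for u
    using that by (simp add: vec_eq_iff mult.assoc[symmetric])
  have one: "(1 :: quat) *s x = x" "(- 1 :: quat) *s x = - x" by (simp_all add: vec_eq_iff)
  show ?thesis
    unfolding sum_Basis_quat using ne
    by (simp add: second_lie_def m quat_units linear_neg[OF linear_deriv1] one)
qed

lemma DIM_quat: "DIM(quat) = 4"
  by (simp add: Basis_quat_def one_quat_def quat_i_def quat_j_def quat_k_def)

lemma DIM_quat_vec: "DIM(quat ^ 'n) = 4 * CARD('n)"
  by (simp add: DIM_quat)

text \<open>
  The reflection that exchanges the two points.
\<close>

lemma sphere_transitive:
  fixes x y :: "quat ^ 'n"
  assumes "x \<in> qsphere" "y \<in> qsphere"
  obtains A where "orthogonal_transformation A" "A x = y"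
proof (cases "x = y")
  case True
  then show thesis using that[of "\<lambda>x. x"] by simp
next
  case False
  define v where "v = x - y"
  (* The reflection in the hyperplane orthogonal to v. *)
  define A where "A z = z - (2 * (z \<bullet> v) / (v \<bullet> v)) *\<^sub>R v" for z
  have v: "v \<bullet> v \<noteq> 0" using False by (simp add: v_def)
  have "linear A" unfolding A_def
    by (rule linearI) (simp_all add: inner_add_left add_divide_distrib algebra_simps)
  moreover have "norm (A z) = norm z" for z
  proof -
    define r where "r = 2 * (z \<bullet> v) / (v \<bullet> v)"
    have "r * (v \<bullet> v) = 2 * (z \<bullet> v)" using v by (simp add: r_def)
    then have "A z \<bullet> A z = z \<bullet> z"
      unfolding A_def r_def[symmetric]
      by (simp add: inner_diff_left inner_diff_right inner_commute[of v z] algebra_simps)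
    then show ?thesis by (simp add: norm_eq)
  qed
  moreover have "A x = y"
  proof -
    have "2 * (x \<bullet> v) = v \<bullet> v"
      using assms by (simp add: v_def inner_diff_left inner_diff_right inner_commute[of y x] qsphere_eq_sphere norm_eq_1)
    then have "A x = x - v" using v by (simp add: A_def)
    then show ?thesis by (simp add: v_def)
  qed
  ultimately show thesis using that[of A] by (auto simp: orthogonal_transformation)
qed

context invariant_measure
begin

text \<open>
  Different degrees are separated by the sum over coordinate planes, and equal degrees with
  different \<open>m\<close> by the sum over the quaternionic units.
\<close>

lemma isotypic_orthogonal:
  fixes f g :: "'n qpoly"
  assumes f: "f \<in> isotypic h m" and g: "g \<in> isotypic h' m'"
    and ne: "(h, m) \<noteq> (h', m')" and le: "2 * m \<le> h" "2 * m' \<le> h'"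
  shows "(LINT x|\<sigma>. peval f x * cnj (peval g x)) = 0"
proof -
  have fs: "fin_supp f" "fin_supp g" using f g isotypic_homogeneous fin_supp_homogeneous by metis+
  have sph: "x \<bullet> x = 1" if "x \<in> qsphere" for x :: "quat ^ 'n"
    using that by (simp add: qsphere_eq_sphere norm_eq_1)
  show ?thesis
  proof (cases "h = h'")
    case False
    (* The eigenvalue of the sum over coordinate planes, in degree h. *)
    define a where "a h = - 2 * (real h * (real h - 1)) + (2 - 2 * real (4 * CARD('n))) * real h" for h
    have eig: "(\<Sum>p\<in>Basis \<times> Basis. second_lie f (plane_rotation p) x) = of_real (a h) * peval f x"
      if f: "f \<in> isotypic h m" and x: "x \<in> qsphere" for f :: "'n qpoly" and h m x
    proof -
      note hom = isotypic_homogeneous[OF f]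
      note ff = fin_supp_homogeneous[OF hom]
      have "(\<Sum>b\<in>Basis. deriv2 f x b b) = 0" using f unfolding isotypic_iff[OF ff] by blast
      then show ?thesis
        unfolding sum_plane_rotation deriv2_homogeneous[OF ff hom] deriv1_homogeneous[OF ff hom] DIM_quat_vec a_def
        by (simp add: algebra_simps)
    qed
    have "a h \<noteq> a h'"
    proof
      assume "a h = a h'"
      then have "(real h - real h') * (real h + real h' + 4 * real CARD('n) - 2) = 0"
        unfolding a_def by (simp add: algebra_simps)
      moreover have "CARD('n) \<ge> 1" using zero_less_card_finite[where 'a = 'n] by linarith
      ultimately show False using False by auto
    qed
    then show ?thesis
      by (intro eigenfunctions_orthogonal[where K = "Basis \<times> Basis" and A = plane_rotation, OF fs])
        (auto intro: rotation_generator_plane eig[OF f] eig[OF g])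
  next
    case True
    (* The eigenvalue of the sum over the quaternionic units; it separates m and m' unless m + m' = h + 1. *)
    define a where "a m = 4 * real m * (real h - real m + 1) - real h * (real h - 1) - 3 * real h" for m
    have eig: "(\<Sum>u\<in>{quat_i, quat_j, quat_k}. second_lie f (\<lambda>x. u *s x) x) = of_real (a m) * peval f x"
      if f: "f \<in> isotypic h m" and x: "x \<in> qsphere" for f :: "'n qpoly" and m x
    proof -
      note hom = isotypic_homogeneous[OF f]
      note ff = fin_supp_homogeneous[OF hom]
      have "(\<Sum>u\<in>Basis. deriv2 f x (u *s x) (u *s x)) = casimir_value h m * peval f x"
        using f unfolding isotypic_iff[OF ff] by blast
      then show ?thesis
        unfolding sum_unit_rotation deriv2_homogeneous[OF ff hom] deriv1_homogeneous[OF ff hom] a_def casimir_value_def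
        by (simp add: algebra_simps)
    qed
    have "a m \<noteq> a m'"
    proof
      assume "a m = a m'"
      then have "(real m - real m') * (real h + 1 - real m - real m') = 0"
        unfolding a_def by (simp add: algebra_simps)
      then show False using True ne le by auto
    qed
    then show ?thesis
      by (intro eigenfunctions_orthogonal[where K = "{quat_i, quat_j, quat_k}" and A = "\<lambda>u x. u *s x", OF fs])
        (use eig[OF f] eig[OF g[folded True]] rotation_generator_unit in blast)+
  qed
qed

text \<open>
  The measure charges every nonempty open set: otherwise rotated copies of a null open set would cover
  the sphere by compactness.
\<close>

lemma continuous_AE_zero:
  fixes F :: "quat ^ 'n \<Rightarrow> complex"
  assumes F: "continuous_on UNIV F" and ae: "AE x in \<sigma>. F x = 0" and x: "x \<in> qsphere"
  shows "F x = 0"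
proof (rule ccontr)
  assume "F x \<noteq> 0"
  define U where "U = {y. F y \<noteq> 0}"
  have U: "open U" unfolding U_def using open_Collect_neq[OF F continuous_on_const] by simp
  have sets: "V \<inter> qsphere \<in> sets \<sigma>" if "open V" for V
    unfolding sets_sigma sets_restrict_space using that by (auto intro!: image_eqI[of _ _ V])
  have "emeasure \<sigma> (U \<inter> qsphere) = 0"
  proof -
    have "AE y in \<sigma>. y \<notin> U \<inter> qsphere" using ae by eventually_elim (simp add: U_def)
    then show ?thesis using AE_iff_measurable[OF sets[OF U], of "\<lambda>y. y \<notin> U \<inter> qsphere"]
      by (auto simp: space_sigma)
  qed
  have open_vimage: "open (A -` U)" if "orthogonal_transformation A" for A :: "quat ^ 'n \<Rightarrow> quat ^ 'n"
    using U orthogonal_transformation_linear[OF that]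
    by (intro open_vimage linear_continuous_on) (simp_all add: linear_conv_bounded_linear[symmetric])
  have null: "A -` U \<inter> qsphere \<in> null_sets \<sigma>" if A: "orthogonal_transformation A" for A :: "quat ^ 'n \<Rightarrow> quat ^ 'n"
  proof -
    have "A -` (U \<inter> qsphere) \<inter> qsphere = A -` U \<inter> qsphere"
      using orthogonal_transformation_norm[OF A] by (auto simp: qsphere_eq_sphere)
    then have "emeasure \<sigma> (A -` U \<inter> qsphere) = emeasure (distr \<sigma> \<sigma> A) (U \<inter> qsphere)"
      using emeasure_distr[OF measurable_orthogonal[OF A] sets[OF U]] by (simp add: space_sigma)
    also have "\<dots> = 0" using \<open>emeasure \<sigma> (U \<inter> qsphere) = 0\<close> distr_orthogonal[OF A] by simp
    finally show ?thesis using sets[OF open_vimage[OF A]] by blast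
  qed
  define C where "C = {A -` U | A :: quat ^ 'n \<Rightarrow> quat ^ 'n. orthogonal_transformation A}"
  have "\<forall>V\<in>C. open V"
    unfolding C_def using open_vimage by blast
  moreover have "qsphere \<subseteq> \<Union>C"
  proof
    fix y :: "quat ^ 'n" assume "y \<in> qsphere"
    then obtain A where "orthogonal_transformation A" "A y = x" using sphere_transitive x by metis
    then show "y \<in> \<Union>C" using \<open>F x \<noteq> 0\<close> by (auto simp: C_def U_def)
  qed
  moreover have "compact (qsphere :: (quat ^ 'n) set)" by (simp add: qsphere_eq_sphere)
  ultimately obtain D where D: "D \<subseteq> C" "finite D" "qsphere \<subseteq> \<Union>D" by (metis compactE)
  have "(\<Union>V\<in>D. V \<inter> qsphere) \<in> null_sets \<sigma>"
    using D(1,2) null by (intro null_sets_UN') (auto simp: C_def countable_finite)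
  moreover have "(\<Union>V\<in>D. V \<inter> qsphere) = space \<sigma>" using D(3) by (auto simp: space_sigma)
  ultimately have "emeasure \<sigma> (space \<sigma>) = 0" by auto
  then show False using emeasure_space_1 by simp
qed

end

section \<open>Square-integrable functions\<close>

definition on_sphere :: "(quat ^ 'n::finite \<Rightarrow> complex) \<Rightarrow> quat ^ 'n \<Rightarrow> complex" where
  "on_sphere F x = (if x \<in> qsphere then F x else 0)"

lemma cmod_add_sq: "(cmod (a + b))\<^sup>2 \<le> 2 * (cmod a)\<^sup>2 + 2 * (cmod b)\<^sup>2"
proof -
  have "(cmod (a + b))\<^sup>2 \<le> (cmod a + cmod b)\<^sup>2" by (intro power_mono norm_triangle_ineq) auto
  also have "\<dots> \<le> 2 * (cmod a)\<^sup>2 + 2 * (cmod b)\<^sup>2"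
    using zero_le_power2[of "cmod a - cmod b"] by (simp add: power2_eq_square algebra_simps)
  finally show ?thesis .
qed

context invariant_measure
begin

definition sq_norm :: "(quat ^ 'n \<Rightarrow> complex) \<Rightarrow> real" where
  "sq_norm f = (LINT x|\<sigma>. (cmod (f x))\<^sup>2)"

lemma L2_norm_less_iff: "\<epsilon> > 0 \<Longrightarrow> L2_norm \<sigma> f < \<epsilon> \<longleftrightarrow> sq_norm f < \<epsilon>\<^sup>2"
  using real_sqrt_less_iff[of "sq_norm f" "\<epsilon>\<^sup>2"] by (simp add: L2_norm_def sq_norm_def)

lemma L2_D:
  assumes "f \<in> L2 \<sigma>"
  shows "f \<in> borel_measurable \<sigma>" "integrable \<sigma> (\<lambda>x. (cmod (f x))\<^sup>2)" "x \<notin> qsphere \<Longrightarrow> f x = 0"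
  using assms by (auto simp: L2_def)

lemma sq_norm_nonneg: "sq_norm f \<ge> 0"
  by (simp add: sq_norm_def)

lemma L2_add:
  assumes f: "f \<in> L2 \<sigma>" and g: "g \<in> L2 \<sigma>"
  shows "f + g \<in> L2 \<sigma>" "sq_norm (f + g) \<le> 2 * sq_norm f + 2 * sq_norm g"
proof -
  note fD = L2_D[OF f] and gD = L2_D[OF g]
  have m: "(\<lambda>x. f x + g x) \<in> borel_measurable \<sigma>" using fD(1) gD(1) by (rule borel_measurable_add)
  have dom: "integrable \<sigma> (\<lambda>x. 2 * (cmod (f x))\<^sup>2 + 2 * (cmod (g x))\<^sup>2)" using fD(2) gD(2) by simp
  have int: "integrable \<sigma> (\<lambda>x. (cmod (f x + g x))\<^sup>2)"
    by (rule Bochner_Integration.integrable_bound[OF dom]) (use m cmod_add_sq in \<open>auto intro!: AE_I2\<close>)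
  then show "f + g \<in> L2 \<sigma>" using m fD(3) gD(3) by (auto simp: L2_def plus_fun_def)
  have "sq_norm (f + g) \<le> (LINT x|\<sigma>. 2 * (cmod (f x))\<^sup>2 + 2 * (cmod (g x))\<^sup>2)"
    unfolding sq_norm_def by (rule integral_mono) (use int dom cmod_add_sq in auto)
  also have "\<dots> = 2 * sq_norm f + 2 * sq_norm g" using fD(2) gD(2) by (simp add: sq_norm_def)
  finally show "sq_norm (f + g) \<le> 2 * sq_norm f + 2 * sq_norm g" .
qed

lemma sq_norm_scale: "sq_norm (cscale c f) = (cmod c)\<^sup>2 * sq_norm f"
  by (simp add: sq_norm_def cscale_def norm_mult power_mult_distrib)

lemma L2_scale: "f \<in> L2 \<sigma> \<Longrightarrow> cscale c f \<in> L2 \<sigma>"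
  by (auto simp: L2_def cscale_def norm_mult power_mult_distrib)

lemma L2_zero: "0 \<in> L2 \<sigma>"
  by (simp add: L2_def zero_fun_def)

lemma L2_subspace: "cfun.subspace (L2 \<sigma>)"
  unfolding cfun.subspace_def using L2_add(1) L2_scale L2_zero by blast

lemma L2_diff: "f \<in> L2 \<sigma> \<Longrightarrow> g \<in> L2 \<sigma> \<Longrightarrow> f - g \<in> L2 \<sigma>"
  by (rule cfun.subspace_diff[OF L2_subspace])

lemma sq_norm_diff_triangle:
  assumes "f \<in> L2 \<sigma>" "g \<in> L2 \<sigma>" "h \<in> L2 \<sigma>"
  shows "sq_norm (f - h) \<le> 2 * sq_norm (f - g) + 2 * sq_norm (g - h)"
  using L2_add(2)[OF L2_diff[OF assms(1,2)] L2_diff[OF assms(2,3)]] by simp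

lemma L2_bounded:
  assumes "f \<in> borel_measurable \<sigma>" "\<And>x. x \<in> qsphere \<Longrightarrow> cmod (f x) \<le> M" "\<And>x. x \<notin> qsphere \<Longrightarrow> f x = 0"
  shows "f \<in> L2 \<sigma>"
proof -
  have "integrable \<sigma> (\<lambda>x. (cmod (f x))\<^sup>2)"
    by (rule integrable_const_bound[of _ "M\<^sup>2"])
      (use assms in \<open>auto intro!: AE_I2 power_mono simp: space_sigma\<close>)
  then show ?thesis using assms by (simp add: L2_def)
qed

lemma measurable_on_sphere: "F \<in> borel_measurable \<sigma> \<Longrightarrow> on_sphere F \<in> borel_measurable \<sigma>"
  by (subst measurable_cong[of \<sigma> _ F]) (auto simp: space_sigma on_sphere_def)

lemma on_sphere_L2:
  assumes "continuous_on UNIV F" shows "on_sphere F \<in> L2 \<sigma>"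
proof -
  obtain M where "\<And>x. x \<in> qsphere \<Longrightarrow> norm (F x) \<le> M" using continuous_bounded_sphere[OF assms] by metis
  then show ?thesis
    by (intro L2_bounded[of _ M] measurable_on_sphere measurable_continuous assms) (auto simp: on_sphere_def)
qed

lemma sq_norm_tendsto_0:
  assumes "\<And>k. f k \<in> borel_measurable \<sigma>" "\<And>k x. x \<in> qsphere \<Longrightarrow> (cmod (f k x))\<^sup>2 \<le> w x" "integrable \<sigma> w"
    and "\<And>x. x \<in> qsphere \<Longrightarrow> (\<lambda>k. f k x) \<longlonglongrightarrow> 0"
  shows "(\<lambda>k. sq_norm (f k)) \<longlonglongrightarrow> 0"
proof -
  have "(\<lambda>k. LINT x|\<sigma>. (cmod (f k x))\<^sup>2) \<longlonglongrightarrow> (LINT x|\<sigma>. 0)"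
  proof (rule integral_dominated_convergence[where w = w])
    show "AE x in \<sigma>. (\<lambda>k. (cmod (f k x))\<^sup>2) \<longlonglongrightarrow> 0"
    proof (rule AE_I2)
      fix x assume "x \<in> space \<sigma>"
      then have "(\<lambda>k. f k x) \<longlonglongrightarrow> 0" using assms(4) by (simp add: space_sigma)
      from tendsto_power[OF tendsto_norm[OF this], of 2] show "(\<lambda>k. (cmod (f k x))\<^sup>2) \<longlonglongrightarrow> 0" by simp
    qed
  qed (use assms in \<open>auto simp: space_sigma\<close>)
  then show ?thesis by (simp add: sq_norm_def)
qed

lemma L2_inner_integrable:
  assumes f: "f \<in> L2 \<sigma>" and g: "g \<in> L2 \<sigma>"
  shows "integrable \<sigma> (\<lambda>x. f x * cnj (g x))"
proof -
  have dom: "integrable \<sigma> (\<lambda>x. (cmod (f x))\<^sup>2 + (cmod (g x))\<^sup>2)" using L2_D(2)[OF f] L2_D(2)[OF g] by simp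
  have "cmod (a * cnj b) \<le> (cmod a)\<^sup>2 + (cmod b)\<^sup>2" for a b
  proof -
    have "cmod a * cmod b \<le> (cmod a)\<^sup>2 + (cmod b)\<^sup>2"
      using zero_le_power2[of "cmod a - cmod b"] mult_nonneg_nonneg[OF norm_ge_zero[of a] norm_ge_zero[of b]]
      unfolding power2_diff by linarith
    then show ?thesis by (simp add: norm_mult)
  qed
  moreover have "(\<lambda>x. f x * cnj (g x)) \<in> borel_measurable \<sigma>"
    using L2_D(1)[OF f] measurable_compose[OF L2_D(1)[OF g] borel_measurable_continuous_onI[OF continuous_on_cnj[OF continuous_on_id]]]
    by (rule borel_measurable_times)
  ultimately show ?thesis
    by (intro Bochner_Integration.integrable_bound[OF dom]) (auto intro!: AE_I2)
qed

lemma L2_inner_add: "f \<in> L2 \<sigma> \<Longrightarrow> f' \<in> L2 \<sigma> \<Longrightarrow> g \<in> L2 \<sigma> \<Longrightarrow> L2_inner \<sigma> (f + f') g = L2_inner \<sigma> f g + L2_inner \<sigma> f' g"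
  unfolding L2_inner_def
  by (subst Bochner_Integration.integral_add[symmetric]) (simp_all add: L2_inner_integrable algebra_simps)

lemma L2_inner_scale: "L2_inner \<sigma> (cscale c f) g = c * L2_inner \<sigma> f g"
  by (simp add: L2_inner_def cscale_def mult.assoc)

lemma L2_inner_diff: "f \<in> L2 \<sigma> \<Longrightarrow> f' \<in> L2 \<sigma> \<Longrightarrow> g \<in> L2 \<sigma> \<Longrightarrow> L2_inner \<sigma> (f - f') g = L2_inner \<sigma> f g - L2_inner \<sigma> f' g"
  unfolding L2_inner_def
  by (subst Bochner_Integration.integral_diff[symmetric]) (simp_all add: L2_inner_integrable algebra_simps)

lemma L2_inner_cnj: "L2_inner \<sigma> g f = cnj (L2_inner \<sigma> f g)"
  unfolding L2_inner_def Bochner_Integration.integral_cnj[symmetric] by (simp add: mult.commute)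

lemma L2_inner_self: "L2_inner \<sigma> f f = of_real (sq_norm f)"
  unfolding L2_inner_def sq_norm_def integral_complex_of_real[symmetric]
  by (simp add: complex_norm_square[symmetric])

lemma sq_norm_eq_0_AE:
  assumes "f \<in> L2 \<sigma>" "sq_norm f = 0" shows "AE x in \<sigma>. f x = 0"
  using assms integral_nonneg_eq_0_iff_AE[OF L2_D(2)[OF assms(1)]] by (simp add: sq_norm_def)

lemma L2_inner_null:
  assumes "f \<in> L2 \<sigma>" "sq_norm f = 0" "g \<in> L2 \<sigma>" shows "L2_inner \<sigma> f g = 0"
proof -
  have "AE x in \<sigma>. f x * cnj (g x) = 0" using sq_norm_eq_0_AE[OF assms(1,2)] by eventually_elim simp
  then show ?thesis unfolding L2_inner_def by (rule integral_eq_zero_AE)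
qed

text \<open>
  Gram--Schmidt. On functions the inner product is only semidefinite; a residual vector \<open>d\<close> of norm zero
  is orthogonal to everything and can be skipped.
\<close>

lemma orthogonal_projection:
  assumes "finite B" "B \<subseteq> L2 \<sigma>" "f \<in> L2 \<sigma>"
  shows "\<exists>g\<in>cfun.span B. \<forall>b\<in>cfun.span B. L2_inner \<sigma> (f - g) b = 0"
  using assms
proof (induction B arbitrary: f rule: finite_induct)
  case empty
  then show ?case by (auto simp: L2_inner_def)
next
  case (insert b B)
  have span: "s \<in> L2 \<sigma>" if "s \<in> cfun.span B" for s
    using cfun.span_minimal[OF _ L2_subspace] insert.prems that by blast
  obtain g0 where g0: "g0 \<in> cfun.span B" "\<And>s. s \<in> cfun.span B \<Longrightarrow> L2_inner \<sigma> (f - g0) s = 0"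
    using insert by blast
  obtain b0 where b0: "b0 \<in> cfun.span B" "\<And>s. s \<in> cfun.span B \<Longrightarrow> L2_inner \<sigma> (b - b0) s = 0"
    using insert by blast
  define d where "d = b - b0"
  have bL: "b \<in> L2 \<sigma>" "f \<in> L2 \<sigma>" "g0 \<in> L2 \<sigma>" "d \<in> L2 \<sigma>"
    using insert.prems span g0(1) b0(1) by (auto simp: d_def intro: L2_diff)
  have sub: "cfun.span B \<subseteq> cfun.span (insert b B)" by (rule cfun.span_mono) auto
  have dspan: "d \<in> cfun.span (insert b B)"
    unfolding d_def by (rule cfun.span_diff[OF cfun.span_base[OF insertI1] subsetD[OF sub b0(1)]])
  (* The Fourier coefficient of f along the residual d. *)
  define k where "k = (if sq_norm d = 0 then 0 else L2_inner \<sigma> f d / of_real (sq_norm d))"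
  define g where "g = g0 + cscale k d"
  have gL: "g \<in> L2 \<sigma>" unfolding g_def by (intro L2_add L2_scale bL)
  have d0: "L2_inner \<sigma> s d = 0" if "s \<in> cfun.span B" for s
    using b0(2)[OF that] L2_inner_cnj[of d s] by (simp add: d_def[symmetric] complex_eq_iff)
  have fg: "L2_inner \<sigma> (f - g) s = L2_inner \<sigma> (f - g0) s - k * L2_inner \<sigma> d s" if "s \<in> L2 \<sigma>" for s
  proof -
    have "f - g = (f - g0) - cscale k d" by (simp add: g_def)
    then show ?thesis using that by (simp only: L2_inner_diff L2_inner_scale L2_diff L2_scale bL)
  qed
  have orth_d: "L2_inner \<sigma> (f - g) d = 0"
  proof (cases "sq_norm d = 0")
    case True
    have "L2_inner \<sigma> d (f - g) = 0" by (intro L2_inner_null True bL L2_diff gL)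
    then show ?thesis using L2_inner_cnj[of d "f - g"] by (simp add: complex_eq_iff)
  next
    case False
    have "L2_inner \<sigma> (f - g0) d = L2_inner \<sigma> f d" using bL d0[OF g0(1)] by (simp add: L2_inner_diff)
    then show ?thesis unfolding fg[OF bL(4)] using False by (simp add: k_def L2_inner_self)
  qed
  have orth_s: "L2_inner \<sigma> (f - g) s = 0" if "s \<in> cfun.span B" for s
    using fg[OF span[OF that]] g0(2)[OF that] b0(2)[OF that] by (simp add: d_def)
  have "L2_inner \<sigma> (f - g) s = 0" if sS: "s \<in> cfun.span (insert b B)" for s
  proof -
    obtain c where c: "s - cscale c b \<in> cfun.span B" using sS cfun.span_breakdown_eq[of s b B] by blast
    define t where "t = (s - cscale c b) + cscale c b0"
    have t: "t \<in> cfun.span B" unfolding t_def using c b0(1) by (intro cfun.span_add cfun.span_scale)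
    have s: "s = t + cscale c d" by (simp add: t_def d_def cfun.scale_right_diff_distrib)
    have "L2_inner \<sigma> s (f - g) = L2_inner \<sigma> t (f - g) + c * L2_inner \<sigma> d (f - g)"
      unfolding s using span[OF t] bL gL by (simp only: L2_inner_add L2_inner_scale L2_diff L2_scale)
    also have "\<dots> = 0"
      using orth_s[OF t] orth_d L2_inner_cnj[of t "f - g"] L2_inner_cnj[of d "f - g"] by (simp add: complex_eq_iff)
    finally show ?thesis using L2_inner_cnj[of "f - g" s] by simp
  qed
  moreover have "g \<in> cfun.span (insert b B)"
    unfolding g_def by (rule cfun.span_add[OF subsetD[OF sub g0(1)] cfun.span_scale[OF dspan]])
  ultimately show ?case by blast
qed

lemma finite_dim_closed:
  assumes V: "fin_dim V" "V \<subseteq> L2 \<sigma>" and f: "f \<in> L2 \<sigma>"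
    and approx: "\<And>\<epsilon>. \<epsilon> > 0 \<Longrightarrow> \<exists>g\<in>V. L2_norm \<sigma> (f - g) < \<epsilon>"
  shows "\<exists>g\<in>V. AE x in \<sigma>. f x = g x"
proof -
  obtain B where B: "finite B" "B \<subseteq> V" "cfun.span B = V" using fin_dim_basis[OF V(1)] by metis
  obtain g where g: "g \<in> V" "\<And>b. b \<in> V \<Longrightarrow> L2_inner \<sigma> (f - g) b = 0"
    using orthogonal_projection[OF B(1) _ f] B V(2) by blast
  have fg: "f - g \<in> L2 \<sigma>" using f g(1) V(2) by (intro L2_diff) auto
  have best: "sq_norm (f - g) \<le> sq_norm (f - g')" if g': "g' \<in> V" for g'
  proof -
    have e: "g - g' \<in> V" "g - g' \<in> L2 \<sigma>"
      using g(1) g' V(2) cfun.subspace_diff[OF fin_dim_subspace[OF V(1)]] by auto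
    have s: "f - g' = (f - g) + (g - g')" by simp
    have fg': "f - g' \<in> L2 \<sigma>" using f g' V(2) by (intro L2_diff) auto
    have add: "L2_inner \<sigma> (f - g') h = L2_inner \<sigma> (f - g) h + L2_inner \<sigma> (g - g') h" if "h \<in> L2 \<sigma>" for h
      using L2_inner_add[OF fg e(2) that] by (simp only: s[symmetric])
    note add[OF fg']
    moreover
    have "L2_inner \<sigma> (f - g') (f - g) = of_real (sq_norm (f - g))"
      using add[OF fg] g(2)[OF e(1)] L2_inner_cnj[of "f - g" "g - g'"] by (simp add: L2_inner_self)
    then have "L2_inner \<sigma> (f - g) (f - g') = of_real (sq_norm (f - g))"
      by (subst L2_inner_cnj) simp
    moreover
    have "L2_inner \<sigma> (f - g') (g - g') = of_real (sq_norm (g - g'))"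
      using add[OF e(2)] g(2)[OF e(1)] by (simp add: L2_inner_self)
    then have "L2_inner \<sigma> (g - g') (f - g') = of_real (sq_norm (g - g'))"
      by (subst L2_inner_cnj) simp
    ultimately have "sq_norm (f - g') = sq_norm (f - g) + sq_norm (g - g')"
      unfolding L2_inner_self by (metis of_real_add of_real_eq_iff)
    then show ?thesis using sq_norm_nonneg[of "g - g'"] by simp
  qed
  have "sq_norm (f - g) = 0"
  proof (rule ccontr)
    assume "sq_norm (f - g) \<noteq> 0"
    then have "sqrt (sq_norm (f - g)) > 0" using sq_norm_nonneg[of "f - g"] by simp
    from approx[OF this] obtain g' where "g' \<in> V" "sq_norm (f - g') < sq_norm (f - g)"
      using L2_norm_less_iff[OF \<open>sqrt (sq_norm (f - g)) > 0\<close>] sq_norm_nonneg[of "f - g"] by auto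
    then show False using best by force
  qed
  from sq_norm_eq_0_AE[OF fg this] have "AE x in \<sigma>. f x = g x" by eventually_elim simp
  then show ?thesis using g(1) by blast
qed

subsection \<open>Density of polynomials\<close>

definition approximable :: "(quat ^ 'n \<Rightarrow> complex) set \<Rightarrow> (quat ^ 'n \<Rightarrow> complex) \<Rightarrow> bool" where
  "approximable S f \<longleftrightarrow> f \<in> L2 \<sigma> \<and> (\<forall>\<epsilon>>0. \<exists>g\<in>S. sq_norm (f - g) < \<epsilon>)"

lemma approximable_limit:
  assumes S: "S \<subseteq> L2 \<sigma>" and f: "f \<in> L2 \<sigma>" and F: "\<And>k. approximable S (F k)"
    and lim: "(\<lambda>k. sq_norm (f - F k)) \<longlonglongrightarrow> 0"
  shows "approximable S f"
  unfolding approximable_def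
proof (intro conjI allI impI f)
  fix \<epsilon> :: real assume "\<epsilon> > 0"
  then have "\<epsilon> / 4 > 0" by simp
  from order_tendstoD(2)[OF lim this] obtain k where k: "sq_norm (f - F k) < \<epsilon> / 4"
    by (meson eventually_sequentially order_refl)
  obtain g where g: "g \<in> S" "sq_norm (F k - g) < \<epsilon> / 4" using F[of k] \<open>\<epsilon> / 4 > 0\<close> unfolding approximable_def by blast
  have "sq_norm (f - g) \<le> 2 * sq_norm (f - F k) + 2 * sq_norm (F k - g)"
    using f F[of k] g(1) S by (intro sq_norm_diff_triangle) (auto simp: approximable_def)
  then have "sq_norm (f - g) < \<epsilon>" using k g(2) by linarith
  then show "\<exists>g\<in>S. sq_norm (f - g) < \<epsilon>" using g(1) by blast
qed

lemma approximable_add: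
  assumes S: "cfun.subspace S" "S \<subseteq> L2 \<sigma>" and f: "approximable S f" and g: "approximable S g"
  shows "approximable S (f + g)"
  unfolding approximable_def
proof (intro conjI allI impI)
  show "f + g \<in> L2 \<sigma>" using f g by (simp add: approximable_def L2_add)
  fix \<epsilon> :: real assume "\<epsilon> > 0"
  then have e: "\<epsilon> / 4 > 0" by simp
  obtain f' where f': "f' \<in> S" "sq_norm (f - f') < \<epsilon> / 4" using f e unfolding approximable_def by blast
  obtain g' where g': "g' \<in> S" "sq_norm (g - g') < \<epsilon> / 4" using g e unfolding approximable_def by blast
  have "sq_norm ((f - f') + (g - g')) \<le> 2 * sq_norm (f - f') + 2 * sq_norm (g - g')"
    using f g f'(1) g'(1) S(2) by (intro L2_add(2) L2_diff) (auto simp: approximable_def)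
  moreover have "(f - f') + (g - g') = (f + g) - (f' + g')" by simp
  ultimately have "sq_norm ((f + g) - (f' + g')) < \<epsilon>" using f'(2) g'(2) by simp
  then show "\<exists>h\<in>S. sq_norm ((f + g) - h) < \<epsilon>" using cfun.subspace_add[OF S(1) f'(1) g'(1)] by blast
qed

lemma approximable_scale:
  assumes S: "cfun.subspace S" and f: "approximable S f"
  shows "approximable S (cscale c f)"
  unfolding approximable_def
proof (intro conjI allI impI)
  show "cscale c f \<in> L2 \<sigma>" using f by (simp add: approximable_def L2_scale)
  fix \<epsilon> :: real assume e: "\<epsilon> > 0"
  define d where "d = (cmod c)\<^sup>2 + 1"
  have d: "d > 0" by (simp add: d_def add_nonneg_pos)
  then have "\<epsilon> / d > 0" using e by simp
  then obtain g where g: "g \<in> S" "sq_norm (f - g) < \<epsilon> / d" using f unfolding approximable_def by blast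
  have "sq_norm (cscale c f - cscale c g) = (cmod c)\<^sup>2 * sq_norm (f - g)"
    unfolding cfun.scale_right_diff_distrib[symmetric] by (rule sq_norm_scale)
  also have "\<dots> \<le> d * sq_norm (f - g)" by (intro mult_right_mono sq_norm_nonneg) (simp add: d_def)
  also have "\<dots> < \<epsilon>" using g(2) d by (simp add: field_simps)
  finally show "\<exists>h\<in>S. sq_norm (cscale c f - h) < \<epsilon>" using cfun.subspace_scale[OF S g(1)] by blast
qed

lemma approximable_zero: "cfun.subspace S \<Longrightarrow> approximable S 0"
  unfolding approximable_def using L2_zero cfun.subspace_0[of S]
  by (auto intro!: bexI[of _ 0] simp: sq_norm_def)

lemma approximable_sum:
  assumes S: "cfun.subspace S" "S \<subseteq> L2 \<sigma>" and f: "\<And>a. a \<in> A \<Longrightarrow> approximable S (f a)"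
  shows "approximable S (sum f A)"
  using f
proof (induction A rule: infinite_finite_induct)
  case (insert a A)
  then show ?case unfolding sum.insert[OF insert(1,2)] by (intro approximable_add[OF S]) auto
qed (simp_all only: sum.infinite sum.empty approximable_zero[OF S(1)] not_False_eq_True)

lemma approximable_continuous:
  fixes F :: "quat ^ 'n \<Rightarrow> real"
  assumes S: "\<And>P. P \<in> polyfun \<Longrightarrow> on_sphere P \<in> S" and F: "continuous_on UNIV F"
  shows "approximable S (on_sphere (\<lambda>x. of_real (F x)))"
  unfolding approximable_def
proof (intro conjI allI impI)
  have cF: "continuous_on UNIV (\<lambda>x. of_real (F x) :: complex)" by (intro continuous_intros F)
  show L: "on_sphere (\<lambda>x. of_real (F x)) \<in> L2 \<sigma>" by (rule on_sphere_L2[OF cF])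
  fix \<epsilon> :: real assume e: "\<epsilon> > 0"
  obtain g where g: "real_polynomial_function g" "\<And>x. x \<in> qsphere \<Longrightarrow> \<bar>F x - g x\<bar> < sqrt (\<epsilon> / 2)"
  proof (rule Stone_Weierstrass_real_polynomial_function[of "qsphere :: (quat ^ 'n) set" F "sqrt (\<epsilon> / 2)"])
    show "compact (qsphere :: (quat ^ 'n) set)" by (simp add: qsphere_eq_sphere)
    show "continuous_on qsphere F" using F by (rule continuous_on_subset) simp
  qed (use e in auto)
  have gP: "(\<lambda>x. of_real (g x)) \<in> polyfun" by (rule polyfun_real_polynomial_function[OF g(1)])
  have cg: "continuous_on UNIV (\<lambda>x. of_real (g x) :: complex)"
  proof -
    obtain p where "(\<lambda>x. of_real (g x)) = peval p" "fin_supp p" using gP by (auto simp: polyfun_def)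
    then show ?thesis by (simp only: continuous_on_peval)
  qed
  let ?d = "on_sphere (\<lambda>x. of_real (F x)) - on_sphere (\<lambda>x. of_real (g x))"
  have bound: "(cmod (?d x))\<^sup>2 \<le> \<epsilon> / 2" if "x \<in> qsphere" for x
  proof -
    have "(cmod (?d x))\<^sup>2 = \<bar>F x - g x\<bar>\<^sup>2" using that by (simp add: on_sphere_def of_real_diff[symmetric] del: of_real_diff)
    also have "\<dots> \<le> (sqrt (\<epsilon> / 2))\<^sup>2" using g(2)[OF that] by (intro power_mono) auto
    finally show ?thesis using e by simp
  qed
  have "sq_norm ?d \<le> (LINT x|\<sigma>. \<epsilon> / 2)"
    unfolding sq_norm_def
    by (rule integral_mono) (use bound L2_D(2)[OF L2_diff[OF L on_sphere_L2[OF cg]]] in \<open>auto simp: space_sigma\<close>)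
  also have "\<dots> < \<epsilon>" using e by (simp add: prob_space)
  finally show "\<exists>h\<in>S. sq_norm (on_sphere (\<lambda>x. of_real (F x)) - h) < \<epsilon>" using S[OF gP] by blast
qed

lemma indicator_L2: "A \<in> sets borel \<Longrightarrow> on_sphere (indicator A) \<in> L2 \<sigma>"
  by (intro L2_bounded[of _ 1] measurable_on_sphere measurable_sigma borel_measurable_indicator)
    (auto simp: on_sphere_def indicator_def)

text \<open>
  The indicator is the limit of the continuous functions \<open>max 0 (1 - k d(x, C))\<close>.
\<close>

lemma approximable_indicator_closed:
  assumes S: "\<And>P. P \<in> polyfun \<Longrightarrow> on_sphere P \<in> S" "cfun.subspace S" "S \<subseteq> L2 \<sigma>" and C: "closed C"
  shows "approximable S (on_sphere (indicator C))"
proof (cases "C = {}")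
  case True
  then have "on_sphere (indicator C) = 0" by (auto simp: on_sphere_def)
  then show ?thesis using approximable_zero[OF S(2)] by simp
next
  case False
  define F where "F k x = max 0 (1 - real k * infdist x C)" for k and x :: "quat ^ 'n"
  let ?F = "\<lambda>k. on_sphere (\<lambda>x. of_real (F k x))"
  have cF: "continuous_on UNIV (F k)" for k unfolding F_def by (intro continuous_intros)
  have L: "?F k \<in> L2 \<sigma>" for k by (intro on_sphere_L2 continuous_intros cF)
  have IL: "on_sphere (indicator C) \<in> L2 \<sigma>" using C by (intro indicator_L2) auto
  show ?thesis
  proof (rule approximable_limit[OF S(3) IL])
    show "approximable S (?F k)" for k by (rule approximable_continuous[OF S(1) cF])
    show "(\<lambda>k. sq_norm (on_sphere (indicator C) - ?F k)) \<longlonglongrightarrow> 0"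
    proof (rule sq_norm_tendsto_0[where w = "\<lambda>_. 1"])
      show "on_sphere (indicator C) - ?F k \<in> borel_measurable \<sigma>" for k
        by (rule L2_D(1)[OF L2_diff[OF IL L]])
      show "(cmod ((on_sphere (indicator C) - ?F k) x))\<^sup>2 \<le> 1" if "x \<in> qsphere" for k x
      proof -
        have "0 \<le> F k x" "F k x \<le> 1" by (auto simp: F_def infdist_nonneg)
        moreover have "(on_sphere (indicator C) - ?F k) x = of_real (indicator C x - F k x)"
          using that by (simp add: on_sphere_def indicator_def)
        ultimately have "cmod ((on_sphere (indicator C) - ?F k) x) \<le> 1"
          by (simp only: norm_of_real) (auto simp: indicator_def)
        then show ?thesis by (simp add: power_le_one)
      qed
      show "(\<lambda>k. (on_sphere (indicator C) - ?F k) x) \<longlonglongrightarrow> 0" if x: "x \<in> qsphere" for x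
      proof (cases "x \<in> C")
        case True
        then have "(on_sphere (indicator C) - ?F k) x = 0" for k using x by (simp add: on_sphere_def F_def)
        then show ?thesis by simp
      next
        case False
        have pos: "infdist x C > 0"
          using False C \<open>C \<noteq> {}\<close> by (metis in_closed_iff_infdist_zero infdist_nonneg order_le_less)
        have "\<forall>\<^sub>F k in sequentially. (on_sphere (indicator C) - ?F k) x = 0"
        proof -
          obtain N :: nat where N: "1 < real N * infdist x C" using reals_Archimedean3[OF pos] by blast
          have "F k x = 0" if "k \<ge> N" for k
          proof -
            have "real N * infdist x C \<le> real k * infdist x C" using that pos by (intro mult_right_mono) auto
            then show ?thesis using N by (simp add: F_def)
          qed
          then show ?thesis using False unfolding eventually_sequentially by (auto simp: on_sphere_def)
        qed
        then show ?thesis by (rule tendsto_eventually)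
      qed
    qed simp
  qed
qed

text \<open>
  The sets with approximable indicator form a Dynkin system that contains the intersection-stable
  family of closed sets.
\<close>

lemma approximable_indicator:
  assumes S: "\<And>P. P \<in> polyfun \<Longrightarrow> on_sphere P \<in> S" "cfun.subspace S" "S \<subseteq> L2 \<sigma>" and A: "A \<in> sets borel"
  shows "approximable S (on_sphere (indicator A))"
proof -
  have A': "A \<in> sigma_sets UNIV (Collect closed)"
    using A unfolding borel_eq_closed by (simp add: sets_measure_of)
  have borel: "sigma_sets UNIV (Collect closed) = sets (borel :: (quat ^ 'n) measure)"
    unfolding borel_eq_closed by (simp add: sets_measure_of)
  have st: "Int_stable (Collect closed :: (quat ^ 'n) set set)" by (auto simp: Int_stable_def)
  have sub: "Collect closed \<subseteq> Pow (UNIV :: (quat ^ 'n) set)" by simp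
  show ?thesis
  proof (rule sigma_sets_induct_disjoint[OF st sub A', where P = "\<lambda>A. approximable S (on_sphere (indicator A))"])
    show "approximable S (on_sphere (indicator C))" if "C \<in> Collect closed" for C
      using approximable_indicator_closed[OF S] that by simp
    show "approximable S (on_sphere (indicator {}))"
      using approximable_indicator_closed[OF S closed_empty] .
    fix A assume A: "A \<in> sigma_sets UNIV (Collect closed)" "approximable S (on_sphere (indicator A))"
    have "on_sphere (indicator (UNIV - A)) = on_sphere (indicator UNIV) + cscale (-1) (on_sphere (indicator A))"
      by (auto simp: on_sphere_def fun_eq_iff cscale_def indicator_def)
    moreover have "approximable S (on_sphere (indicator UNIV) + cscale (-1) (on_sphere (indicator A)))"
      by (intro approximable_add[OF S(2,3)] approximable_scale[OF S(2)] A(2) approximable_indicator_closed[OF S closed_UNIV])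
    ultimately show "approximable S (on_sphere (indicator (UNIV - A)))" by (simp only:)
  next
    fix B :: "nat \<Rightarrow> (quat ^ 'n) set"
    assume disj: "disjoint_family B" and B: "range B \<subseteq> sigma_sets UNIV (Collect closed)"
      and app: "\<And>i. approximable S (on_sphere (indicator (B i)))"
    let ?U = "\<Union>i. B i"
    have Bb: "B i \<in> sets borel" for i using B unfolding borel by auto
    have UL: "on_sphere (indicator ?U) \<in> L2 \<sigma>" using Bb by (intro indicator_L2) auto
    let ?s = "\<lambda>k. \<Sum>i<k. on_sphere (indicator (B i))"
    have sapp: "approximable S (?s k)" for k by (intro approximable_sum[OF S(2,3)] app)
    have s_eq: "?s k x = on_sphere (indicator (\<Union>i<k. B i)) x" for k x
      using disj unfolding sum_fun_apply on_sphere_def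
      by (auto simp: indicator_UN_disjoint disjoint_family_on_def)
    show "approximable S (on_sphere (indicator ?U))"
    proof (rule approximable_limit[OF S(3) UL sapp])
      show "(\<lambda>k. sq_norm (on_sphere (indicator ?U) - ?s k)) \<longlonglongrightarrow> 0"
      proof (rule sq_norm_tendsto_0[where w = "\<lambda>_. 1"])
        show "on_sphere (indicator ?U) - ?s k \<in> borel_measurable \<sigma>" for k
          using sapp[of k] by (intro L2_D(1) L2_diff UL) (simp add: approximable_def)
        show "(cmod ((on_sphere (indicator ?U) - ?s k) x))\<^sup>2 \<le> 1" for k x
          unfolding fun_diff_def s_eq by (auto simp: on_sphere_def indicator_def)
        show "(\<lambda>k. (on_sphere (indicator ?U) - ?s k) x) \<longlonglongrightarrow> 0" for x
        proof (rule tendsto_eventually)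
          show "\<forall>\<^sub>F k in sequentially. (on_sphere (indicator ?U) - ?s k) x = 0"
          proof (cases "x \<in> ?U")
            case True
            then obtain i where "x \<in> B i" by blast
            then have "(on_sphere (indicator ?U) - ?s k) x = 0" if "k \<ge> Suc i" for k
              unfolding fun_diff_def s_eq using that by (auto simp: on_sphere_def indicator_def)
            then show ?thesis unfolding eventually_sequentially by blast
          next
            case False
            then show ?thesis unfolding fun_diff_def s_eq by (auto simp: on_sphere_def indicator_def)
          qed
        qed
      qed simp
    qed
  qed
qed

lemma approximable_L2:
  assumes S: "\<And>P. P \<in> polyfun \<Longrightarrow> on_sphere P \<in> S" "cfun.subspace S" "S \<subseteq> L2 \<sigma>" and f: "f \<in> L2 \<sigma>"
  shows "approximable S f"
proof -
  obtain F where "\<forall>i. simple_function \<sigma> (F i)" "\<forall>x\<in>space \<sigma>. (\<lambda>i. F i x) \<longlonglongrightarrow> f x"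
    "\<forall>i. \<forall>x\<in>space \<sigma>. dist (F i x) 0 \<le> 2 * dist (f x) 0"
    using borel_measurable_implies_sequence_metric[OF L2_D(1)[OF f], of 0] by blast
  then have F: "\<And>i. simple_function \<sigma> (F i)" "\<And>x. x \<in> space \<sigma> \<Longrightarrow> (\<lambda>i. F i x) \<longlonglongrightarrow> f x"
    "\<And>i x. x \<in> space \<sigma> \<Longrightarrow> dist (F i x) 0 \<le> 2 * dist (f x) 0"
    by auto
  have app: "approximable S (on_sphere (F i))" for i
  proof -
    have "\<exists>A\<in>sets borel. F i -` {y} \<inter> space \<sigma> = A \<inter> qsphere" for y
      using simple_functionD(2)[OF F(1), of i "{y}"] unfolding sets_sigma sets_restrict_space by auto
    then obtain A where A: "\<And>y. A y \<in> sets borel" "\<And>y. F i -` {y} \<inter> space \<sigma> = A y \<inter> qsphere" by metis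
    have fin: "finite (F i ` space \<sigma>)" by (rule simple_functionD(1)[OF F(1)])
    have "on_sphere (F i) = (\<Sum>y\<in>F i ` space \<sigma>. cscale y (on_sphere (indicator (A y))))"
    proof
      fix x
      show "on_sphere (F i) x = (\<Sum>y\<in>F i ` space \<sigma>. cscale y (on_sphere (indicator (A y)))) x"
      proof (cases "x \<in> qsphere")
        case True
        have "x \<in> A y \<longleftrightarrow> F i x = y" for y using A(2)[of y] True by (auto simp: space_sigma)
        then have "(\<Sum>y\<in>F i ` space \<sigma>. cscale y (on_sphere (indicator (A y)))) x =
            (\<Sum>y\<in>F i ` space \<sigma>. if y = F i x then y else 0)"
          unfolding sum_fun_apply using True by (intro sum.cong) (auto simp: cscale_def on_sphere_def indicator_def)
        also have "\<dots> = F i x" using fin True by (simp add: space_sigma)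
        finally show ?thesis using True by (simp add: on_sphere_def)
      qed (simp add: on_sphere_def sum_fun_apply cscale_def)
    qed
    then show ?thesis
      by (simp only:) (intro approximable_sum[OF S(2,3)] approximable_scale[OF S(2)] approximable_indicator[OF S] A(1))
  qed
  have dom: "integrable \<sigma> (\<lambda>x. 9 * (cmod (f x))\<^sup>2)" using L2_D(2)[OF f] by simp
  show ?thesis
  proof (rule approximable_limit[OF S(3) f app])
    show "(\<lambda>k. sq_norm (f - on_sphere (F k))) \<longlonglongrightarrow> 0"
    proof (rule sq_norm_tendsto_0[OF _ _ dom])
      show "f - on_sphere (F k) \<in> borel_measurable \<sigma>" for k
        using app[of k] by (intro L2_D(1) L2_diff f) (simp add: approximable_def)
      show "(cmod ((f - on_sphere (F k)) x))\<^sup>2 \<le> 9 * (cmod (f x))\<^sup>2" if x: "x \<in> qsphere" for k x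
      proof -
        have "cmod (f x - F k x) \<le> 3 * cmod (f x)"
          using norm_triangle_ineq4[of "f x" "F k x"] F(3)[of x k] x by (simp add: space_sigma)
        then have "(cmod (f x - F k x))\<^sup>2 \<le> (3 * cmod (f x))\<^sup>2" by (intro power_mono) auto
        then show ?thesis using x by (simp add: on_sphere_def power_mult_distrib)
      qed
      show "(\<lambda>k. (f - on_sphere (F k)) x) \<longlonglongrightarrow> 0" if x: "x \<in> qsphere" for x
        using tendsto_diff[OF tendsto_const F(2)[of x], of "f x"] x by (simp add: space_sigma on_sphere_def)
    qed
  qed
qed

end

section \<open>Differential operators applied to restrictions of polynomials\<close>

lemma Ck_on_peval: "fin_supp f \<Longrightarrow> Ck_on k (peval f) UNIV"
proof (induction k arbitrary: f)
  case 0
  then show ?case by (simp add: continuous_on_peval)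
next
  case (Suc k)
  have "Ck_on k (\<lambda>x. frechet_derivative (peval f) (at x) v) UNIV" for v
  proof -
    let ?g = "\<Sum>i\<in>UNIV. cscale (coord i v) (pdiff i f)"
    have g: "fin_supp ?g" using Suc.prems by (intro fin_supp_sum fin_supp_scale fin_supp_pdiff)
    have "frechet_derivative (peval f) (at x) v = peval ?g x" for x
    proof -
      have "frechet_derivative (peval f) (at x) v = deriv1 f x v"
        using frechet_derivative_at[OF peval_has_derivative[OF Suc.prems]] by metis
      also have "\<dots> = peval ?g x"
        using Suc.prems by (simp add: deriv1_def peval_sum peval_scale fin_supp_scale fin_supp_pdiff mult.commute)
      finally show ?thesis .
    qed
    then have "(\<lambda>x. frechet_derivative (peval f) (at x) v) = peval ?g" by blast
    then show ?thesis using Suc.IH[OF g] by (simp only:)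
  qed
  moreover have "\<forall>x. peval f differentiable (at x)"
    using peval_has_derivative[OF Suc.prems] unfolding differentiable_def by blast
  ultimately show ?case by simp
qed

lemma smooth_on_sphere: "fin_supp f \<Longrightarrow> smooth_on_qsphere (on_sphere (peval f))"
  unfolding smooth_on_qsphere_def
  by (rule exI[of _ UNIV], rule exI[of _ "peval f"]) (simp add: Ck_on_peval on_sphere_def)

text \<open>
  The great circle through \<open>x\<close> with velocity \<open>v\<close>.
\<close>

lemma tangent_curve:
  assumes x: "x \<in> qsphere" and v: "v \<in> tangent_space x"
  obtains \<gamma> :: "real \<Rightarrow> quat ^ 'n" where "\<And>t. \<gamma> t \<in> qsphere" "\<gamma> 0 = x" "(\<gamma> has_derivative (\<lambda>t. t *\<^sub>R v)) (at 0)"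
proof (cases "v = 0")
  case True
  then show thesis using that[of "\<lambda>_. x"] x by simp
next
  case False
  define c where "c = norm v"
  have c: "c \<noteq> 0" using False by (simp add: c_def)
  (* The factor c accounts for velocities v that are not of unit length. *)
  define \<gamma> where "\<gamma> t = cos (c * t) *\<^sub>R x + (sin (c * t) / c) *\<^sub>R v" for t
  have xx: "x \<bullet> x = 1" and xv: "x \<bullet> v = 0" "v \<bullet> x = 0" and vv: "v \<bullet> v = c * c"
    using x v by (auto simp: qsphere_eq_sphere norm_eq_1 tangent_space_def inner_commute c_def dot_square_norm power2_eq_square)
  have "\<gamma> t \<bullet> \<gamma> t = 1" for t
  proof -
    have "\<gamma> t \<bullet> \<gamma> t = (cos (c * t))\<^sup>2 + (sin (c * t))\<^sup>2"
      unfolding \<gamma>_def using c by (simp add: inner_add_left inner_add_right xx xv vv power2_eq_square)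
    then show ?thesis by simp
  qed
  then have "\<gamma> t \<in> qsphere" for t by (simp add: qsphere_eq_sphere norm_eq_1)
  moreover have "(\<gamma> has_vector_derivative v) (at 0)"
  proof -
    have "(\<gamma> has_vector_derivative ((- sin (c * 0) * c) *\<^sub>R x + (cos (c * 0) * c / c) *\<^sub>R v)) (at 0)"
      unfolding \<gamma>_def
      by (rule has_vector_derivative_add; rule has_vector_derivative_scaleR[OF _ has_vector_derivative_const, THEN has_vector_derivative_eq_rhs])
        (auto intro!: derivative_eq_intros simp: c)
    then show ?thesis using c by simp
  qed
  ultimately show thesis using that[of \<gamma>] c by (simp add: has_vector_derivative_def \<gamma>_def)
qed

text \<open>
  Both derivatives compute the velocity of \<open>F\<close> along the same curve on the sphere.
\<close>

lemma sphere_deriv_unique: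
  assumes D: "(F has_derivative D) (at x within qsphere)" and E: "(F has_derivative E) (at x within qsphere)"
    and x: "x \<in> qsphere" and v: "v \<in> tangent_space (x :: quat ^ 'n)"
  shows "D v = E v"
proof -
  obtain \<gamma> where \<gamma>: "\<And>t. \<gamma> t \<in> qsphere" "\<gamma> 0 = x" "(\<gamma> has_derivative (\<lambda>t. t *\<^sub>R v)) (at 0)"
    using tangent_curve[OF x v] by metis
  have "((\<lambda>t. F (\<gamma> t)) has_derivative (\<lambda>t. D (t *\<^sub>R v))) (at 0)"
    "((\<lambda>t. F (\<gamma> t)) has_derivative (\<lambda>t. E (t *\<^sub>R v))) (at 0)"
    using has_derivative_in_compose[OF \<gamma>(3), of F D] has_derivative_in_compose[OF \<gamma>(3), of F E]
      has_derivative_subset[OF D, of "range \<gamma>"] has_derivative_subset[OF E, of "range \<gamma>"] \<gamma>(1,2) by auto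
  from fun_cong[OF has_derivative_unique[OF this], of 1] show ?thesis by simp
qed

lemma sphere_deriv_eq:
  assumes F: "(F has_derivative F') (at x)" and eq: "\<And>y. y \<in> qsphere \<Longrightarrow> G y = F y"
    and x: "x \<in> qsphere" and v: "v \<in> tangent_space (x :: quat ^ 'n)"
  shows "sphere_deriv G x v = F' v"
proof -
  have G: "(G has_derivative F') (at x within qsphere)"
    by (rule has_derivative_transform[OF x eq has_derivative_at_withinI[OF F]])
  then have "(G has_derivative sphere_deriv G x) (at x within qsphere)"
    using frechet_derivative_works differentiable_def by blast
  from sphere_deriv_unique[OF this G x v] show ?thesis .
qed

text \<open>
  The tangential gradient is \<open>\<nabla>\<Phi> - (x \<bullet> \<nabla>\<Phi>) x\<close>. Its derivative along a tangent vector \<open>p\<close>, paired with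
  \<open>p\<close>, is the Hessian at \<open>p\<close> minus \<open>(x \<bullet> \<nabla>\<Phi>) |p|\<^sup>2\<close>; the trace over the tangent space is the full trace minus
  the contribution of \<open>x\<close>.
\<close>

lemma real_laplace_beltrami_eq:
  fixes \<phi> :: "quat ^ 'n \<Rightarrow> real" and grad :: "quat ^ 'n \<Rightarrow> quat ^ 'n" and hess :: "quat ^ 'n \<Rightarrow> quat ^ 'n \<Rightarrow> quat ^ 'n"
  assumes \<Phi>: "\<And>y. (\<Phi> has_derivative (\<lambda>v. grad y \<bullet> v)) (at y)"
    and grad: "\<And>y. (grad has_derivative hess y) (at y)"
    and eq: "\<And>y. y \<in> qsphere \<Longrightarrow> \<phi> y = \<Phi> y" and x: "x \<in> qsphere"
  shows "real_laplace_beltrami \<phi> x =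
    - ((\<Sum>b\<in>Basis. hess x b \<bullet> b) - hess x x \<bullet> x - (real DIM(quat ^ 'n) - 1) * (x \<bullet> grad x))"
proof -
  have sph: "y \<bullet> y = 1" if "y \<in> qsphere" for y :: "quat ^ 'n"
    using that by (simp add: qsphere_eq_sphere norm_eq_1)
  define X where "X y = grad y - (y \<bullet> grad y) *\<^sub>R y" for y
  have sgrad: "sphere_grad \<phi> y = X y" if y: "y \<in> qsphere" for y
    unfolding sphere_grad_def
  proof (rule the_equality)
    have d: "sphere_deriv \<phi> y w = grad y \<bullet> w" if "w \<in> tangent_space y" for w
      by (rule sphere_deriv_eq[OF \<Phi> eq y that])
    show X: "X y \<in> tangent_space y \<and> (\<forall>w\<in>tangent_space y. X y \<bullet> w = sphere_deriv \<phi> y w)"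
      using sph[OF y] by (auto simp: d) (auto simp: X_def tangent_space_def inner_diff_left inner_diff_right)
    fix v assume v: "v \<in> tangent_space y \<and> (\<forall>w\<in>tangent_space y. v \<bullet> w = sphere_deriv \<phi> y w)"
    have "v - X y \<in> tangent_space y" using v X by (auto simp: tangent_space_def inner_diff_right)
    then have "(v - X y) \<bullet> (v - X y) = 0" using v X by (simp add: inner_diff_left)
    then show "v = X y" by simp
  qed
  let ?H = "hess x"
  have lH: "linear ?H" using has_derivative_linear[OF grad] .
  define X' where "X' v = ?H v - ((v \<bullet> grad x + x \<bullet> ?H v) *\<^sub>R x + (x \<bullet> grad x) *\<^sub>R v)" for v
  have dX: "(X has_derivative X') (at x)"
    unfolding X_def X'_def by (auto intro!: derivative_eq_intros grad simp: algebra_simps)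
  have summand: "tangent_proj x (sphere_deriv (sphere_grad \<phi>) x (tangent_proj x b)) \<bullet> b =
      ?H b \<bullet> b - (x \<bullet> b) * (?H x \<bullet> b) - (x \<bullet> b) * (?H b \<bullet> x) + (x \<bullet> b) * (x \<bullet> b) * (?H x \<bullet> x)
      - (x \<bullet> grad x) * (1 - (x \<bullet> b) * (x \<bullet> b))" if b: "b \<in> Basis" for b
  proof -
    (* The outer projection is moved to the other side of the inner product. *)
  define p where "p = tangent_proj x b"
    have p: "p = b - (x \<bullet> b) *\<^sub>R x" by (simp add: p_def tangent_proj_def)
    have px: "x \<bullet> p = 0" using sph[OF x] by (simp add: p inner_diff_right)
    have "sphere_deriv (sphere_grad \<phi>) x p = X' p"
      by (rule sphere_deriv_eq[OF dX sgrad x]) (auto simp: tangent_space_def px)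
    moreover have "tangent_proj x w \<bullet> b = w \<bullet> p" for w
      by (simp add: p tangent_proj_def inner_diff_left inner_diff_right inner_commute)
    ultimately have "tangent_proj x (sphere_deriv (sphere_grad \<phi>) x p) \<bullet> b = X' p \<bullet> p" by simp
    also have "\<dots> = ?H p \<bullet> p - (x \<bullet> grad x) * (p \<bullet> p)"
      by (simp add: X'_def inner_diff_left inner_add_left px)
    also have "p \<bullet> p = 1 - (x \<bullet> b) * (x \<bullet> b)"
      using sph[OF x] inner_Basis[OF b b] by (simp add: p inner_diff_left inner_diff_right inner_commute[of b x])
    also have "?H p \<bullet> p = ?H b \<bullet> b - (x \<bullet> b) * (?H x \<bullet> b) - (x \<bullet> b) * (?H b \<bullet> x) + (x \<bullet> b) * (x \<bullet> b) * (?H x \<bullet> x)"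
      by (simp add: p linear_diff[OF lH] linear_cmul[OF lH] inner_diff_left inner_diff_right algebra_simps)
    finally show ?thesis by (simp add: p_def)
  qed
  have s1: "(\<Sum>b\<in>Basis. (x \<bullet> b) * (?H x \<bullet> b)) = ?H x \<bullet> x"
    by (simp add: euclidean_inner[of "?H x" x] mult.commute)
  have s2: "(\<Sum>b\<in>Basis. (x \<bullet> b) * (?H b \<bullet> x)) = ?H x \<bullet> x"
  proof -
    have "?H x = (\<Sum>b\<in>Basis. (x \<bullet> b) *\<^sub>R ?H b)"
      using linear_sum[OF lH, of "\<lambda>b. (x \<bullet> b) *\<^sub>R b" Basis] by (simp add: euclidean_representation linear_cmul[OF lH])
    then show ?thesis by (simp add: inner_sum_left)
  qed
  have s3: "(\<Sum>b\<in>Basis. (x \<bullet> b) * (x \<bullet> b)) = 1"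
    using sph[OF x] by (simp add: euclidean_inner[of x x])
  have "sphere_div (sphere_grad \<phi>) x = (\<Sum>b\<in>Basis. ?H b \<bullet> b - (x \<bullet> b) * (?H x \<bullet> b) - (x \<bullet> b) * (?H b \<bullet> x)
      + (x \<bullet> b) * (x \<bullet> b) * (?H x \<bullet> x) - (x \<bullet> grad x) * (1 - (x \<bullet> b) * (x \<bullet> b)))"
    unfolding sphere_div_def by (rule sum.cong[OF refl summand])
  also have "\<dots> = (\<Sum>b\<in>Basis. ?H b \<bullet> b) - ?H x \<bullet> x - ?H x \<bullet> x + 1 * (?H x \<bullet> x)
      - (x \<bullet> grad x) * (real DIM(quat ^ 'n) - 1)"
    by (simp only: sum.distrib sum_subtractf s1 s2 sum_distrib_left[symmetric] sum_distrib_right[symmetric] s3 sum_constant) simp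
  finally show ?thesis unfolding real_laplace_beltrami_def by (simp add: algebra_simps)
qed

lemma real_laplace_beltrami_isotypic:
  fixes f :: "('n::finite) qpoly"
  assumes f: "f \<in> isotypic h m" and eq: "\<And>y. y \<in> qsphere \<Longrightarrow> \<phi> y = Re (peval f y)" and x: "x \<in> qsphere"
  shows "real_laplace_beltrami \<phi> x = real h * (real h + 4 * real CARD('n) - 2) * Re (peval f x)"
proof -
  note hom = isotypic_homogeneous[OF f]
  note ff = fin_supp_homogeneous[OF hom]
  define grad where "grad y = (\<Sum>b\<in>Basis. Re (deriv1 f y b) *\<^sub>R b)" for y
  define hess where "hess y v = (\<Sum>b\<in>Basis. Re (deriv2 f y b v) *\<^sub>R b)" for y v
  have lin: "(\<Sum>b\<in>Basis. Re (L b) * (b \<bullet> v)) = Re (L v)" if L: "linear L" for L :: "quat ^ 'n \<Rightarrow> complex" and v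
  proof -
    have "L v = (\<Sum>b\<in>Basis. (v \<bullet> b) *\<^sub>R L b)"
      using linear_sum[OF L, of "\<lambda>b. (v \<bullet> b) *\<^sub>R b" Basis] by (simp add: euclidean_representation linear_cmul[OF L])
    then show ?thesis by (simp add: mult.commute inner_commute)
  qed
  have ginner: "grad y \<bullet> v = Re (deriv1 f y v)" for y v
    using lin[OF linear_deriv1, of f y v] by (simp add: grad_def inner_sum_left)
  have hinner: "hess y v \<bullet> w = Re (deriv2 f y w v)" for y v w
  proof -
    have "linear (\<lambda>w. deriv2 f y w v)" using bilinear_deriv2[of f y] by (simp add: bilinear_def)
    from lin[OF this, of w] show ?thesis by (simp add: hess_def inner_sum_left)
  qed
  have d\<Phi>: "((\<lambda>y. Re (peval f y)) has_derivative (\<lambda>v. grad y \<bullet> v)) (at y)" for y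
    unfolding ginner by (rule has_derivative_Re[OF peval_has_derivative[OF ff]])
  have dgrad: "(grad has_derivative hess y) (at y)" for y
    unfolding grad_def [abs_def] hess_def [abs_def]
    by (intro has_derivative_sum has_derivative_scaleR_left has_derivative_Re deriv1_has_derivative ff)
  have tr: "(\<Sum>b\<in>Basis. hess x b \<bullet> b) = 0"
  proof -
    have "(\<Sum>b\<in>Basis. deriv2 f x b b) = 0" using f unfolding isotypic_iff[OF ff] by blast
    then show ?thesis unfolding hinner Re_sum[symmetric] by simp
  qed
  have "real_laplace_beltrami \<phi> x = - (0 - Re (deriv2 f x x x) - (real DIM(quat ^ 'n) - 1) * Re (deriv1 f x x))"
    using real_laplace_beltrami_eq[OF d\<Phi> dgrad eq x] unfolding tr unfolding hinner ginner[symmetric] by (simp add: inner_commute)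
  also have "\<dots> = real h * (real h + 4 * real CARD('n) - 2) * Re (peval f x)"
    unfolding deriv2_homogeneous[OF ff hom] deriv1_homogeneous[OF ff hom] DIM_quat_vec
    by (simp add: algebra_simps)
  finally show ?thesis .
qed

text \<open>
  The imaginary part of the evaluation of \<open>f\<close> is the real part of that of \<open>- \<i> f\<close>, and the
  isotypic space is complex.
\<close>

lemma laplace_beltrami_isotypic:
  fixes f :: "('n::finite) qpoly"
  assumes f: "f \<in> isotypic h m" and x: "x \<in> qsphere"
  shows "laplace_beltrami (on_sphere (peval f)) x
    = of_real (real h * (real h + 4 * real CARD('n) - 2)) * on_sphere (peval f) x"
proof -
  have ff: "fin_supp f" using f isotypic_homogeneous fin_supp_homogeneous by metis
  have ps: "peval (cscale (- \<i>) f) y = - \<i> * peval f y" for y by (rule peval_scale[OF ff])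
  have g: "cscale (- \<i>) f \<in> isotypic h m"
    by (rule cfun.subspace_scale[OF fin_dim_subspace[OF fin_dim_isotypic] f])
  have "real_laplace_beltrami (\<lambda>y. Re (on_sphere (peval f) y)) x = real h * (real h + 4 * real CARD('n) - 2) * Re (peval f x)"
    by (rule real_laplace_beltrami_isotypic[OF f _ x]) (simp add: on_sphere_def)
  moreover have "real_laplace_beltrami (\<lambda>y. Im (on_sphere (peval f) y)) x
      = real h * (real h + 4 * real CARD('n) - 2) * Re (peval (cscale (- \<i>) f) x)"
    by (rule real_laplace_beltrami_isotypic[OF g _ x]) (simp add: ps on_sphere_def del: cfun.scale_minus_left)
  ultimately show ?thesis
    using x unfolding ps by (simp add: laplace_beltrami_def on_sphere_def complex_eq_iff)
qed

lemma norm_exp_unit: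
  assumes u: "u \<in> {quat_i, quat_j, quat_k}"
  shows "norm (exp (- (t *\<^sub>R u))) = 1"
proof -
  define \<gamma> where "\<gamma> t = exp (t *\<^sub>R (- u))" for t :: real
  have perp: "q \<bullet> (u * q) = 0" for q
    using u by (auto simp: quat_i_def quat_j_def quat_k_def inner_quat_def times_quat_def)
  have d: "(\<gamma> has_vector_derivative - u * \<gamma> t) (at t)" for t
    unfolding \<gamma>_def by (rule exp_scaleR_has_vector_derivative_left)
  have "((\<lambda>t. \<gamma> t \<bullet> \<gamma> t) has_derivative (\<lambda>_. 0)) (at t within UNIV)" for t
  proof -
    have "((\<lambda>t. \<gamma> t \<bullet> \<gamma> t) has_derivative (\<lambda>s. \<gamma> t \<bullet> (s *\<^sub>R (- u * \<gamma> t)) + (s *\<^sub>R (- u * \<gamma> t)) \<bullet> \<gamma> t)) (at t)"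
      using d[of t] unfolding has_vector_derivative_def by (intro has_derivative_inner)
    moreover have "\<gamma> t \<bullet> (s *\<^sub>R (- u * \<gamma> t)) + (s *\<^sub>R (- u * \<gamma> t)) \<bullet> \<gamma> t = 0" for s
      using perp[of "\<gamma> t"] by (simp add: inner_commute)
    ultimately show ?thesis by simp
  qed
  then have "\<gamma> t \<bullet> \<gamma> t = \<gamma> 0 \<bullet> \<gamma> 0" by (rule has_derivative_zero_unique[OF convex_UNIV]) auto
  also have "\<dots> = 1" by (simp add: \<gamma>_def inner_quat_def one_quat_def)
  finally show ?thesis by (simp add: \<gamma>_def norm_eq_1)
qed

text \<open>
  The flow of \<open>T_op u\<close> preserves the norm, hence the sphere and its complement, so the convention that
  functions vanish off the sphere is compatible with the operator.
\<close>

lemma T_op_on_sphere: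
  fixes F :: "quat ^ 'n \<Rightarrow> complex"
  assumes u: "u \<in> {quat_i, quat_j, quat_k}" and F: "\<And>x. (F has_derivative F' x) (at x)"
  shows "T_op u (on_sphere F) = on_sphere (\<lambda>x. - F' x (u *s x))"
proof
  fix x :: "quat ^ 'n"
  have "norm (exp (- (t *\<^sub>R u)) *s x) = norm x" for t
    unfolding norm_vec_def by (simp add: vector_scalar_mult_def norm_mult norm_exp_unit[OF u])
  then have sph: "exp (- (t *\<^sub>R u)) *s x \<in> qsphere \<longleftrightarrow> x \<in> qsphere" for t by (simp add: qsphere_eq_sphere)
  show "T_op u (on_sphere F) x = on_sphere (\<lambda>x. - F' x (u *s x)) x"
  proof (cases "x \<in> qsphere")
    case False
    then show ?thesis unfolding T_op_def on_sphere_def sph by simp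
  next
    case True
    have "((\<lambda>t. exp (- (t *\<^sub>R u))) has_vector_derivative - u * exp (0 *\<^sub>R (- u))) (at 0)"
      using exp_scaleR_has_vector_derivative_left[of "- u" 0] by simp
    then have "((\<lambda>t. exp (- (t *\<^sub>R u))) has_derivative (\<lambda>s. s *\<^sub>R (- u))) (at 0)"
      by (simp add: has_vector_derivative_def)
    moreover have "bounded_linear (\<lambda>c. c *s x)"
      using linear_scalar_left by (simp add: linear_conv_bounded_linear)
    ultimately have "((\<lambda>t. exp (- (t *\<^sub>R u)) *s x) has_derivative (\<lambda>s. (s *\<^sub>R (- u)) *s x)) (at 0)"
      by (rule bounded_linear.has_derivative[rotated])
    moreover have one: "exp (- (0 *\<^sub>R u)) *s x = x" by (simp add: vec_eq_iff)
    ultimately have "((\<lambda>t. F (exp (- (t *\<^sub>R u)) *s x)) has_derivative (\<lambda>s. F' x ((s *\<^sub>R (- u)) *s x))) (at 0)"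
      using has_derivative_compose[of "\<lambda>t. exp (- (t *\<^sub>R u)) *s x" _ 0 UNIV F "F' x"] F[of x] by simp
    moreover have "F' x ((s *\<^sub>R (- u)) *s x) = s *\<^sub>R (- F' x (u *s x))" for s
    proof -
      have "(s *\<^sub>R (- u)) *s x = (- s) *\<^sub>R (u *s x)" by (simp add: vec_eq_iff)
      then show ?thesis by (simp only: linear_cmul[OF has_derivative_linear[OF F]]) simp
    qed
    ultimately have "((\<lambda>t. F (exp (- (t *\<^sub>R u)) *s x)) has_vector_derivative - F' x (u *s x)) (at 0)"
      by (simp add: has_vector_derivative_def)
    from vector_derivative_at[OF this] show ?thesis
      using True unfolding T_op_def on_sphere_def sph by simp
  qed
qed

lemma T_op_twice:
  assumes u: "u \<in> {quat_i, quat_j, quat_k}" and f: "fin_supp f"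
  shows "T_op u (T_op u (on_sphere (peval f))) = on_sphere (second_lie f (\<lambda>x. u *s x))"
proof -
  have 1: "T_op u (on_sphere (peval f)) = on_sphere (\<lambda>x. - deriv1 f x (u *s x))"
    by (rule T_op_on_sphere[OF u peval_has_derivative[OF f]])
  have "((\<lambda>x. - deriv1 f x (u *s x)) has_derivative (\<lambda>w. - (deriv2 f x (u *s x) w + deriv1 f x (u *s w)))) (at x)" for x
    by (rule has_derivative_minus[OF lie_derivative[OF f linear_scalar_right]])
  from T_op_on_sphere[OF u this] show ?thesis unfolding 1 by (simp add: second_lie_def[abs_def] add.commute)
qed

lemma Gamma_op_isotypic:
  assumes f: "f \<in> isotypic h m" and x: "x \<in> qsphere"
  shows "Gamma_op (on_sphere (peval f)) x =
    of_real ((real h - 2 * real m) * (real h - 2 * real m + 2)) * on_sphere (peval f) x"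
proof -
  note hom = isotypic_homogeneous[OF f]
  note ff = fin_supp_homogeneous[OF hom]
  have ne: "quat_i \<noteq> quat_j" "quat_i \<noteq> quat_k" "quat_j \<noteq> quat_k"
    by (simp_all add: quat_i_def quat_j_def quat_k_def)
  have "Gamma_op (on_sphere (peval f)) x = - (\<Sum>u\<in>{quat_i, quat_j, quat_k}. second_lie f (\<lambda>x. u *s x) x)"
    using x ne by (simp add: Gamma_op_def T_op_twice[OF _ ff] on_sphere_def)
  also have "(\<Sum>u\<in>{quat_i, quat_j, quat_k}. second_lie f (\<lambda>x. u *s x) x) =
      casimir_value h m * peval f x - of_real (real h * (real h - 1)) * peval f x - 3 * (of_nat h * peval f x)"
    using f unfolding sum_unit_rotation deriv2_homogeneous[OF ff hom] deriv1_homogeneous[OF ff hom] isotypic_iff[OF ff]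
    by simp
  also have "- \<dots> = of_real ((real h - 2 * real m) * (real h - 2 * real m + 2)) * on_sphere (peval f) x"
    using x by (simp add: on_sphere_def casimir_value_def algebra_simps)
  finally show ?thesis .
qed

lemma sub_laplacian_isotypic:
  fixes f :: "('n::finite) qpoly"
  assumes f: "f \<in> isotypic h m" and x: "x \<in> qsphere"
  shows "sub_laplacian (on_sphere (peval f)) x =
    of_real (4 * real m * (real h - real m + 1) + 4 * (real CARD('n) - 1) * real h) * on_sphere (peval f) x"
  unfolding sub_laplacian_def laplace_beltrami_isotypic[OF f x] Gamma_op_isotypic[OF f x]
  by (simp add: algebra_simps)

section \<open>The decomposition\<close>

definition degree_part :: "nat \<Rightarrow> (('i::finite \<Rightarrow> nat) \<Rightarrow> complex) \<Rightarrow> ('i \<Rightarrow> nat) \<Rightarrow> complex" where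
  "degree_part h f = (\<lambda>e. if total_degree e = h then f e else 0)"

text \<open>
  Evaluation is additive only on polynomials of finite support; composing with the projection to one
  degree gives a linear map on all coefficient functions.
\<close>

definition sphere_eval ::
    "nat \<Rightarrow> ('n::finite) qpoly \<Rightarrow> quat ^ 'n \<Rightarrow> complex" where
  "sphere_eval h f = on_sphere (peval (degree_part h f))"

lemma homogeneous_degree_part: "homogeneous h (degree_part h f)"
  by (simp add: homogeneous_def degree_part_def)

lemma sphere_eval_homogeneous:
  assumes "homogeneous h f" shows "sphere_eval h f = on_sphere (peval f)"
proof -
  have "degree_part h f = f" using assms by (auto simp: homogeneous_def degree_part_def fun_eq_iff)
  then show ?thesis by (simp add: sphere_eval_def)
qed

lemma clinear_sphere_eval: "clinear (sphere_eval h)"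
proof (rule clinearI)
  note fs = fin_supp_homogeneous[OF homogeneous_degree_part]
  show "sphere_eval h (f + g) = sphere_eval h f + sphere_eval h g" for f g
  proof -
    have "degree_part h (f + g) = degree_part h f + degree_part h g" by (auto simp: degree_part_def fun_eq_iff)
    then have "peval (degree_part h (f + g)) x = peval (degree_part h f) x + peval (degree_part h g) x" for x
      by (simp only: peval_add fs)
    then show ?thesis by (auto simp: sphere_eval_def on_sphere_def fun_eq_iff)
  qed
  show "sphere_eval h (cscale c f) = cscale c (sphere_eval h f)" for c f
  proof -
    have "degree_part h (cscale c f) = cscale c (degree_part h f)"
      by (auto simp: degree_part_def cscale_def fun_eq_iff)
    then have "peval (degree_part h (cscale c f)) x = c * peval (degree_part h f) x" for x
      by (simp only: peval_scale fs)
    then show ?thesis by (auto simp: sphere_eval_def on_sphere_def cscale_def fun_eq_iff)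
  qed
qed

text \<open>
  A homogeneous function is determined by its values on the sphere.
\<close>

lemma sphere_eval_injective:
  assumes f: "homogeneous h f" and 0: "sphere_eval h f = (0 :: quat ^ 'n::finite \<Rightarrow> complex)"
  shows "f = 0"
proof (rule peval_injective[OF fin_supp_homogeneous[OF f]])
  fix x :: "quat ^ 'n"
  have z: "peval f y = 0" if "y \<in> qsphere" for y
    using fun_cong[OF 0, of y] that by (simp add: sphere_eval_homogeneous[OF f] on_sphere_def)
  obtain e :: "quat ^ 'n" where e: "e \<in> qsphere"
    using vector_choose_size[of 1] by (auto simp: qsphere_eq_sphere)
  define y where "y = (if x = 0 then e else x /\<^sub>R norm x)"
  have "x = norm x *\<^sub>R y" "y \<in> qsphere" using e by (simp_all add: y_def qsphere_eq_sphere)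
  then show "peval f x = 0" using homogeneous_peval_scale[OF f, of "norm x" y] z[of y] by simp
qed

definition component :: "nat \<times> nat \<Rightarrow> (quat ^ 'n::finite \<Rightarrow> complex) set" where
  "component p = sphere_eval (fst p) ` isotypic (fst p) (snd p)"

lemma componentE:
  assumes "F \<in> component (h, m)"
  obtains f where "f \<in> isotypic h m" "F = on_sphere (peval f)" "fin_supp f"
proof -
  obtain f where f: "f \<in> isotypic h m" "F = sphere_eval h f" using assms unfolding component_def by auto
  note hom = isotypic_homogeneous[OF f(1)]
  show thesis
    by (rule that[OF f(1)]) (simp_all add: f(2) sphere_eval_homogeneous[OF hom] fin_supp_homogeneous[OF hom])
qed

lemma component_on_sphere:
  assumes "f \<in> isotypic h m" shows "on_sphere (peval f) \<in> component (h, m)"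
  unfolding component_def sphere_eval_homogeneous[OF isotypic_homogeneous[OF assms], symmetric]
  using assms by simp

lemma fin_dim_component: "fin_dim (component p)"
  unfolding component_def by (rule fin_dim_image[OF fin_dim_isotypic clinear_sphere_eval])

lemma dim_component:
  "cfun.dim (component (h, m) :: (quat ^ 'n::finite \<Rightarrow> complex) set) =
   cfun.dim (isotypic h m :: 'n qpoly set)"
  unfolding component_def fst_conv snd_conv
proof (rule dim_image_injective[OF fin_dim_isotypic clinear_sphere_eval])
  fix f :: "'n qpoly"
  assume "f \<in> isotypic h m" "sphere_eval h f = 0"
  then show "f = 0" by (intro sphere_eval_injective isotypic_homogeneous)
qed

lemma component_invariant:
  assumes A: "A \<in> Sp1_Sp_group" and F: "F \<in> component (h, m)"
  shows "F \<circ> A \<in> component (h, m)"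
proof -
  obtain f where f: "f \<in> isotypic h m" "F = on_sphere (peval f)" using F by (rule componentE)
  have qA: "quaternionic_isometry A" by (rule quaternionic_isometry_Sp1_Sp[OF A])
  obtain g where g: "g \<in> isotypic h m" "\<And>x. peval g x = peval f (A x)" using isotypic_invariant[OF qA f(1)] by metis
  have "norm (A x) = norm x" for x
    using qA by (simp add: quaternionic_isometry_def orthogonal_transformation_norm)
  then have "F \<circ> A = on_sphere (peval g)" by (auto simp: f(2) on_sphere_def g(2) qsphere_eq_sphere fun_eq_iff)
  then show ?thesis using component_on_sphere[OF g(1)] by simp
qed

text \<open>
  On the sphere the factor \<open>|x|\<^sup>2\<close> is invisible, so the harmonic decomposition descends by induction on
  the degree.
\<close>

lemma bihom_in_span:
  assumes "f \<in> bihom \<alpha> \<beta>"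
  shows "on_sphere (peval f) \<in> cfun.span (\<Union>p\<in>I_H. component p)"
  using assms
proof (induction \<alpha> arbitrary: \<beta> f rule: less_induct)
  case (less \<alpha>)
  let ?S = "cfun.span (\<Union>p\<in>I_H. component p :: (quat ^ 'a \<Rightarrow> complex) set)"
  have harm: "on_sphere (peval g) \<in> ?S" if g: "g \<in> harmonic \<alpha> \<beta>" for g
  proof -
    let ?h = "\<alpha> + \<beta>"
    have "g \<in> bihom \<alpha> \<beta>" using g by (simp add: harmonic_def)
    then have hom: "homogeneous ?h g"
      by (auto simp: homogeneous_def bihom_def exponents_def total_degree_bidegree)
    have "g \<in> cfun.span (\<Union>m\<in>{m. 2 * m \<le> ?h}. isotypic_weight ?h m \<beta>)"
      using g by (intro harmonic_isotypic_span) simp_all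
    then have "sphere_eval ?h g \<in> cfun.span (sphere_eval ?h ` (\<Union>m\<in>{m. 2 * m \<le> ?h}. isotypic_weight ?h m \<beta>))"
      unfolding cpair.linear_span_image[OF clinear_sphere_eval] by (rule imageI)
    also have "\<dots> \<subseteq> ?S"
    proof (rule cfun.span_mono)
      show "sphere_eval ?h ` (\<Union>m\<in>{m. 2 * m \<le> ?h}. isotypic_weight ?h m \<beta>) \<subseteq> (\<Union>p\<in>I_H. component p)"
        using isotypic_weight_subset[of \<beta> ?h] by (fastforce simp: component_def I_H_def)
    qed
    finally show ?thesis by (simp only: sphere_eval_homogeneous[OF hom])
  qed
  show ?case
    using less.prems
  proof (cases rule: harmonic_decomposition)
    case (1 g)
    then show ?thesis using harm by simp
  next
    case (2 \<alpha>' \<beta>' g k)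
    have fs: "fin_supp g" "fin_supp k" "fin_supp (radius2 k)"
      using 2 fin_supp_bihom fin_supp_radius2 by (auto simp: harmonic_def)
    have "on_sphere (peval f) = on_sphere (peval g) + on_sphere (peval k)"
      using fs by (auto simp: 2(5) on_sphere_def peval_add peval_radius2 qsphere_eq_sphere fun_eq_iff)
    moreover have "on_sphere (peval k) \<in> ?S" using less.IH[OF _ 2(4)] 2(1) by simp
    ultimately show ?thesis using harm[OF 2(3)] by (simp only: cfun.span_add)
  qed
qed

lemma polyfun_in_span:
  assumes "P \<in> polyfun"
  shows "on_sphere P \<in> cfun.span (\<Union>p\<in>I_H. component p)"
proof -
  obtain f where P: "P = peval f" using assms by (auto simp: polyfun_def)
  have mono: "peval (monomial e) x = (\<Prod>i\<in>UNIV. coord i x ^ e i)" for e and x :: "quat ^ 'a"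
  proof -
    have "{d. monomial e d \<noteq> 0} = {e}" by (auto simp: monomial_def)
    then show ?thesis by (simp add: peval_def monomial_def)
  qed
  have "on_sphere P = (\<Sum>e | f e \<noteq> 0. cscale (f e) (on_sphere (peval (monomial e))))"
  proof -
    have "peval f x = (\<Sum>e | f e \<noteq> 0. f e * peval (monomial e) x)" for x
      unfolding mono by (rule peval_def)
    then show ?thesis by (simp add: fun_eq_iff on_sphere_def sum_fun_apply cscale_def P)
  qed
  also have "\<dots> \<in> cfun.span (\<Union>p\<in>I_H. component p)"
  proof (intro cfun.span_sum cfun.span_scale bihom_in_span)
    show "monomial e \<in> bihom (bidegree False e) (bidegree True e)" for e :: "('a \<times> bool) \<times> bool \<Rightarrow> nat"
      by (simp add: bihom_def exponents_def monomial_def)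
  qed
  finally show ?thesis .
qed

context invariant_measure
begin

lemma component_L2: "component p \<subseteq> L2 \<sigma>"
proof
  fix F :: "quat ^ 'n \<Rightarrow> complex" assume "F \<in> component p"
  then obtain f where "F = on_sphere (peval f)" "fin_supp f"
    using componentE[of F "fst p" "snd p"] by auto
  then show "F \<in> L2 \<sigma>" by (simp add: on_sphere_L2 continuous_on_peval)
qed

lemma component_hilbert_sum: "hilbert_direct_sum \<sigma> I_H component"
  unfolding hilbert_direct_sum_def
proof (intro conjI ballI allI impI)
  fix p :: "nat \<times> nat" assume p: "p \<in> I_H"
  show "component p \<subseteq> L2 \<sigma>" by (rule component_L2)
  show "cfun.subspace (component p)" by (rule fin_dim_subspace[OF fin_dim_component])
  show "F = 0" if F: "F \<in> component p" and ae: "AE x in \<sigma>. F x = 0" for F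
  proof -
    obtain f where f: "F = on_sphere (peval f)" "fin_supp f"
      using componentE[of F "fst p" "snd p"] F by auto
    have ae: "AE x in \<sigma>. peval f x = 0"
      using ae AE_space by eventually_elim (simp add: f(1) on_sphere_def space_sigma)
    have "peval f x = 0" if "x \<in> qsphere" for x
      by (rule continuous_AE_zero[OF continuous_on_peval[OF f(2)] ae that])
    then show "F = 0" by (simp add: f(1) on_sphere_def fun_eq_iff)
  qed
  show "\<exists>G\<in>component p. AE x in \<sigma>. F x = G x"
    if "F \<in> L2 \<sigma>" "\<forall>\<epsilon>>0. \<exists>G\<in>component p. L2_norm \<sigma> (F - G) < \<epsilon>" for F
  proof (rule finite_dim_closed[OF fin_dim_component component_L2 that(1)])
    fix \<epsilon> :: real assume "\<epsilon> > 0"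
    with that(2) show "\<exists>G\<in>component p. L2_norm \<sigma> (F - G) < \<epsilon>" by simp
  qed
next
  fix p q :: "nat \<times> nat" and F G :: "quat ^ 'n \<Rightarrow> complex"
  assume pq: "p \<in> I_H" "q \<in> I_H" "p \<noteq> q" and F: "F \<in> component p" and G: "G \<in> component q"
  obtain f where f: "f \<in> isotypic (fst p) (snd p)" "F = on_sphere (peval f)"
    using componentE[of F "fst p" "snd p"] F by auto
  obtain g where g: "g \<in> isotypic (fst q) (snd q)" "G = on_sphere (peval g)"
    using componentE[of G "fst q" "snd q"] G by auto
  have "L2_inner \<sigma> F G = (LINT x|\<sigma>. peval f x * cnj (peval g x))"
    unfolding L2_inner_def by (rule Bochner_Integration.integral_cong) (auto simp: f(2) g(2) on_sphere_def space_sigma)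
  also have "\<dots> = 0" using pq by (intro isotypic_orthogonal[OF f(1) g(1)]) (auto simp: I_H_def)
  finally show "L2_inner \<sigma> F G = 0" .
next
  fix F and \<epsilon> :: real assume F: "F \<in> L2 \<sigma>" and e: "\<epsilon> > 0"
  let ?S = "cfun.span (\<Union>p\<in>I_H. component p) :: (quat ^ 'n \<Rightarrow> complex) set"
  have "?S \<subseteq> L2 \<sigma>" by (rule cfun.span_minimal[OF _ L2_subspace]) (use component_L2 in blast)
  then have "approximable ?S F" by (intro approximable_L2 polyfun_in_span cfun.subspace_span F)
  then obtain G where "G \<in> ?S" "sq_norm (F - G) < \<epsilon>\<^sup>2" using e unfolding approximable_def by (meson zero_less_power)
  then show "\<exists>G\<in>?S. L2_norm \<sigma> (F - G) < \<epsilon>" using L2_norm_less_iff[OF e] by blast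
qed

end

theorem proposition2p1:
  fixes \<sigma> :: "(quat ^ 'n) measure" and n :: nat
  assumes n: "n = CARD('n)" "n \<ge> 2"
    and \<sigma>: "rotation_invariant_prob \<sigma>"
  shows "\<exists>H :: nat \<times> nat \<Rightarrow> (quat ^ 'n \<Rightarrow> complex) set.
    hilbert_direct_sum \<sigma> I_H H \<and>
    (\<forall>(h, m) \<in> I_H.
       (\<forall>A \<in> Sp1_Sp_group. \<forall>f \<in> H (h, m). f \<circ> A \<in> H (h, m)) \<and>
       (\<exists>B. finite B \<and> cfun.span B = H (h, m)) \<and>
       real (cfun.dim (H (h, m))) =
         (real h - 2 * real m + 1)\<^sup>2 * (real h + 2 * real n - 1)
           / ((2 * real n - 2) * (2 * real n - 1))
         * real ((h - m + 2 * n - 2) choose (2 * n - 3))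
         * real ((m + 2 * n - 3) choose (2 * n - 3)) \<and>
       (\<forall>f \<in> H (h, m).
          eigenfunction laplace_beltrami (of_real (real h * (real h + 4 * real n - 2))) f \<and>
          eigenfunction Gamma_op
            (of_real ((real h - 2 * real m) * (real h - 2 * real m + 2))) f \<and>
          eigenfunction sub_laplacian
            (of_real (4 * real m * (real h - real m + 1) + 4 * (real n - 1) * real h)) f))"
proof (rule exI[of _ component], rule conjI, goal_cases)
  interpret invariant_measure \<sigma> by unfold_locales (rule \<sigma>)
  case 1
  show ?case by (rule component_hilbert_sum)
next
  case 2
  show ?case
  proof (unfold I_H_def, clarify, goal_cases)
    case (1 h m)
    note hm = 1
    show ?case
    proof (intro conjI ballI)
      show "f \<circ> A \<in> component (h, m)" if "A \<in> Sp1_Sp_group" "f \<in> component (h, m)" for A f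
        using that by (rule component_invariant)
      show "\<exists>B. finite B \<and> cfun.span B = component (h, m)" using fin_dim_basis[OF fin_dim_component] by metis
      show "real (cfun.dim (component (h, m) :: (quat ^ 'n \<Rightarrow> complex) set)) =
           (real h - 2 * real m + 1)\<^sup>2 * (real h + 2 * real n - 1)
             / ((2 * real n - 2) * (2 * real n - 1))
           * real ((h - m + 2 * n - 2) choose (2 * n - 3))
           * real ((m + 2 * n - 3) choose (2 * n - 3))"
        using dim_isotypic[OF hm, where 'n = 'n] n unfolding dim_component by simp
    next
      fix F :: "quat ^ 'n \<Rightarrow> complex" assume "F \<in> component (h, m)"
      then obtain f where f: "f \<in> isotypic h m" "F = on_sphere (peval f)" "fin_supp f" by (rule componentE)
      note smooth = smooth_on_sphere[OF f(3)]
      show "eigenfunction laplace_beltrami (of_real (real h * (real h + 4 * real n - 2))) F"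
        unfolding eigenfunction_def f(2) n(1) using smooth laplace_beltrami_isotypic[OF f(1)] by blast
      show "eigenfunction Gamma_op (of_real ((real h - 2 * real m) * (real h - 2 * real m + 2))) F"
        unfolding eigenfunction_def f(2) using smooth Gamma_op_isotypic[OF f(1)] by blast
      show "eigenfunction sub_laplacian
              (of_real (4 * real m * (real h - real m + 1) + 4 * (real n - 1) * real h)) F"
        unfolding eigenfunction_def f(2) n(1) using smooth sub_laplacian_isotypic[OF f(1)] by blast
    qed
  qed
qed

end
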